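(* Let $\alpha\in(1,2)$. Assume that $\sum_{n\ge1}\beta_n^\alpha/\gamma_n<\infty$, that $F:H\to H$ is Lipschitz continuous and bounded, and that there exist $\gamma\in[1/\alpha,1)$ and $C_1>0$ such that $$\beta_n\ge C_1\,\gamma_n^{\frac1\alpha-\gamma},\qquad n\ge1 .$$ Then, for any $t>0$, the transition semigroup operator $P_t$ maps Borel and bounded functions on $H$ into Lipschitz continuous functions. Moreover, there exists a constant $\tilde C=\tilde C(\gamma,c_\alpha,C_1,\|F\|_0)>0$ such that, for any $x,y\in H$, $$|P_tf(x)-P_tf(y)|\le\tilde C\,\|f\|_0\,\frac{1}{t^\gamma\wedge1}\,|x-y|,\qquad t>0,\ f\in B_b(H).$$
   Context: Let $H$ be a real separable (infinite-dimensional) Hilbert space with norm $|\cdot|$ and a fixed orthonormal basis $(e_n)_{n\ge1}$. $(Z^n_t)_{t\ge0}$, $n\ge1$, are independent real normalized symmetric $\alpha$-stable Lévy processes, $\mathbb E[e^{ihZ^n_t}]=e^{-t|h|^\alpha}$, on a stochastic basis $(\Omega,\mathcal F,(\mathcal F_t)_{t\ge0},\mathbb P)$ satisfying the usual assumptions (each $Z^n$ adapted, increments after time $s$ independent of $\mathcal F_s$). $(\beta_n)$ is a sequence of positive reals. $A:D(A)\subset H\to H$ is self-adjoint with $e_n\in D(A)$, $Ae_n=-\gamma_ne_n$, $\gamma_n>0$, $\gamma_n\to+\infty$; $e^{tA}e_k=e^{-\gamma_kt}e_k$. Set $Z_A(t)=\sum_{n\ge1}\big(\int_0^te^{-\gamma_n(t-s)}\beta_n\,dZ_s^n\big)e_n$,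 which is $H$-valued under $\sum_n\beta_n^\alpha/\gamma_n<\infty$ and has a predictable version, which is the one used. For $x\in H$, $X=(X_t^x)_{t\ge0}$ denotes the unique mild solution of $dX_t=AX_tdt+F(X_t)dt+dZ_t$, $X_0=x$, with $Z_t=\sum_n\beta_nZ^n_te_n$ (a cylindrical process), i.e. the predictable $H$-valued process such that for every $t\ge0$, $\mathbb P$-a.s., $X_t^x=e^{tA}x+\int_0^te^{(t-s)A}F(X_s^x)\,ds+Z_A(t)$. The transition semigroup is $P_tf(x)=\mathbb E[f(X_t^x)]$, $f\in B_b(H)$, $t\ge0$. $B_b(H)$ is the space of real bounded Borel functions on $H$; $\|f\|_0=\sup_x|f(x)|$, $\|F\|_0=\sup_x|F(x)|$. $p_\alpha$ is the density of the probability measure on $\mathbb R$ with characteristic function $e^{-|s|^\alpha}$ and $c_\alpha=\frac18\int_{\mathbb R}\frac{p_\alpha'(z)^2}{p_\alpha(z)}\,dz$. $a\wedge b=\min(a,b)$. The number $\alpha$ is fixed throughout. *)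

theory Defs
  imports "HOL-Probability.Probability"
begin

section \<open>The constant \<open>c\<^sub>\<alpha>\<close>\<close>

text \<open>A Lebesgue density is unique only almost everywhere; the continuous one is unique.\<close>

definition stable_density :: "real \<Rightarrow> real \<Rightarrow> real" where
  "stable_density \<alpha> = (THE p. continuous_on UNIV p \<and> (\<forall>z. 0 \<le> p z) \<and>
     prob_space (density lborel (\<lambda>z. ennreal (p z))) \<and>
     (\<forall>s. char (density lborel (\<lambda>z. ennreal (p z))) s = of_real (exp (- (\<bar>s\<bar> powr \<alpha>)))))"

definition c_stable :: "real \<Rightarrow> real" where
  "c_stable \<alpha> = 1 / 8 * (LINT z|lborel. (deriv (stable_density \<alpha>) z)\<^sup>2 / stable_density \<alpha> z)"


section \<open>Bounded Borel functions\<close>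

definition sup_norm :: "('a \<Rightarrow> 'b::real_normed_vector) \<Rightarrow> real" where
  "sup_norm f = (SUP x. norm (f x))"

definition bounded_borel :: "('a::topological_space \<Rightarrow> real) set" where
  "bounded_borel = {f. f \<in> borel_measurable borel \<and> bounded (range f)}"

definition lipschitz :: "('a::metric_space \<Rightarrow> 'b::metric_space) \<Rightarrow> bool" where
  "lipschitz f \<longleftrightarrow> (\<exists>L. L-lipschitz_on UNIV f)"


section \<open>The linear part\<close>

definition orthonormal_basis :: "(nat \<Rightarrow> 'h::real_inner) \<Rightarrow> bool" where
  "orthonormal_basis e \<longleftrightarrow>
     (\<forall>m n. e m \<bullet> e n = (if m = n then 1 else 0)) \<and> closure (span (range e)) = UNIV"

text \<open>An unbounded operator is a pair of a domain \<open>D\<close> and a total function \<open>A\<close>, of which only the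
  restriction to \<open>D\<close> matters. The last conjunct below says that \<open>D\<close> is the domain of the adjoint
  and that \<open>A\<close> is the adjoint on it.\<close>

definition self_adjoint_op :: "'h::real_inner set \<Rightarrow> ('h \<Rightarrow> 'h) \<Rightarrow> bool" where
  "self_adjoint_op D A \<longleftrightarrow>
     subspace D \<and> closure D = UNIV \<and>
     (\<forall>x\<in>D. \<forall>y\<in>D. A (x + y) = A x + A y) \<and> (\<forall>c. \<forall>x\<in>D. A (c *\<^sub>R x) = c *\<^sub>R A x) \<and>
     (\<forall>y z. (\<forall>x\<in>D. A x \<bullet> y = x \<bullet> z) \<longleftrightarrow> (y \<in> D \<and> z = A y))"

definition C0_semigroup :: "(real \<Rightarrow> 'h::real_normed_vector \<Rightarrow> 'h) \<Rightarrow> bool" where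
  "C0_semigroup S \<longleftrightarrow>
     (\<forall>t\<ge>0. bounded_linear (S t)) \<and> S 0 = id \<and>
     (\<forall>s\<ge>0. \<forall>t\<ge>0. S (s + t) = S s \<circ> S t) \<and>
     (\<forall>x. ((\<lambda>t. S t x) \<longlongrightarrow> x) (at_right 0))"

text \<open>\<open>S t = e\<^bsup>tA\<^esup>\<close>: the strongly continuous semigroup with infinitesimal generator \<open>(D, A)\<close>;
  its values at negative times are irrelevant.\<close>

definition semigroup_generated_by ::
  "'h::real_normed_vector set \<Rightarrow> ('h \<Rightarrow> 'h) \<Rightarrow> (real \<Rightarrow> 'h \<Rightarrow> 'h) \<Rightarrow> bool" where
  "semigroup_generated_by D A S \<longleftrightarrow>
     C0_semigroup S \<and>
     (\<forall>x y. ((\<lambda>h. (S h x - x) /\<^sub>R h) \<longlongrightarrow> y) (at_right 0) \<longleftrightarrow> (x \<in> D \<and> y = A x))"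


section \<open>The noise\<close>

text \<open>Time is \<open>[0,\<infinity>)\<close>; values of filtrations and processes at negative times are irrelevant.\<close>

definition stochastic_basis :: "'w measure \<Rightarrow> (real \<Rightarrow> 'w measure) \<Rightarrow> bool" where
  "stochastic_basis M Fil \<longleftrightarrow>
     prob_space M \<and>
     (\<forall>t\<ge>0. subalgebra M (Fil t)) \<and>
     (\<forall>s\<ge>0. \<forall>t\<ge>s. sets (Fil s) \<subseteq> sets (Fil t))"

definition usual_conditions :: "'w measure \<Rightarrow> (real \<Rightarrow> 'w measure) \<Rightarrow> bool" where
  "usual_conditions M Fil \<longleftrightarrow>
     complete_measure M \<and>
     null_sets M \<subseteq> sets (Fil 0) \<and>
     (\<forall>t\<ge>0. sets (Fil t) = (\<Inter>s\<in>{t<..}. sets (Fil s)))"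

definition cadlag :: "(real \<Rightarrow> real) \<Rightarrow> bool" where
  "cadlag z \<longleftrightarrow>
     (\<forall>t\<ge>0. (z \<longlongrightarrow> z t) (at_right t)) \<and> (\<forall>t>0. \<exists>l. (z \<longlongrightarrow> l) (at_left t))"

definition levy_process ::
  "'w measure \<Rightarrow> (real \<Rightarrow> 'w measure) \<Rightarrow> (real \<Rightarrow> 'w \<Rightarrow> real) \<Rightarrow> bool" where
  "levy_process M Fil Z \<longleftrightarrow>
     (\<forall>t\<ge>0. Z t \<in> borel_measurable (Fil t)) \<and>
     (AE \<omega> in M. Z 0 \<omega> = 0) \<and>
     (\<forall>s\<ge>0. \<forall>t\<ge>s. prob_space.indep_set M (sets (Fil s))
        (sets (vimage_algebra (space M) (\<lambda>\<omega>. Z t \<omega> - Z s \<omega>) borel))) \<and>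
     (\<forall>s\<ge>0. \<forall>t\<ge>s. distr M borel (\<lambda>\<omega>. Z t \<omega> - Z s \<omega>) = distr M borel (Z (t - s))) \<and>
     (AE \<omega> in M. cadlag (\<lambda>t. Z t \<omega>))"

definition stable_levy_process ::
  "'w measure \<Rightarrow> (real \<Rightarrow> 'w measure) \<Rightarrow> real \<Rightarrow> (real \<Rightarrow> 'w \<Rightarrow> real) \<Rightarrow> bool" where
  "stable_levy_process M Fil \<alpha> Z \<longleftrightarrow>
     levy_process M Fil Z \<and>
     (\<forall>t\<ge>0. \<forall>h. (CLINT \<omega>|M. iexp (h * Z t \<omega>)) = of_real (exp (- t * \<bar>h\<bar> powr \<alpha>)))"

text \<open>Independence of whole processes: the paths, as random elements of the product space
  \<open>\<real>\<^bsup>[0,\<infinity>)\<^esup>\<close>, are independent.\<close>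

definition independent_processes :: "'w measure \<Rightarrow> (nat \<Rightarrow> real \<Rightarrow> 'w \<Rightarrow> real) \<Rightarrow> bool" where
  "independent_processes M Z \<longleftrightarrow>
     prob_space.indep_vars M (\<lambda>_. PiM {0..} (\<lambda>_. borel)) (\<lambda>n \<omega>. \<lambda>t\<in>{0..}. Z n t \<omega>) UNIV"

text \<open>\<open>J\<close> is (a version of) \<open>\<integral>\<^sub>0\<^sup>t g(s) dZ\<^sub>s\<close> for a deterministic continuous \<open>g\<close>: the limit in
  probability of the Riemann sums over partitions \<open>0 = p 0 \<le> \<dots> \<le> p N = t\<close> as the mesh tends to 0.\<close>

definition stochastic_integral ::
  "'w measure \<Rightarrow> (real \<Rightarrow> real) \<Rightarrow> (real \<Rightarrow> 'w \<Rightarrow> real) \<Rightarrow> real \<Rightarrow> ('w \<Rightarrow> real) \<Rightarrow> bool" where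
  "stochastic_integral M g Z t J \<longleftrightarrow>
     J \<in> borel_measurable M \<and>
     (\<forall>\<epsilon>>0. \<exists>\<delta>>0. \<forall>N (p :: nat \<Rightarrow> real).
        p 0 = 0 \<and> p N = t \<and> (\<forall>i<N. p i \<le> p (Suc i) \<and> p (Suc i) - p i \<le> \<delta>) \<longrightarrow>
        measure M {\<omega> \<in> space M.
          \<bar>(\<Sum>i<N. g (p i) * (Z (p (Suc i)) \<omega> - Z (p i) \<omega>)) - J \<omega>\<bar> > \<epsilon>} \<le> \<epsilon>)"

definition predictable_algebra :: "'w measure \<Rightarrow> (real \<Rightarrow> 'w measure) \<Rightarrow> (real \<times> 'w) measure" where
  "predictable_algebra M Fil = sigma ({0..} \<times> space M)
     ({{0} \<times> B | B. B \<in> sets (Fil 0)} \<union>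
      {{s<..t} \<times> B | s t B. 0 \<le> s \<and> s < t \<and> B \<in> sets (Fil s)})"

definition predictable_process ::
  "'w measure \<Rightarrow> (real \<Rightarrow> 'w measure) \<Rightarrow> (real \<Rightarrow> 'w \<Rightarrow> 'h::topological_space) \<Rightarrow> bool" where
  "predictable_process M Fil X \<longleftrightarrow>
     (\<lambda>(t, \<omega>). X t \<omega>) \<in> borel_measurable (predictable_algebra M Fil)"

text \<open>\<open>ZA\<close> is a predictable version of
  \<open>Z\<^sub>A(t) = \<Sum>\<^sub>n (\<integral>\<^sub>0\<^sup>t exp (- \<gamma>\<^sub>n (t - s)) \<beta>\<^sub>n dZ\<^sup>n\<^sub>s) e\<^sub>n\<close>.\<close>

definition stochastic_convolution ::
  "'w measure \<Rightarrow> (real \<Rightarrow> 'w measure) \<Rightarrow> (nat \<Rightarrow> real \<Rightarrow> 'w \<Rightarrow> real) \<Rightarrow> (nat \<Rightarrow> 'h::real_inner) \<Rightarrow>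
   (nat \<Rightarrow> real) \<Rightarrow> (nat \<Rightarrow> real) \<Rightarrow> (real \<Rightarrow> 'w \<Rightarrow> 'h) \<Rightarrow> bool" where
  "stochastic_convolution M Fil Z e \<beta> \<gamma> ZA \<longleftrightarrow>
     predictable_process M Fil ZA \<and>
     (\<forall>t\<ge>0. \<exists>J.
        (\<forall>n. stochastic_integral M (\<lambda>s. exp (- \<gamma> n * (t - s)) * \<beta> n) (Z n) t (J n)) \<and>
        (AE \<omega> in M. (\<lambda>n. J n \<omega> *\<^sub>R e n) sums ZA t \<omega>))"


section \<open>Mild solutions and the transition semigroup\<close>

definition mild_solution ::
  "'w measure \<Rightarrow> (real \<Rightarrow> 'w measure) \<Rightarrow> (real \<Rightarrow> 'h \<Rightarrow> 'h) \<Rightarrow> ('h \<Rightarrow> 'h) \<Rightarrow> (real \<Rightarrow> 'w \<Rightarrow> 'h) \<Rightarrow>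
   'h \<Rightarrow> (real \<Rightarrow> 'w \<Rightarrow> 'h::{real_inner, banach, second_countable_topology}) \<Rightarrow> bool" where
  "mild_solution M Fil S F ZA x X \<longleftrightarrow>
     predictable_process M Fil X \<and>
     (\<forall>t\<ge>0. AE \<omega> in M.
        set_integrable lborel {0..t} (\<lambda>s. S (t - s) (F (X s \<omega>))) \<and>
        X t \<omega> = S t x + (LINT s:{0..t}|lborel. S (t - s) (F (X s \<omega>))) + ZA t \<omega>)"

definition transition_semigroup ::
  "'w measure \<Rightarrow> ('h \<Rightarrow> real \<Rightarrow> 'w \<Rightarrow> 'h) \<Rightarrow> real \<Rightarrow> ('h \<Rightarrow> real) \<Rightarrow> 'h \<Rightarrow> real" where
  "transition_semigroup M X t f x = (LINT \<omega>|M. f (X x t \<omega>))"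

end

theory Submission
  imports Defs "HOL-Real_Asymp.Real_Asymp"
begin

text \<open>Discretise the mild equation by an exponential Euler scheme with step \<open>\<delta> = t / (m + 1)\<close> on the span
  of \<open>e 0, \<dots>, e (N - 1)\<close>. One step acts on functions as \<open>Q f z = R f (z + \<delta> F z)\<close>, where \<open>R\<close> is the
  transition operator of the linear scheme.

  The iterate \<open>R\<^sup>j\<close> convolves with a product of symmetric stable laws and then applies the semigroup.
  A symmetric stable variable is \<open>sqrt V * G\<close> with \<open>G\<close> Gaussian and \<open>V\<close> positive stable of index \<open>\<alpha> / 2\<close>.
  The squared Hellinger distance between a stable law of scale \<open>c\<close> and its translate by \<open>a\<close> is then at
  most of order \<open>(a / c)\<^sup>2 * E (1 / V)\<close>, which is finite because
  \<open>E (1 / V) = \<integral>\<^sub>0\<^sup>\<infinity> exp (- (2 l) powr (\<alpha> / 2)) dl\<close>. Squared Hellinger distances add up over the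
  coordinates, and the hypothesis on \<open>\<beta>\<close> bounds the scales from below, so \<open>R\<^sup>j f\<close> is Lipschitz with
  constant of order \<open>(j \<delta>) powr - g\<close>, uniformly in \<open>N\<close> and \<open>\<delta>\<close>. Duhamel's formula and \<open>g < 1\<close> carry
  this over to \<open>Q\<close> for short times; longer times reduce to these by the semigroup property.

  The scheme converges to \<open>X\<close> in probability, which gives the estimate for Lipschitz \<open>f\<close>; regularity of
  the laws of \<open>X x t\<close> and \<open>X y t\<close> extends it to bounded Borel \<open>f\<close> with the same constant.\<close>

section \<open>Stable laws as Gaussian mixtures\<close>

text \<open>The obstacle is the infinite number of coordinates: the gradient bound must not see
  \<open>N\<close>, so distances between coordinate laws have to combine like squares. Hellinger
  affinities multiply on products and give exactly this. A direct estimate of the affinity of a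
  stable density would go through its Fisher information, hence through smoothness and positivity of
  the density. Writing the law as a Gaussian mixture reduces it to the explicit Gaussian affinity
  and to one number, \<open>E (1 / V)\<close>.

  Time is discretised so that the perturbed operator is an honest iterate \<open>Q ^^ m\<close>. Its
  semigroup property is that of iteration, whereas for \<open>X\<close> it would require the Markov
  property of mild solutions. Duhamel's formula becomes a telescoping sum over bounded continuous
  functions, and no function is differentiated in space. On finitely many modes the generator is
  bounded, so the scheme converges as \<open>\<delta>\<close> tends to 0 for fixed \<open>N\<close>;
  hence \<open>N\<close> is chosen first and \<open>\<delta>\<close> afterwards.\<close>

lemma stable_square_laplace:
  fixes \<kappa> :: "real measure"
  assumes "real_distribution \<kappa>" and ch: "\<And>h. char \<kappa> h = of_real (exp (- (\<bar>h\<bar> powr \<alpha>)))"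
    and l: "0 \<le> l"
  shows "(\<integral>w. exp (- (l * w\<^sup>2)) \<partial>\<kappa>) =
    (\<integral>y. exp (- ((2 * l) powr (\<alpha> / 2) * \<bar>y\<bar> powr \<alpha>)) \<partial>std_normal_distribution)"
proof -
  interpret K: real_distribution \<kappa> by fact
  interpret N: real_distribution std_normal_distribution by (rule real_dist_normal_dist)
  interpret P: pair_prob_space \<kappa> std_normal_distribution ..
  \<comment> \<open>\<open>exp (- (l * w\<^sup>2))\<close> is the Gaussian characteristic function
    at \<open>?s * w\<close>; after Fubini the law \<open>\<kappa>\<close> enters through its own
    characteristic function.\<close>
  let ?s = "sqrt (2 * l)"
  have int: "integrable (\<kappa> \<Otimes>\<^sub>M std_normal_distribution) (\<lambda>(w, y). iexp (?s * w * y))"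
    by (rule P.integrable_const_bound[where B=1]) (auto simp: measurable_split_conv)
  have "complex_of_real (\<integral>w. exp (- (l * w\<^sup>2)) \<partial>\<kappa>) =
      (\<integral>w. complex_of_real (exp (- (l * w\<^sup>2))) \<partial>\<kappa>)"
    by (simp add: integral_complex_of_real)
  also have "\<dots> = (\<integral>w. (\<integral>y. iexp (?s * w * y) \<partial>std_normal_distribution) \<partial>\<kappa>)"
  proof (rule Bochner_Integration.integral_cong[OF refl])
    fix w
    have "complex_of_real (exp (- (l * w\<^sup>2))) = char std_normal_distribution (?s * w)"
      using l by (simp add: char_std_normal_distribution power_mult_distrib)
    then show "complex_of_real (exp (- (l * w\<^sup>2))) =
      (\<integral>y. iexp (?s * w * y) \<partial>std_normal_distribution)" by (simp add: char_def)
  qed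
  also have "\<dots> = (\<integral>y. (\<integral>w. iexp (?s * w * y) \<partial>\<kappa>) \<partial>std_normal_distribution)"
    using P.Fubini_integral[OF int] by simp
  also have "\<dots> = (\<integral>y. complex_of_real (exp (- ((2 * l) powr (\<alpha> / 2) * \<bar>y\<bar> powr \<alpha>))) \<partial>std_normal_distribution)"
  proof (rule Bochner_Integration.integral_cong[OF refl])
    fix y :: real
    have "(\<integral>w. iexp (?s * w * y) \<partial>\<kappa>) = char \<kappa> (?s * y)" by (simp add: char_def mult_ac)
    also have "\<bar>?s * y\<bar> powr \<alpha> = (2 * l) powr (\<alpha> / 2) * \<bar>y\<bar> powr \<alpha>"
      using l by (simp add: abs_mult powr_mult powr_half_sqrt[symmetric] powr_powr)
    then have "char \<kappa> (?s * y) = complex_of_real (exp (- ((2 * l) powr (\<alpha> / 2) * \<bar>y\<bar> powr \<alpha>)))"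
      by (simp only: ch)
    finally show "(\<integral>w. iexp (?s * w * y) \<partial>\<kappa>) =
      complex_of_real (exp (- ((2 * l) powr (\<alpha> / 2) * \<bar>y\<bar> powr \<alpha>)))" .
  qed
  also have "\<dots> = complex_of_real (\<integral>y. exp (- ((2 * l) powr (\<alpha> / 2) * \<bar>y\<bar> powr \<alpha>)) \<partial>std_normal_distribution)"
    by (rule integral_complex_of_real)
  finally show ?thesis by simp
qed

lemma std_normal_abs_powr_moment:
  fixes \<alpha> :: real
  assumes "0 < \<alpha>" "\<alpha> < 2"
  shows "integrable std_normal_distribution (\<lambda>y. \<bar>y\<bar> powr \<alpha>)"
    and "0 < (\<integral>y. \<bar>y\<bar> powr \<alpha> \<partial>std_normal_distribution)"
proof -
  interpret N: real_distribution std_normal_distribution by (rule real_dist_normal_dist)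
  show int: "integrable std_normal_distribution (\<lambda>y. \<bar>y\<bar> powr \<alpha>)"
  proof (rule Bochner_Integration.integrable_bound)
    show "integrable std_normal_distribution (\<lambda>y::real. 1 + y ^ 2)"
      by (intro Bochner_Integration.integrable_add integrable_std_normal_distribution_moment) simp
    show "AE y in std_normal_distribution. norm (\<bar>y\<bar> powr \<alpha>) \<le> norm (1 + y ^ 2)"
    proof (rule AE_I2)
      fix y :: real
      have "\<bar>y\<bar> powr \<alpha> \<le> 1 + y ^ 2"
      proof (cases "\<bar>y\<bar> \<le> 1")
        case True
        then have "\<bar>y\<bar> powr \<alpha> \<le> 1" using assms by (simp add: powr_le1)
        then show ?thesis using zero_le_power2[of y] by linarith
      next
        case False
        then have "\<bar>y\<bar> powr \<alpha> \<le> \<bar>y\<bar> powr 2" using assms by (intro powr_mono) auto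
        also have "\<dots> = y ^ 2" using False by (simp add: powr_numeral)
        finally show ?thesis by simp
      qed
      then show "norm (\<bar>y\<bar> powr \<alpha>) \<le> norm (1 + y ^ 2)" by simp
    qed
  qed simp
  have "(\<integral>y. \<bar>y\<bar> powr \<alpha> \<partial>std_normal_distribution) \<noteq> 0"
  proof
    assume "(\<integral>y. \<bar>y\<bar> powr \<alpha> \<partial>std_normal_distribution) = 0"
    then have "AE y in std_normal_distribution. \<bar>y\<bar> powr \<alpha> = 0"
      by (subst (asm) integral_nonneg_eq_0_iff_AE[OF int]) auto
    then have "AE y in lborel. y = (0::real)"
      by (subst (asm) AE_density) (auto simp: normal_density_pos)
    moreover have "AE y in lborel. y \<noteq> (0::real)" by (rule AE_lborel_singleton)
    ultimately have "AE y in (lborel :: real measure). False" by eventually_elim simp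
    then have "space (lborel :: real measure) \<in> null_sets lborel"
      by (simp add: AE_iff_null_sets)
    then show False by auto
  qed
  moreover have "0 \<le> (\<integral>y. \<bar>y\<bar> powr \<alpha> \<partial>std_normal_distribution)" by simp
  ultimately show "0 < (\<integral>y. \<bar>y\<bar> powr \<alpha> \<partial>std_normal_distribution)" by linarith
qed

text \<open>Only the product \<open>n * q n\<close> is known to converge, so the power is squeezed
  between \<open>exp (- (n * q n / (1 - q n)))\<close> and \<open>exp (- (n * q n))\<close>.\<close>

lemma power_one_minus_tendsto_exp:
  fixes q :: "nat \<Rightarrow> real"
  assumes q: "\<And>n. 0 \<le> q n" and lim: "(\<lambda>n. real n * q n) \<longlonglongrightarrow> u"
  shows "(\<lambda>n. (1 - q n) ^ n) \<longlonglongrightarrow> exp (- u)"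
proof -
  have q0: "q \<longlonglongrightarrow> 0"
  proof -
    have "(\<lambda>n. (real n * q n) * inverse (real n)) \<longlonglongrightarrow> u * 0"
      by (intro tendsto_mult lim lim_inverse_n)
    moreover have "\<forall>\<^sub>F n in sequentially. (real n * q n) * inverse (real n) = q n"
      using eventually_gt_at_top[of 0] by eventually_elim simp
    ultimately show ?thesis by (simp add: tendsto_cong)
  qed
  have ev: "\<forall>\<^sub>F n in sequentially. q n < 1"
    using order_tendstoD(2)[OF q0, of 1] by simp
  have lo: "\<forall>\<^sub>F n in sequentially. exp (- (real n * q n / (1 - q n))) \<le> (1 - q n) ^ n"
    using ev
  proof eventually_elim
    case (elim n)
    then have p: "0 < 1 - q n" by simp
    have "ln (1 / (1 - q n)) \<le> 1 / (1 - q n) - 1" using p by (intro ln_le_minus_one) simp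
    then have "- (q n / (1 - q n)) \<le> ln (1 - q n)" using p by (simp add: ln_div field_simps)
    then have "exp (- (q n / (1 - q n))) \<le> 1 - q n" using p by (metis exp_le_cancel_iff exp_ln)
    then have "exp (- (q n / (1 - q n))) ^ n \<le> (1 - q n) ^ n" by (intro power_mono) auto
    then show ?case by (simp add: exp_of_nat_mult[symmetric])
  qed
  have hi: "\<forall>\<^sub>F n in sequentially. (1 - q n) ^ n \<le> exp (- (real n * q n))"
    using ev
  proof eventually_elim
    case (elim n)
    have "1 - q n \<le> exp (- q n)" using exp_ge_add_one_self[of "- q n"] by simp
    then have "(1 - q n) ^ n \<le> exp (- q n) ^ n" using elim by (intro power_mono) auto
    then show ?case by (simp add: exp_of_nat_mult[symmetric])
  qed
  have l1: "(\<lambda>n. exp (- (real n * q n / (1 - q n)))) \<longlonglongrightarrow> exp (- (u / (1 - 0)))"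
    by (intro tendsto_intros lim q0) simp
  have l2: "(\<lambda>n. exp (- (real n * q n))) \<longlonglongrightarrow> exp (- u)" by (intro tendsto_intros lim)
  show ?thesis using tendsto_sandwich[OF lo hi _ l2] l1 by simp
qed

text \<open>Chebyshev's inequality for \<open>1 - exp (- (l * v))\<close>, which is at least
  \<open>1 - exp (-1)\<close> beyond \<open>1 / l\<close>. The modulus \<open>\<psi>\<close> does
  not depend on \<open>n\<close>, so one choice of \<open>l\<close> serves all the measures.\<close>

lemma tight_of_laplace:
  assumes rd: "\<And>n. real_distribution (\<mu> n)" and nn: "\<And>n. AE v in \<mu> n. 0 \<le> v"
    and L: "\<And>n l. 0 < l \<Longrightarrow> 1 - (\<integral>v. exp (- (l * \<bar>v\<bar>)) \<partial>\<mu> n) \<le> \<psi> l"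
    and psi: "(\<psi> \<longlongrightarrow> 0) (at_right 0)"
  shows "tight \<mu>"
  unfolding tight_def
proof (intro conjI allI impI)
  fix \<epsilon> :: real assume e: "0 < \<epsilon>"
  have "0 < \<epsilon> * (1 - exp (-1))" using e by simp
  then have "\<forall>\<^sub>F l in at_right 0. \<psi> l < \<epsilon> * (1 - exp (-1))"
    using order_tendstoD(2)[OF psi] by blast
  then obtain b0 where b0: "0 < b0" "\<And>l. 0 < l \<Longrightarrow> l < b0 \<Longrightarrow> \<psi> l < \<epsilon> * (1 - exp (-1))"
    unfolding eventually_at_right_field by auto
  define l where "l = b0 / 2"
  have l: "0 < l" "\<psi> l < \<epsilon> * (1 - exp (-1))" using b0 by (auto simp: l_def)
  \<comment> \<open>Tightness is stated with half-open intervals; the left end -1 keeps a possible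
    atom at 0 inside.\<close>
  have "measure (\<mu> n) {-1<..1/l} > 1 - \<epsilon>" for n
  proof -
    interpret real_distribution "\<mu> n" by (rule rd)
    have i: "integrable (\<mu> n) (\<lambda>v. exp (- (l * \<bar>v\<bar>)))"
      using l by (intro integrable_const_bound[where B=1]) auto
    have "(1 - exp (-1)) * measure (\<mu> n) {1/l<..} = (\<integral>v. (1 - exp (-1)) * indicator {1/l<..} v \<partial>\<mu> n)"
      by simp
    also have "\<dots> \<le> (\<integral>v. 1 - exp (- (l * \<bar>v\<bar>)) \<partial>\<mu> n)"
    proof (rule integral_mono)
      show "integrable (\<mu> n) (\<lambda>v. (1 - exp (-1)) * indicator {1/l<..} v :: real)"
        by (intro integrable_mult_right integrable_real_indicator) (auto simp: emeasure_eq_measure)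
      show "integrable (\<mu> n) (\<lambda>v. 1 - exp (- (l * \<bar>v\<bar>)))" using i by simp
      fix v :: real
      show "(1 - exp (-1)) * indicator {1/l<..} v \<le> 1 - exp (- (l * \<bar>v\<bar>))"
      proof (cases "1/l < v")
        case True
        moreover have "0 < 1/l" using l(1) by simp
        ultimately have "0 < v" by linarith
        then have "1 \<le> l * \<bar>v\<bar>" using l(1) True by (simp add: field_simps)
        then show ?thesis using True by simp
      next
        case False
        then show ?thesis using l by simp
      qed
    qed
    also have "\<dots> = 1 - (\<integral>v. exp (- (l * \<bar>v\<bar>)) \<partial>\<mu> n)" using i prob_space by simp
    also have "\<dots> < \<epsilon> * (1 - exp (-1))" using L[OF l(1), of n] l(2) by linarith
    finally have "(1 - exp (-1)) * measure (\<mu> n) {1/l<..} < (1 - exp (-1)) * \<epsilon>" by (simp add: mult.commute)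
    then have A: "measure (\<mu> n) {1/l<..} < \<epsilon>" by (subst (asm) mult_less_cancel_left_pos) auto
    have B: "measure (\<mu> n) {..-1} = 0"
    proof -
      have "AE v in \<mu> n. v \<notin> {..-1}" using nn[of n] by eventually_elim auto
      then show ?thesis by (subst prob_eq_0) auto
    qed
    have "1 = measure (\<mu> n) ({..-1} \<union> {-1<..1/l} \<union> {1/l<..})"
    proof -
      have "{..-1} \<union> {-1<..1/l} \<union> {1/l<..} = (UNIV :: real set)" using l(1) by (auto simp: not_less) 
      then show ?thesis using prob_space by simp
    qed
    also have "\<dots> \<le> measure (\<mu> n) {..-1} + measure (\<mu> n) {-1<..1/l} + measure (\<mu> n) {1/l<..}"
      by (rule order_trans[OF measure_Un_le add_right_mono[OF measure_Un_le]]) auto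
    finally show ?thesis using A B by linarith
  qed
  then show "\<exists>a b. a < b \<and> (\<forall>n. measure (\<mu> n) {a<..b} > 1 - \<epsilon>)"
    using l(1) by (intro exI[of _ "-1"] exI[of _ "1/l"]) (auto intro: less_trans[of _ 0])
qed (rule rd)

text \<open>\<open>\<rho>\<close> is a weak limit of the laws of normalised sums of squares of independent copies of \<open>\<kappa>\<close>: the
  squares lie in the domain of attraction of the positive stable law of index \<open>\<alpha> / 2\<close>, and their
  Laplace transform is a Gaussian average of the characteristic function of \<open>\<kappa>\<close>.\<close>

lemma positive_stable_mixing_measure:
  fixes \<kappa> :: "real measure"
  assumes \<alpha>: "0 < \<alpha>" "\<alpha> < 2"
    and rd: "real_distribution \<kappa>" and ch: "\<And>h. char \<kappa> h = of_real (exp (- (\<bar>h\<bar> powr \<alpha>)))"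
  obtains \<rho> :: "real measure" where "real_distribution \<rho>"
    "\<And>l. 0 \<le> l \<Longrightarrow> (\<integral>v. exp (- (l * \<bar>v\<bar>)) \<partial>\<rho>) = exp (- ((2 * l) powr (\<alpha> / 2)))"
proof -
  interpret K: real_distribution \<kappa> by fact
  interpret N: real_distribution std_normal_distribution by (rule real_dist_normal_dist)
  define c where "c = (\<integral>y. \<bar>y\<bar> powr \<alpha> \<partial>std_normal_distribution)"
  have c: "0 < c" and int: "integrable std_normal_distribution (\<lambda>y. \<bar>y\<bar> powr \<alpha>)"
    using std_normal_abs_powr_moment[OF \<alpha>] by (auto simp: c_def)
  \<comment> \<open>The square of a stable variable has tails of index \<open>\<alpha> / 2\<close>,
    so sums of \<open>n + 1\<close> of them grow like the power \<open>2 / \<alpha>\<close>. The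
    Gaussian moment \<open>c\<close> makes the limiting exponent exactly
    \<open>(2 * l) powr (\<alpha> / 2)\<close>.\<close>
  define a where "a n = (c * real (Suc n)) powr (- 2 / \<alpha>)" for n
  define \<mu> where "\<mu> n = distr (PiM {..<Suc n} (\<lambda>_. \<kappa>)) borel (\<lambda>w. a n * (\<Sum>i<Suc n. (w i)\<^sup>2))" for n
  \<comment> \<open>The Laplace transform of one normalised square, with
    \<open>x = (2 * l) powr (\<alpha> / 2)\<close>; the normalised sum has its power
    \<open>Suc n\<close>.\<close>
  define m where "m x n = (\<integral>y. exp (- (x * \<bar>y\<bar> powr \<alpha> / (c * real (Suc n)))) \<partial>std_normal_distribution)" for x n
  interpret PS: product_sigma_finite "\<lambda>_::nat. \<kappa>" ..
  have PP: "prob_space (PiM I (\<lambda>_::nat. \<kappa>))" for I by (intro prob_space_PiM) unfold_locales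
  have a0: "0 \<le> a n" for n by (simp add: a_def)
  have \<mu>: "real_distribution (\<mu> n)" for n
  proof -
    have "prob_space (\<mu> n)" unfolding \<mu>_def by (rule prob_space.prob_space_distr[OF PP]) simp
    then show ?thesis unfolding real_distribution_def real_distribution_axioms_def by (simp add: \<mu>_def)
  qed
  have nn: "AE v in \<mu> n. 0 \<le> v" for n
    unfolding \<mu>_def by (subst AE_distr_iff) (auto intro!: AE_I2 mult_nonneg_nonneg a0 sum_nonneg simp del: sum.lessThan_Suc)
  have lap: "(\<integral>v. exp (- (l * \<bar>v\<bar>)) \<partial>\<mu> n) = m ((2 * l) powr (\<alpha> / 2)) n ^ Suc n" if l: "0 \<le> l" for l n
  proof -
    have "(\<integral>v. exp (- (l * \<bar>v\<bar>)) \<partial>\<mu> n) =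
      (\<integral>w. exp (- (l * \<bar>a n * (\<Sum>i<Suc n. (w i)\<^sup>2)\<bar>)) \<partial>PiM {..<Suc n} (\<lambda>_. \<kappa>))"
      unfolding \<mu>_def by (subst integral_distr) auto
    also have "\<dots> = (\<integral>w. (\<Prod>i<Suc n. exp (- (l * a n * (w i)\<^sup>2))) \<partial>PiM {..<Suc n} (\<lambda>_. \<kappa>))"
    proof (rule Bochner_Integration.integral_cong[OF refl])
      fix w :: "nat \<Rightarrow> real"
      have "\<bar>a n * (\<Sum>i<Suc n. (w i)\<^sup>2)\<bar> = a n * (\<Sum>i<Suc n. (w i)\<^sup>2)"
        by (intro abs_of_nonneg mult_nonneg_nonneg a0 sum_nonneg) simp
      then show "exp (- (l * \<bar>a n * (\<Sum>i<Suc n. (w i)\<^sup>2)\<bar>)) = (\<Prod>i<Suc n. exp (- (l * a n * (w i)\<^sup>2)))"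
        by (simp only: exp_sum[symmetric, OF finite_lessThan] sum_negf sum_distrib_left mult.assoc)
    qed
    also have "\<dots> = (\<Prod>i<Suc n. (\<integral>x. exp (- (l * a n * x\<^sup>2)) \<partial>\<kappa>))"
      using l a0 by (intro PS.product_integral_prod K.integrable_const_bound[where B=1]) auto
    also have "(\<integral>x. exp (- (l * a n * x\<^sup>2)) \<partial>\<kappa>) = m ((2 * l) powr (\<alpha> / 2)) n"
    proof -
      have "(2 * (l * a n)) powr (\<alpha> / 2) = (2 * l) powr (\<alpha> / 2) * a n powr (\<alpha> / 2)"
        using l a0 by (simp add: powr_mult mult.assoc[symmetric])
      also have "a n powr (\<alpha> / 2) = 1 / (c * real (Suc n))"
      proof -
        have "- 2 / \<alpha> * (\<alpha> / 2) = - 1" using \<alpha> by simp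
        then show ?thesis unfolding a_def powr_powr using c by (simp add: powr_neg_one del: of_nat_Suc)
      qed
      finally have "(2 * (l * a n)) powr (\<alpha> / 2) = (2 * l) powr (\<alpha> / 2) / (c * real (Suc n))" by simp
      then show ?thesis
        using stable_square_laplace[OF rd ch, of "l * a n"] l a0 by (simp add: m_def)
    qed
    finally show ?thesis by simp
  qed
  have mint: "integrable std_normal_distribution (\<lambda>y. exp (- (x * \<bar>y\<bar> powr \<alpha> / (c * real (Suc n)))))"
    if "0 \<le> x" for x n
    using that c by (intro N.integrable_const_bound[where B=1]) auto
  have m1: "m x n \<le> 1" and m0: "0 \<le> m x n" if "0 \<le> x" for x n
  proof -
    have "m x n \<le> (\<integral>y. 1 \<partial>std_normal_distribution)"
      unfolding m_def using that c by (intro integral_mono mint) auto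
    then show "m x n \<le> 1" using N.prob_space by simp
    show "0 \<le> m x n" by (simp add: m_def)
  qed
  \<comment> \<open>With Bernoulli's inequality this bounds \<open>1 - m x n ^ Suc n\<close> by
    \<open>x\<close> for every \<open>n\<close>, which is the modulus needed for tightness.\<close>
  have bnd: "1 - m x n \<le> x / real (Suc n)" if x: "0 \<le> x" for x n
  proof -
    have "1 - m x n = (\<integral>y. 1 - exp (- (x * \<bar>y\<bar> powr \<alpha> / (c * real (Suc n)))) \<partial>std_normal_distribution)"
      unfolding m_def using mint[OF x] N.prob_space by simp
    also have "\<dots> \<le> (\<integral>y. x / (c * real (Suc n)) * \<bar>y\<bar> powr \<alpha> \<partial>std_normal_distribution)"
    proof (rule integral_mono)
      show "integrable std_normal_distribution (\<lambda>y. x / (c * real (Suc n)) * \<bar>y\<bar> powr \<alpha>)" using int by simp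
      show "integrable std_normal_distribution (\<lambda>y. 1 - exp (- (x * \<bar>y\<bar> powr \<alpha> / (c * real (Suc n)))))"
        using mint[OF x] by simp
      show "1 - exp (- (x * \<bar>y\<bar> powr \<alpha> / (c * real (Suc n)))) \<le> x / (c * real (Suc n)) * \<bar>y\<bar> powr \<alpha>" for y
        using exp_ge_add_one_self[of "- (x * \<bar>y\<bar> powr \<alpha> / (c * real (Suc n)))"] by simp
    qed
    also have "\<dots> = x / real (Suc n)" using int c by (simp add: c_def[symmetric])
    finally show ?thesis .
  qed
  have lim: "(\<lambda>n. m x n ^ Suc n) \<longlonglongrightarrow> exp (- x)" if x: "0 \<le> x" for x
  proof -
    \<comment> \<open>Shifted by one: \<open>power_one_minus_tendsto_exp\<close> pairs
      \<open>q n\<close> with the exponent \<open>n\<close>, while \<open>m x n\<close> belongs to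
      \<open>n + 1\<close> summands.\<close>
    define q where "q n = (if n = 0 then 0 else 1 - m x (n - 1))" for n
    have "(\<lambda>n. real (Suc n) * q (Suc n)) \<longlonglongrightarrow> x"
    proof -
      have "(\<lambda>n. \<integral>y. real (Suc n) * (1 - exp (- (x * \<bar>y\<bar> powr \<alpha> / (c * real (Suc n))))) \<partial>std_normal_distribution)
        \<longlonglongrightarrow> (\<integral>y. x / c * \<bar>y\<bar> powr \<alpha> \<partial>std_normal_distribution)"
      proof (rule integral_dominated_convergence[where w="\<lambda>y. x / c * \<bar>y\<bar> powr \<alpha>"])
        show "integrable std_normal_distribution (\<lambda>y. x / c * \<bar>y\<bar> powr \<alpha>)" using int by simp
        show "AE y in std_normal_distribution. (\<lambda>n. real (Suc n) * (1 - exp (- (x * \<bar>y\<bar> powr \<alpha> / (c * real (Suc n))))))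
          \<longlonglongrightarrow> x / c * \<bar>y\<bar> powr \<alpha>"
        proof (rule AE_I2)
          fix y :: real
          define z where "z = x / c * \<bar>y\<bar> powr \<alpha>"
          have "(\<lambda>n. real n * (1 - exp (- (z / real n)))) \<longlonglongrightarrow> z" by real_asymp
          then have "(\<lambda>n. real (Suc n) * (1 - exp (- (z / real (Suc n))))) \<longlonglongrightarrow> z"
            by (rule LIMSEQ_Suc)
          then show "(\<lambda>n. real (Suc n) * (1 - exp (- (x * \<bar>y\<bar> powr \<alpha> / (c * real (Suc n))))))
            \<longlonglongrightarrow> x / c * \<bar>y\<bar> powr \<alpha>" by (simp add: z_def)
        qed
        show "AE y in std_normal_distribution. norm (real (Suc n) * (1 - exp (- (x * \<bar>y\<bar> powr \<alpha> / (c * real (Suc n))))))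
          \<le> x / c * \<bar>y\<bar> powr \<alpha>" for n
        proof (rule AE_I2)
          fix y :: real
          let ?u = "x * \<bar>y\<bar> powr \<alpha> / (c * real (Suc n))"
          have u: "0 \<le> ?u" using x c by simp
          have "real (Suc n) * (1 - exp (- ?u)) \<le> real (Suc n) * ?u"
            using exp_ge_add_one_self[of "- ?u"] by (intro mult_left_mono) auto
          also have "\<dots> = x / c * \<bar>y\<bar> powr \<alpha>" by simp
          finally show "norm (real (Suc n) * (1 - exp (- ?u))) \<le> x / c * \<bar>y\<bar> powr \<alpha>" using u by simp
        qed
      qed simp_all
      moreover have "(\<integral>y. x / c * \<bar>y\<bar> powr \<alpha> \<partial>std_normal_distribution) = x"
        using c by (simp add: c_def[symmetric])
      moreover have "(\<integral>y. real (Suc n) * (1 - exp (- (x * \<bar>y\<bar> powr \<alpha> / (c * real (Suc n))))) \<partial>std_normal_distribution)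
         = real (Suc n) * q (Suc n)" for n
        using mint[OF x, of n] N.prob_space by (simp add: q_def m_def)
      ultimately show ?thesis by simp
    qed
    then have "(\<lambda>n. real n * q n) \<longlonglongrightarrow> x" by (rule LIMSEQ_imp_Suc)
    then have "(\<lambda>n. (1 - q n) ^ n) \<longlonglongrightarrow> exp (- x)"
      by (intro power_one_minus_tendsto_exp) (auto simp: q_def m1[OF x])
    then have "(\<lambda>n. (1 - q (Suc n)) ^ Suc n) \<longlonglongrightarrow> exp (- x)" by (rule LIMSEQ_Suc)
    then show ?thesis by (simp add: q_def)
  qed
  have "tight \<mu>"
  proof (rule tight_of_laplace[OF \<mu> nn, where \<psi>="\<lambda>l. (2 * l) powr (\<alpha> / 2)"])
    fix n and l :: real assume l: "0 < l"
    let ?x = "(2 * l) powr (\<alpha> / 2)"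
    have x: "0 \<le> ?x" by simp
    have "1 + real (Suc n) * (m ?x n - 1) \<le> (1 + (m ?x n - 1)) ^ Suc n"
      using m0[OF x, of n] by (intro Bernoulli_inequality) simp
    moreover have "real (Suc n) * (1 - m ?x n) \<le> ?x"
      using bnd[OF x, of n] by (simp add: field_simps)
    ultimately have "1 - ?x \<le> m ?x n ^ Suc n" by (simp add: algebra_simps)
    then show "1 - (\<integral>v. exp (- (l * \<bar>v\<bar>)) \<partial>\<mu> n) \<le> ?x" using lap[of l n] l by simp
  next
    show "((\<lambda>l. (2 * l) powr (\<alpha> / 2)) \<longlongrightarrow> 0) (at_right 0)"
      using \<alpha> by real_asymp
  qed
  then obtain r \<rho> where r: "strict_mono (r :: nat \<Rightarrow> nat)" and \<rho>: "real_distribution \<rho>"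
    and w: "weak_conv_m (\<mu> \<circ> id \<circ> r) \<rho>"
    using tight_imp_convergent_subsubsequence[of \<mu> id] by (auto simp: strict_mono_id)
  \<comment> \<open>The absolute value makes the test function bounded and continuous on the whole
    line, so weak convergence applies without any statement on the support of
    \<open>\<rho>\<close>.\<close>
  have "(\<integral>v. exp (- (l * \<bar>v\<bar>)) \<partial>\<rho>) = exp (- ((2 * l) powr (\<alpha> / 2)))" if l: "0 \<le> l" for l
  proof (rule LIMSEQ_unique)
    show "(\<lambda>n. \<integral>v. exp (- (l * \<bar>v\<bar>)) \<partial>(\<mu> \<circ> id \<circ> r) n) \<longlonglongrightarrow> (\<integral>v. exp (- (l * \<bar>v\<bar>)) \<partial>\<rho>)"
      by (rule weak_conv_imp_integral_bdd_continuous_conv[OF _ \<rho> w, where B=1])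
        (use \<mu> l in \<open>auto intro!: continuous_intros\<close>)
    have "(\<lambda>n. m ((2 * l) powr (\<alpha> / 2)) (r n) ^ Suc (r n)) \<longlonglongrightarrow> exp (- ((2 * l) powr (\<alpha> / 2)))"
      using LIMSEQ_subseq_LIMSEQ[OF lim r, of "(2 * l) powr (\<alpha> / 2)"] by (simp add: o_def)
    then show "(\<lambda>n. \<integral>v. exp (- (l * \<bar>v\<bar>)) \<partial>(\<mu> \<circ> id \<circ> r) n) \<longlonglongrightarrow> exp (- ((2 * l) powr (\<alpha> / 2)))"
      by (simp only: lap[OF l] o_def id_def)
  qed
  with \<rho> show ?thesis by (rule that)
qed

text \<open>Expressed through \<open>\<alpha>\<close> alone, so that constants built from it do not
  mention the mixing measure, which is obtained by compactness. For \<open>\<alpha> > 1\<close> the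
  integral is finite and \<open>enn2real\<close> returns its value.\<close>

definition inv_moment :: "real \<Rightarrow> real" where
  "inv_moment \<alpha> = enn2real (\<integral>\<^sup>+ l. ennreal (exp (- ((2 * l) powr (\<alpha> / 2)))) * indicator {0..} l \<partial>lborel)"

lemma nn_integral_exp_powr_finite:
  assumes "1 < \<alpha>"
  shows "(\<integral>\<^sup>+ l. ennreal (exp (- ((2 * l) powr (\<alpha> / 2)))) * indicator {0..} l \<partial>lborel) < \<infinity>"
proof -
  \<comment> \<open>With \<open>y = (2 * l) powr (\<alpha> / 2)\<close>, the assumption
    \<open>\<alpha> > 1\<close> gives \<open>y ^ 4 \<ge> (2 * l)\<^sup>2\<close>, and
    \<open>y / 4 \<le> exp (y / 4)\<close> gives \<open>y ^ 4 \<le> 256 * exp y\<close>; 64 is 256 /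
    4.\<close>
  have le: "exp (- ((2 * l) powr (\<alpha> / 2))) \<le> 64 / l\<^sup>2" if l: "1 \<le> l" for l :: real
  proof -
    let ?y = "(2 * l) powr (\<alpha> / 2)"
    have y: "0 < ?y" using l by simp
    have "(2 * l)\<^sup>2 = (2 * l) powr 2" using l by (simp add: powr_numeral)
    also have "\<dots> \<le> (2 * l) powr (\<alpha> / 2 * 4)" using l assms by (intro powr_mono) auto
    also have "\<dots> = ?y ^ 4" using l by (subst powr_powr[symmetric]) (simp only: powr_numeral powr_ge_zero)
    finally have A: "(2 * l)\<^sup>2 \<le> ?y ^ 4" .
    have "(?y / 4) ^ 4 \<le> exp (?y / 4) ^ 4"
      using y exp_ge_add_one_self[of "?y / 4"] by (intro power_mono) linarith+
    then have "?y ^ 4 \<le> 256 * exp ?y" by (simp add: power_divide exp_of_nat_mult[symmetric])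
    with A have "4 * l\<^sup>2 \<le> 256 * exp ?y" by (simp add: power_mult_distrib)
    then show ?thesis using l by (simp add: exp_minus field_simps)
  qed
  have "(\<integral>\<^sup>+ l. ennreal (exp (- ((2 * l) powr (\<alpha> / 2)))) * indicator {0..} l \<partial>lborel)
    \<le> (\<integral>\<^sup>+ l. indicator {0..<1} l + ennreal (64 / l\<^sup>2) * indicator {1..} l \<partial>lborel)"
    using le by (intro nn_integral_mono) (auto simp: indicator_def not_le intro!: ennreal_leI)
  also have "\<dots> = (\<integral>\<^sup>+ l. indicator {0..<1::real} l \<partial>lborel) + (\<integral>\<^sup>+ l. ennreal (64 / l\<^sup>2) * indicator {1::real..} l \<partial>lborel)"
    by (rule nn_integral_add) auto
  also have "(\<integral>\<^sup>+ l. ennreal (64 / l\<^sup>2) * indicator {1::real..} l \<partial>lborel) = ennreal (0 - (- 64 / 1))"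
  proof (rule nn_integral_FTC_atLeast)
    show "((\<lambda>x::real. - 64 / x) has_real_derivative 64 / x\<^sup>2) (at x)" if "1 \<le> x" for x
      using that by (auto intro!: derivative_eq_intros simp: power2_eq_square)
    show "((\<lambda>x::real. - 64 / x) \<longlongrightarrow> 0) at_top" by real_asymp
  qed auto
  finally show ?thesis by (rule order_le_less_trans) simp
qed

lemma nn_integral_exp_atLeast:
  assumes "0 < u"
  shows "(\<integral>\<^sup>+ l. ennreal (exp (- (l * u))) * indicator {0..} l \<partial>lborel) = ennreal (1 / u)"
proof -
  have "(\<integral>\<^sup>+ l. ennreal (exp (- (l * u))) * indicator {0..} l \<partial>lborel) = ennreal (0 - (- exp (- (0 * u)) / u))"
  proof (rule nn_integral_FTC_atLeast)
    show "((\<lambda>x. - exp (- (x * u)) / u) has_real_derivative exp (- (x * u))) (at x)" for x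
      using assms by (auto intro!: derivative_eq_intros)
    show "((\<lambda>x. - exp (- (x * u)) / u) \<longlongrightarrow> 0) at_top" using assms by real_asymp
  qed auto
  then show ?thesis by simp
qed

text \<open>Tonelli's theorem for \<open>1 / \<bar>v\<bar>\<close> written as the integral of
  \<open>exp (- (l * \<bar>v\<bar>))\<close> over \<open>l\<close>. At \<open>v = 0\<close> this
  integral is infinite, so finiteness of the total also excludes an atom at 0, where the Gaussian
  component would degenerate.\<close>

lemma mixing_inverse_moment:
  assumes \<alpha>: "1 < \<alpha>" and "real_distribution \<rho>"
    and lap: "\<And>l. 0 \<le> l \<Longrightarrow> (\<integral>v. exp (- (l * \<bar>v\<bar>)) \<partial>\<rho>) = exp (- ((2 * l) powr (\<alpha> / 2)))"
  shows "AE v in \<rho>. v \<noteq> 0" "integrable \<rho> (\<lambda>v. 1 / \<bar>v\<bar>)" "(\<integral>v. 1 / \<bar>v\<bar> \<partial>\<rho>) \<le> inv_moment \<alpha>"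
proof -
  interpret R: real_distribution \<rho> by fact
  interpret P: pair_sigma_finite \<rho> lborel ..
  define u where "u v = (\<integral>\<^sup>+ l. ennreal (exp (- (l * \<bar>v\<bar>))) * indicator {0..} l \<partial>lborel)" for v :: real
  have [measurable]: "u \<in> borel_measurable borel" unfolding u_def by measurable
  have u: "u v = ennreal (1 / \<bar>v\<bar>)" if "v \<noteq> 0" for v
    using that nn_integral_exp_atLeast[of "\<bar>v\<bar>"] by (simp add: u_def)
  have u0: "u 0 = \<infinity>"
  proof -
    have "u 0 = (\<integral>\<^sup>+ l. indicator {0::real..} l \<partial>lborel)" by (simp add: u_def)
    also have "\<dots> = emeasure lborel {0::real..}" by simp
    also have "\<dots> = \<infinity>"
    proof -
      have "of_nat n \<le> emeasure lborel {0::real..}" for n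
        using emeasure_mono[of "{0..real n}" "{0..}" lborel] by (simp add: ennreal_of_nat_eq_real_of_nat)
      then have "(SUP n. of_nat n :: ennreal) \<le> emeasure lborel {0::real..}" by (intro SUP_least)
      then show ?thesis by (simp add: ennreal_SUP_of_nat_eq_top top_unique)
    qed
    finally show ?thesis .
  qed
  have I: "(\<integral>\<^sup>+ v. u v \<partial>\<rho>) = ennreal (inv_moment \<alpha>)"
  proof -
    have "(\<integral>\<^sup>+ v. u v \<partial>\<rho>) = (\<integral>\<^sup>+ l. (\<integral>\<^sup>+ v. ennreal (exp (- (l * \<bar>v\<bar>))) * indicator {0..} l \<partial>\<rho>) \<partial>lborel)"
      unfolding u_def by (rule P.Fubini'[symmetric]) measurable
    also have "\<dots> = (\<integral>\<^sup>+ l. ennreal (exp (- ((2 * l) powr (\<alpha> / 2)))) * indicator {0..} l \<partial>lborel)"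
    proof (rule nn_integral_cong)
      fix l :: real
      show "(\<integral>\<^sup>+ v. ennreal (exp (- (l * \<bar>v\<bar>))) * indicator {0..} l \<partial>\<rho>) =
        ennreal (exp (- ((2 * l) powr (\<alpha> / 2)))) * indicator {0..} l"
      proof (cases "0 \<le> l")
        case True
        have "(\<integral>\<^sup>+ v. ennreal (exp (- (l * \<bar>v\<bar>))) \<partial>\<rho>) = ennreal (\<integral>v. exp (- (l * \<bar>v\<bar>)) \<partial>\<rho>)"
          using True by (intro nn_integral_eq_integral R.integrable_const_bound[where B=1]) auto
        then show ?thesis using lap[OF True] True by simp
      qed simp
    qed
    also have "\<dots> = ennreal (inv_moment \<alpha>)"
      unfolding inv_moment_def using nn_integral_exp_powr_finite[OF \<alpha>] by simp
    finally show ?thesis .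
  qed
  have "AE v in \<rho>. u v \<noteq> \<infinity>" using I by (intro nn_integral_PInf_AE) auto
  then show ne: "AE v in \<rho>. v \<noteq> 0" by eventually_elim (use u0 in auto)
  have J: "(\<integral>\<^sup>+ v. ennreal (1 / \<bar>v\<bar>) \<partial>\<rho>) = ennreal (inv_moment \<alpha>)"
    unfolding I[symmetric] using ne by (intro nn_integral_cong_AE) (auto elim!: eventually_mono simp: u)
  show int: "integrable \<rho> (\<lambda>v. 1 / \<bar>v\<bar>)"
    by (rule integrableI_nonneg) (auto simp: J)
  have "ennreal (\<integral>v. 1 / \<bar>v\<bar> \<partial>\<rho>) = ennreal (inv_moment \<alpha>)"
    using nn_integral_eq_integral[OF int] J by simp
  then show "(\<integral>v. 1 / \<bar>v\<bar> \<partial>\<rho>) \<le> inv_moment \<alpha>"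
    by (simp add: inv_moment_def)
qed

section \<open>Gaussian mixtures: densities, characteristic functions and Hellinger affinity\<close>

lemma normal_density_scale:
  assumes "0 < \<sigma>"
  shows "normal_density 0 \<sigma> (\<sigma> * x) = std_normal_density x / \<sigma>"
  using assms by (simp add: normal_density_def power_mult_distrib real_sqrt_mult)

lemma normal_density_char:
  assumes \<sigma>: "0 < \<sigma>"
  shows "(\<integral>w. normal_density 0 \<sigma> w *\<^sub>R iexp (h * w) \<partial>lborel) = of_real (exp (- ((\<sigma> * h)\<^sup>2 / 2)))"
proof -
  have "(\<integral>w. normal_density 0 \<sigma> w *\<^sub>R iexp (h * w) \<partial>lborel) =
     \<bar>\<sigma>\<bar> *\<^sub>R (\<integral>x. normal_density 0 \<sigma> (0 + \<sigma> * x) *\<^sub>R iexp (h * (0 + \<sigma> * x)) \<partial>lborel)"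
    by (rule lborel_integral_real_affine) (use \<sigma> in simp)
  also have "\<dots> = (\<integral>x. std_normal_density x *\<^sub>R iexp ((\<sigma> * h) * x) \<partial>lborel)"
  proof (subst integral_scaleR_right[symmetric], rule Bochner_Integration.integral_cong[OF refl])
    fix x
    show "\<bar>\<sigma>\<bar> *\<^sub>R (normal_density 0 \<sigma> (0 + \<sigma> * x) *\<^sub>R iexp (h * (0 + \<sigma> * x))) =
      std_normal_density x *\<^sub>R iexp ((\<sigma> * h) * x)"
      unfolding add_0 normal_density_scale[OF \<sigma>] using \<sigma> by (simp add: mult_ac)
  qed
  also have "\<dots> = char std_normal_distribution (\<sigma> * h)"
    unfolding char_def by (subst integral_density) auto
  finally show ?thesis by (simp add: char_std_normal_distribution)
qed

text \<open>Completing the square at the midpoint: \<open>w\<^sup>2 + (w - a)\<^sup>2 = 2 * (w - a /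
  2)\<^sup>2 + a\<^sup>2 / 2\<close>. Integration over \<open>w\<close> then leaves the exponential
  factor as the affinity.\<close>

lemma normal_density_affinity:
  assumes \<sigma>: "0 < \<sigma>"
  shows "sqrt (normal_density 0 \<sigma> w * normal_density 0 \<sigma> (w - a)) =
    exp (- (a\<^sup>2 / (8 * \<sigma>\<^sup>2))) * normal_density (a / 2) \<sigma> w"
proof (rule real_sqrt_unique)
  have "exp (- (w\<^sup>2 / (2 * \<sigma>\<^sup>2))) * exp (- ((w - a)\<^sup>2 / (2 * \<sigma>\<^sup>2))) =
    (exp (- (a\<^sup>2 / (8 * \<sigma>\<^sup>2))) * exp (- ((w - a / 2)\<^sup>2 / (2 * \<sigma>\<^sup>2))))\<^sup>2"
    using \<sigma> by (simp add: exp_add[symmetric] power2_eq_square field_simps)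
  then show "(exp (- (a\<^sup>2 / (8 * \<sigma>\<^sup>2))) * normal_density (a / 2) \<sigma> w)\<^sup>2 =
    normal_density 0 \<sigma> w * normal_density 0 \<sigma> (w - a)"
    by (simp add: normal_density_def power_mult_distrib power_divide power2_eq_square)
qed simp

text \<open>Stated through \<open>1 / \<sigma>\<^sup>2\<close> because for
  \<open>\<sigma> = c * sqrt \<bar>v\<bar>\<close> the right side is then integrable by the inverse
  first moment of the mixing measure.\<close>

lemma normal_density_le:
  assumes "0 < \<sigma>"
  shows "normal_density \<mu> \<sigma> w \<le> 1 + 1 / \<sigma>\<^sup>2"
proof -
  have "\<sigma> \<le> sqrt (2 * pi * \<sigma>\<^sup>2)"
    using assms pi_gt3 by (intro real_le_rsqrt) simp
  then have "normal_density \<mu> \<sigma> w \<le> 1 / \<sigma> * 1"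
    unfolding normal_density_def using assms by (intro mult_mono divide_left_mono) (auto intro: mult_pos_pos)
  also have "\<dots> \<le> 1 + 1 / \<sigma>\<^sup>2"
  proof -
    have "0 \<le> (1 / \<sigma> - 1)\<^sup>2 + 1 / \<sigma>" using assms by simp
    then show ?thesis using assms by (simp add: power2_eq_square field_simps)
  qed
  finally show ?thesis .
qed

text \<open>Cauchy-Schwarz for \<open>sqrt f\<close> and \<open>sqrt g\<close>, from the
  arithmetic-geometric mean inequality once both functions are normalised to integral 1; the case of
  a vanishing integral is separate.\<close>

lemma integral_sqrt_mult_le:
  fixes f g :: "'a \<Rightarrow> real"
  assumes f: "integrable M f" "\<And>x. 0 \<le> f x" and g: "integrable M g" "\<And>x. 0 \<le> g x"
  shows "integrable M (\<lambda>x. sqrt (f x * g x))"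
    and "(\<integral>x. sqrt (f x * g x) \<partial>M) \<le> sqrt ((\<integral>x. f x \<partial>M) * (\<integral>x. g x \<partial>M))"
proof -
  have [measurable]: "f \<in> borel_measurable M" "g \<in> borel_measurable M" using f g by auto
  have amgm: "sqrt (a * b) \<le> (a + b) / 2" if "0 \<le> a" "0 \<le> b" for a b :: real
    using arith_geo_mean_sqrt[OF that] .
  show int: "integrable M (\<lambda>x. sqrt (f x * g x))"
  proof (rule Bochner_Integration.integrable_bound)
    show "integrable M (\<lambda>x. (f x + g x) / 2)" using f g by simp
    show "AE x in M. norm (sqrt (f x * g x)) \<le> norm ((f x + g x) / 2)"
      using amgm f(2) g(2) by (intro AE_I2) (simp add: add_nonneg_nonneg)
  qed simp
  let ?A = "\<integral>x. f x \<partial>M" and ?B = "\<integral>x. g x \<partial>M"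
  have AB: "0 \<le> ?A" "0 \<le> ?B" using f(2) g(2) by auto
  show "(\<integral>x. sqrt (f x * g x) \<partial>M) \<le> sqrt (?A * ?B)"
  proof (cases "?A = 0 \<or> ?B = 0")
    case True
    then have "AE x in M. f x = 0 \<or> g x = 0"
    proof
      assume "?A = 0"
      then have "AE x in M. f x = 0" using integral_nonneg_eq_0_iff_AE[OF f(1)] f(2) by auto
      then show ?thesis by eventually_elim simp
    next
      assume "?B = 0"
      then have "AE x in M. g x = 0" using integral_nonneg_eq_0_iff_AE[OF g(1)] g(2) by auto
      then show ?thesis by eventually_elim simp
    qed
    then have "(\<integral>x. sqrt (f x * g x) \<partial>M) = (\<integral>x. 0 \<partial>M)" by (intro integral_cong_AE) (auto elim!: eventually_mono)
    then show ?thesis using AB by simp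
  next
    case False
    then have p: "0 < ?A" "0 < ?B" using AB by auto
    have "(\<integral>x. sqrt (f x * g x) \<partial>M) / sqrt (?A * ?B) = (\<integral>x. sqrt ((f x / ?A) * (g x / ?B)) \<partial>M)"
      by (simp add: real_sqrt_divide)
    also have "\<dots> \<le> (\<integral>x. (f x / ?A + g x / ?B) / 2 \<partial>M)"
    proof (rule integral_mono)
      show "integrable M (\<lambda>x. sqrt ((f x / ?A) * (g x / ?B)))" using int by (simp add: real_sqrt_divide)
      show "integrable M (\<lambda>x. (f x / ?A + g x / ?B) / 2)" using f g by simp
      show "sqrt ((f x / ?A) * (g x / ?B)) \<le> (f x / ?A + g x / ?B) / 2" for x
        using f(2) g(2) p by (intro amgm) auto
    qed
    also have "\<dots> = 1" using f g p by simp
    finally show ?thesis using p by (simp add: field_simps)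
  qed
qed

text \<open>The density of \<open>c * sqrt \<bar>V\<bar> * G\<close>, where \<open>V\<close> has law
  \<open>\<rho>\<close> and \<open>G\<close> is an independent standard Gaussian. The absolute value
  spares a condition on the support of \<open>\<rho>\<close>; the degenerate point
  \<open>v = 0\<close> will be a null set.\<close>

definition mixture_density :: "real measure \<Rightarrow> real \<Rightarrow> real \<Rightarrow> real" where
  "mixture_density \<rho> c w = (\<integral>v. normal_density 0 (c * sqrt \<bar>v\<bar>) w \<partial>\<rho>)"

context
  fixes \<rho> :: "real measure" and \<alpha> c :: real
  assumes \<alpha>: "1 < \<alpha>" and rd: "real_distribution \<rho>"
    and lap: "\<And>l. 0 \<le> l \<Longrightarrow> (\<integral>v. exp (- (l * \<bar>v\<bar>)) \<partial>\<rho>) = exp (- ((2 * l) powr (\<alpha> / 2)))"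
    and c: "0 < c"
begin

interpretation R: real_distribution \<rho> by (rule rd)
interpretation P: pair_sigma_finite \<rho> lborel ..
interpretation P': pair_sigma_finite lborel \<rho> ..

private lemma measurable_normal_density_scale[measurable]: "(\<lambda>v. normal_density 0 (c * sqrt \<bar>v\<bar>) w) \<in> borel_measurable borel"
  unfolding normal_density_def by measurable

private lemma AE_ne: "AE v in \<rho>. v \<noteq> 0"
  by (rule mixing_inverse_moment(1)[OF \<alpha> rd lap])

lemma mixture_density_integrable: "integrable \<rho> (\<lambda>v. normal_density 0 (c * sqrt \<bar>v\<bar>) w)"
proof (rule Bochner_Integration.integrable_bound)
  show "integrable \<rho> (\<lambda>v. 1 + (1 / c\<^sup>2) * (1 / \<bar>v\<bar>))"
    by (intro Bochner_Integration.integrable_add integrable_mult_right mixing_inverse_moment(2)[OF \<alpha> rd lap]) auto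
  show "AE v in \<rho>. norm (normal_density 0 (c * sqrt \<bar>v\<bar>) w) \<le> norm (1 + (1 / c\<^sup>2) * (1 / \<bar>v\<bar>))"
    using AE_ne
  proof eventually_elim
    case (elim v)
    then show ?case
      using normal_density_le[of "c * sqrt \<bar>v\<bar>" 0 w] c by (simp add: power_mult_distrib)
  qed
qed simp

lemma mixture_density_nonneg: "0 \<le> mixture_density \<rho> c w"
  unfolding mixture_density_def by simp

lemma mixture_density_measurable[measurable]: "mixture_density \<rho> c \<in> borel_measurable borel"
  unfolding mixture_density_def[abs_def]
  by (rule R.borel_measurable_lebesgue_integral) (unfold normal_density_def, measurable)

private lemma int_pair: "integrable (\<rho> \<Otimes>\<^sub>M lborel) (\<lambda>(v, w). normal_density 0 (c * sqrt \<bar>v\<bar>) w)"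
proof (rule P.Fubini_integrable)
  have eq: "AE v in \<rho>. (\<integral>w. norm (normal_density 0 (c * sqrt \<bar>v\<bar>) w) \<partial>lborel) = 1"
    using AE_ne by eventually_elim (use c in simp)
  show "integrable \<rho> (\<lambda>v. \<integral>w. norm (case (v, w) of (v, w) \<Rightarrow> normal_density 0 (c * sqrt \<bar>v\<bar>) w) \<partial>lborel)"
  proof (rule R.integrable_const_bound[where B=1])
    show "AE v in \<rho>. norm (\<integral>w. norm (case (v, w) of (v, w) \<Rightarrow> normal_density 0 (c * sqrt \<bar>v\<bar>) w) \<partial>lborel) \<le> 1"
      using eq by eventually_elim simp
    show "(\<lambda>v. \<integral>w. norm (case (v, w) of (v, w) \<Rightarrow> normal_density 0 (c * sqrt \<bar>v\<bar>) w) \<partial>lborel) \<in> borel_measurable \<rho>"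
      by (rule lborel.borel_measurable_lebesgue_integral) (unfold normal_density_def, measurable)
  qed
  show "AE v in \<rho>. integrable lborel (\<lambda>w. case (v, w) of (v, w) \<Rightarrow> normal_density 0 (c * sqrt \<bar>v\<bar>) w)"
    using AE_ne by eventually_elim (use c in simp)
qed (unfold normal_density_def, measurable)

lemma mixture_density_integral: "integrable lborel (mixture_density \<rho> c)" "(\<integral>w. mixture_density \<rho> c w \<partial>lborel) = 1"
proof -
  show "integrable lborel (mixture_density \<rho> c)"
    using P.integrable_snd[OF int_pair] by (simp add: mixture_density_def[abs_def])
  have "(\<integral>w. mixture_density \<rho> c w \<partial>lborel) = (\<integral>v. (\<integral>w. normal_density 0 (c * sqrt \<bar>v\<bar>) w \<partial>lborel) \<partial>\<rho>)"
    unfolding mixture_density_def using P.Fubini_integral[OF int_pair] by simp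
  also have "\<dots> = (\<integral>v. 1 \<partial>\<rho>)"
  proof (rule integral_cong_AE)
    show "AE v in \<rho>. (\<integral>w. normal_density 0 (c * sqrt \<bar>v\<bar>) w \<partial>lborel) = 1"
      using AE_ne by eventually_elim (use c in simp)
    show "(\<lambda>v. \<integral>w. normal_density 0 (c * sqrt \<bar>v\<bar>) w \<partial>lborel) \<in> borel_measurable \<rho>"
      by (rule lborel.borel_measurable_lebesgue_integral) (unfold normal_density_def, measurable)
  qed simp
  finally show "(\<integral>w. mixture_density \<rho> c w \<partial>lborel) = 1" using R.prob_space by simp
qed

text \<open>Conditionally on \<open>v\<close> the characteristic function is
  \<open>exp (- ((c * h)\<^sup>2 / 2 * \<bar>v\<bar>))\<close>, so the mixture yields the Laplace
  transform of \<open>\<rho>\<close> at \<open>l = (c * h)\<^sup>2 / 2\<close>. The normalisation of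
  \<open>\<rho>\<close> by \<open>2 * l\<close> is chosen for this point.\<close>

lemma mixture_density_char:
  "char (density lborel (\<lambda>w. ennreal (mixture_density \<rho> c w))) h = of_real (exp (- (\<bar>c * h\<bar> powr \<alpha>)))"
proof -
  have int: "integrable (\<rho> \<Otimes>\<^sub>M lborel) (\<lambda>(v, w). normal_density 0 (c * sqrt \<bar>v\<bar>) w *\<^sub>R iexp (h * w))"
    by (rule Bochner_Integration.integrable_bound[OF int_pair])
      (unfold normal_density_def, measurable, auto)
  have "char (density lborel (\<lambda>w. ennreal (mixture_density \<rho> c w))) h =
      (\<integral>w. mixture_density \<rho> c w *\<^sub>R iexp (h * w) \<partial>lborel)"
    unfolding char_def by (rule integral_density) (auto simp: mixture_density_nonneg)
  also have "\<dots> = (\<integral>w. (\<integral>v. normal_density 0 (c * sqrt \<bar>v\<bar>) w *\<^sub>R iexp (h * w) \<partial>\<rho>) \<partial>lborel)"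
    unfolding mixture_density_def using mixture_density_integrable
    by (intro Bochner_Integration.integral_cong refl integral_scaleR_left[symmetric])
  also have "\<dots> = (\<integral>v. (\<integral>w. normal_density 0 (c * sqrt \<bar>v\<bar>) w *\<^sub>R iexp (h * w) \<partial>lborel) \<partial>\<rho>)"
    using P.Fubini_integral[OF int] by simp
  also have "\<dots> = (\<integral>v. complex_of_real (exp (- ((c * h)\<^sup>2 / 2 * \<bar>v\<bar>))) \<partial>\<rho>)"
  proof (rule integral_cong_AE)
    show "AE v in \<rho>. (\<integral>w. normal_density 0 (c * sqrt \<bar>v\<bar>) w *\<^sub>R iexp (h * w) \<partial>lborel) =
      complex_of_real (exp (- ((c * h)\<^sup>2 / 2 * \<bar>v\<bar>)))"
      using AE_ne
    proof eventually_elim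
      case (elim v)
      have "(c * sqrt \<bar>v\<bar> * h)\<^sup>2 / 2 = (c * h)\<^sup>2 / 2 * \<bar>v\<bar>" by (simp add: power_mult_distrib)
      then show ?case using normal_density_char[of "c * sqrt \<bar>v\<bar>" h] elim c by simp
    qed
    show "(\<lambda>v. \<integral>w. normal_density 0 (c * sqrt \<bar>v\<bar>) w *\<^sub>R iexp (h * w) \<partial>lborel) \<in> borel_measurable \<rho>"
      by (rule lborel.borel_measurable_lebesgue_integral) (unfold normal_density_def, measurable)
  qed simp
  also have "\<dots> = complex_of_real (\<integral>v. exp (- ((c * h)\<^sup>2 / 2 * \<bar>v\<bar>)) \<partial>\<rho>)" by (rule integral_complex_of_real)
  also have "(\<integral>v. exp (- ((c * h)\<^sup>2 / 2 * \<bar>v\<bar>)) \<partial>\<rho>) = exp (- (\<bar>c * h\<bar> powr \<alpha>))"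
  proof -
    have "((c * h)\<^sup>2) powr (\<alpha> / 2) = \<bar>c * h\<bar> powr \<alpha>"
    proof (cases "c * h = 0")
      case False
      then have "(c * h)\<^sup>2 = \<bar>c * h\<bar> powr 2" by (simp add: powr_numeral)
      then show ?thesis by (simp only: powr_powr) simp
    qed auto
    then show ?thesis using lap[of "(c * h)\<^sup>2 / 2"] by simp
  qed
  finally show ?thesis .
qed

text \<open>Cauchy-Schwarz in \<open>v\<close> shows that the affinity of two mixtures is at least
  the average of the affinities of their components,
  \<open>exp (- (a\<^sup>2 / (8 * c\<^sup>2 * \<bar>v\<bar>)))\<close>. The bound
  \<open>exp (- u) \<ge> 1 - u\<close> then leaves the mean of \<open>1 / \<bar>v\<bar>\<close>, and
  the 8 is the Gaussian one.\<close>

lemma mixture_density_affinity: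
  "1 - inv_moment \<alpha> / 8 * (a / c)\<^sup>2 \<le> (\<integral>w. sqrt (mixture_density \<rho> c w * mixture_density \<rho> c (w - a)) \<partial>lborel)"
proof -
  let ?n = "\<lambda>v w. normal_density 0 (c * sqrt \<bar>v\<bar>) w"
  let ?p = "mixture_density \<rho> c"
  let ?k = "\<lambda>v w. sqrt (?n v w * ?n v (w - a))"
  have meas: "(\<lambda>(v, w). ?k v w) \<in> borel_measurable (\<rho> \<Otimes>\<^sub>M lborel)"
    unfolding normal_density_def by measurable
  have inner: "AE v in \<rho>. integrable lborel (?k v) \<and> (\<integral>w. ?k v w \<partial>lborel) = exp (- (a\<^sup>2 / (8 * c\<^sup>2 * \<bar>v\<bar>)))"
    using AE_ne
  proof eventually_elim
    case (elim v)
    then have s: "0 < c * sqrt \<bar>v\<bar>" using c by simp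
    have "?k v = (\<lambda>w. exp (- (a\<^sup>2 / (8 * c\<^sup>2 * \<bar>v\<bar>))) * normal_density (a / 2) (c * sqrt \<bar>v\<bar>) w)"
      using normal_density_affinity[OF s, of _ a] by (simp add: fun_eq_iff power_mult_distrib mult.assoc)
    then show ?case using s by simp
  qed
  have intk: "integrable (\<rho> \<Otimes>\<^sub>M lborel) (\<lambda>(v, w). ?k v w)"
  proof (rule P.Fubini_integrable[OF meas])
    show "integrable \<rho> (\<lambda>v. \<integral>w. norm (case (v, w) of (v, w) \<Rightarrow> ?k v w) \<partial>lborel)"
    proof (rule R.integrable_const_bound[where B=1])
      show "AE v in \<rho>. norm (\<integral>w. norm (case (v, w) of (v, w) \<Rightarrow> ?k v w) \<partial>lborel) \<le> 1"
        using inner by eventually_elim simp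
      show "(\<lambda>v. \<integral>w. norm (case (v, w) of (v, w) \<Rightarrow> ?k v w) \<partial>lborel) \<in> borel_measurable \<rho>"
        using meas by measurable
    qed
    show "AE v in \<rho>. integrable lborel (\<lambda>w. case (v, w) of (v, w) \<Rightarrow> ?k v w)"
      using inner by eventually_elim simp
  qed
  have "1 - inv_moment \<alpha> / 8 * (a / c)\<^sup>2 \<le> 1 - a\<^sup>2 / (8 * c\<^sup>2) * (\<integral>v. 1 / \<bar>v\<bar> \<partial>\<rho>)"
    using mult_left_mono[OF mixing_inverse_moment(3)[OF \<alpha> rd lap], of "a\<^sup>2 / (8 * c\<^sup>2)"]
    by (simp add: power_divide mult.commute)
  also have "\<dots> = (\<integral>v. 1 - a\<^sup>2 / (8 * c\<^sup>2) * (1 / \<bar>v\<bar>) \<partial>\<rho>)"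
    using mixing_inverse_moment(2)[OF \<alpha> rd lap] R.prob_space
    by (subst Bochner_Integration.integral_diff) (auto simp del: times_divide_eq_right)
  also have "\<dots> \<le> (\<integral>v. (\<integral>w. ?k v w \<partial>lborel) \<partial>\<rho>)"
  proof (rule integral_mono_AE)
    show "integrable \<rho> (\<lambda>v. 1 - a\<^sup>2 / (8 * c\<^sup>2) * (1 / \<bar>v\<bar>))"
      using mixing_inverse_moment(2)[OF \<alpha> rd lap] by (intro Bochner_Integration.integrable_diff integrable_mult_right) auto
    show "integrable \<rho> (\<lambda>v. \<integral>w. ?k v w \<partial>lborel)" using P.integrable_fst'[OF intk] by simp
    show "AE v in \<rho>. 1 - a\<^sup>2 / (8 * c\<^sup>2) * (1 / \<bar>v\<bar>) \<le> (\<integral>w. ?k v w \<partial>lborel)"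
      using inner
    proof eventually_elim
      case (elim v)
      have "1 - a\<^sup>2 / (8 * c\<^sup>2) * (1 / \<bar>v\<bar>) = 1 + - (a\<^sup>2 / (8 * c\<^sup>2 * \<bar>v\<bar>))" by simp
      also have "\<dots> \<le> exp (- (a\<^sup>2 / (8 * c\<^sup>2 * \<bar>v\<bar>)))" by (rule exp_ge_add_one_self)
      finally show ?case using elim by simp
    qed
  qed
  also have "\<dots> = (\<integral>w. (\<integral>v. ?k v w \<partial>\<rho>) \<partial>lborel)" using P.Fubini_integral[OF intk] by simp
  also have "\<dots> \<le> (\<integral>w. sqrt (?p w * ?p (w - a)) \<partial>lborel)"
  proof (rule integral_mono)
    show "integrable lborel (\<lambda>w. \<integral>v. ?k v w \<partial>\<rho>)" using P.integrable_snd[OF intk] by simp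
    show "integrable lborel (\<lambda>w. sqrt (?p w * ?p (w - a)))"
    proof (rule integral_sqrt_mult_le(1))
      show "integrable lborel (\<lambda>w. ?p (w - a))"
        using lborel_integrable_real_affine[OF mixture_density_integral(1), of 1 "- a"] by simp
    qed (auto simp: mixture_density_integral mixture_density_nonneg)
    show "(\<integral>v. ?k v w \<partial>\<rho>) \<le> sqrt (?p w * ?p (w - a))" for w
      unfolding mixture_density_def
      by (rule integral_sqrt_mult_le(2)) (auto intro: mixture_density_integrable)
  qed
  finally show ?thesis .
qed

end

text \<open>The mixture density has the same characteristic function as \<open>\<kappa>\<close>, so
  uniqueness identifies the two laws and \<open>\<kappa>\<close> inherits the affinity
  bound.\<close>

lemma stable_law_density:
  fixes \<kappa> :: "real measure"
  assumes \<alpha>: "1 < \<alpha>" "\<alpha> < 2" and c: "0 < c"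
    and rd: "real_distribution \<kappa>" and ch: "\<And>h. char \<kappa> h = of_real (exp (- (\<bar>c * h\<bar> powr \<alpha>)))"
  obtains p where "p \<in> borel_measurable borel" "\<And>w. 0 \<le> p w" "\<kappa> = density lborel (\<lambda>w. ennreal (p w))"
    "integrable lborel p" "(\<integral>w. p w \<partial>lborel) = 1"
    "\<And>a. 1 - inv_moment \<alpha> / 8 * (a / c)\<^sup>2 \<le> (\<integral>w. sqrt (p w * p (w - a)) \<partial>lborel)"
proof -
  interpret K: real_distribution \<kappa> by (rule rd)
  \<comment> \<open>The mixing measure is constructed at unit scale; the scale \<open>c\<close>
    returns as the parameter of \<open>mixture_density\<close>.\<close>
  let ?\<kappa>1 = "distr \<kappa> borel (\<lambda>x. x / c)"
  have "real_distribution ?\<kappa>1"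
    unfolding real_distribution_def real_distribution_axioms_def by (simp add: K.prob_space_distr)
  moreover have "char ?\<kappa>1 h = of_real (exp (- (\<bar>h\<bar> powr \<alpha>)))" for h
  proof -
    have "char ?\<kappa>1 h = char \<kappa> (h / c)" unfolding char_def by (subst integral_distr) auto
    then show ?thesis using c by (simp only: ch) simp
  qed
  ultimately obtain \<rho> where \<rho>: "real_distribution \<rho>"
    "\<And>l. 0 \<le> l \<Longrightarrow> (\<integral>v. exp (- (l * \<bar>v\<bar>)) \<partial>\<rho>) = exp (- ((2 * l) powr (\<alpha> / 2)))"
    using positive_stable_mixing_measure[of \<alpha> ?\<kappa>1] \<alpha> by auto
  note mix = \<alpha>(1) \<rho> c
  let ?p = "mixture_density \<rho> c"
  have m: "?p \<in> borel_measurable borel" by (rule mixture_density_measurable[OF mix])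
  have nn: "0 \<le> ?p w" for w by (rule mixture_density_nonneg[OF mix])
  have "real_distribution (density lborel (\<lambda>w. ennreal (?p w)))"
  proof -
    have "(\<integral>\<^sup>+ w. ennreal (?p w) \<partial>lborel) = 1"
      using nn_integral_eq_integral[OF mixture_density_integral(1)[OF mix]] nn mixture_density_integral(2)[OF mix] by simp
    then have "prob_space (density lborel (\<lambda>w. ennreal (?p w)))"
      using m by (intro prob_spaceI) (simp add: emeasure_density)
    then show ?thesis unfolding real_distribution_def real_distribution_axioms_def by simp
  qed
  then have "\<kappa> = density lborel (\<lambda>w. ennreal (?p w))"
    using ch mixture_density_char[OF mix] by (intro Levy_uniqueness rd) (auto simp: fun_eq_iff)
  then show ?thesis
    using m nn mixture_density_integral[OF mix] mixture_density_affinity[OF mix] by (intro that[of ?p]) auto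
qed

section \<open>Translates of product measures\<close>

lemma distr_PiM_componentwise:
  fixes \<kappa> :: "'i \<Rightarrow> real measure" and f :: "'i \<Rightarrow> real \<Rightarrow> real"
  assumes I: "finite I" and \<kappa>: "\<And>i. real_distribution (\<kappa> i)"
    and f[measurable]: "\<And>i. f i \<in> borel_measurable borel"
  shows "distr (PiM I \<kappa>) (PiM I (\<lambda>_. borel)) (\<lambda>w. \<lambda>i\<in>I. f i (w i)) = PiM I (\<lambda>i. distr (\<kappa> i) borel (f i))"
proof -
  interpret K: real_distribution "\<kappa> i" for i by (rule \<kappa>)
  interpret PK: product_sigma_finite \<kappa> ..
  have pd: "prob_space (distr (\<kappa> i) borel (f i))" for i by (rule K.prob_space_distr) simp
  interpret PD: product_sigma_finite "\<lambda>i. distr (\<kappa> i) borel (f i)"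
    by (intro product_sigma_finite.intro prob_space_imp_sigma_finite pd)
  show ?thesis
  proof (rule PD.PiM_eqI[OF I])
    show "sets (distr (PiM I \<kappa>) (PiM I (\<lambda>_. borel)) (\<lambda>w. \<lambda>i\<in>I. f i (w i))) =
      sets (PiM I (\<lambda>i. distr (\<kappa> i) borel (f i)))"
      by (simp cong: sets_PiM_cong)
    fix A assume A: "\<And>i. i \<in> I \<Longrightarrow> A i \<in> sets (distr (\<kappa> i) borel (f i))"
    then have [measurable]: "i \<in> I \<Longrightarrow> A i \<in> sets borel" for i by simp
    have "Pi\<^sub>E I A \<in> sets (PiM I (\<lambda>_. borel :: real measure))" using I A by (intro sets_PiM_I_finite) auto
    then have "emeasure (distr (PiM I \<kappa>) (PiM I (\<lambda>_. borel)) (\<lambda>w. \<lambda>i\<in>I. f i (w i))) (Pi\<^sub>E I A) =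
       (\<integral>\<^sup>+w. indicator (Pi\<^sub>E I A) (\<lambda>i\<in>I. f i (w i)) \<partial>PiM I \<kappa>)"
      by (subst nn_integral_indicator[symmetric], simp, subst nn_integral_distr) auto
    also have "\<dots> = (\<integral>\<^sup>+w. (\<Prod>i\<in>I. indicator (A i) (f i (w i))) \<partial>PiM I \<kappa>)"
      using I by (intro nn_integral_cong) (auto simp: indicator_def PiE_def Pi_def prod_zero_iff)
    also have "\<dots> = (\<Prod>i\<in>I. \<integral>\<^sup>+x. indicator (A i) (f i x) \<partial>\<kappa> i)"
      using I by (intro PK.product_nn_integral_prod) measurable
    also have "\<dots> = (\<Prod>i\<in>I. emeasure (distr (\<kappa> i) borel (f i)) (A i))"
    proof (rule prod.cong[OF refl])
      fix i assume i: "i \<in> I"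
      then show "(\<integral>\<^sup>+x. indicator (A i) (f i x) \<partial>\<kappa> i) = emeasure (distr (\<kappa> i) borel (f i)) (A i)"
        by (subst nn_integral_indicator[symmetric], simp, subst nn_integral_distr) auto
    qed
    finally show "emeasure (distr (PiM I \<kappa>) (PiM I (\<lambda>_. borel)) (\<lambda>w. \<lambda>i\<in>I. f i (w i))) (Pi\<^sub>E I A) =
      (\<Prod>i\<in>I. emeasure (distr (\<kappa> i) borel (f i)) (A i))" .
  qed
qed

text \<open>Merges two independent noise vectors coordinate by coordinate; this is how the noise of
  successive steps is accumulated into one product law.\<close>

lemma distr_pair_PiM_componentwise:
  fixes \<kappa> \<kappa>' :: "'i \<Rightarrow> real measure" and f :: "'i \<Rightarrow> real \<times> real \<Rightarrow> real"
  assumes I: "finite I" and \<kappa>: "\<And>i. real_distribution (\<kappa> i)" and \<kappa>': "\<And>i. real_distribution (\<kappa>' i)"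
    and f[measurable]: "\<And>i. f i \<in> borel_measurable (borel \<Otimes>\<^sub>M borel)"
  shows "distr (PiM I \<kappa> \<Otimes>\<^sub>M PiM I \<kappa>') (PiM I (\<lambda>_. borel)) (\<lambda>x. \<lambda>i\<in>I. f i (fst x i, snd x i)) =
    PiM I (\<lambda>i. distr (\<kappa> i \<Otimes>\<^sub>M \<kappa>' i) borel (f i))"
proof -
  interpret K: real_distribution "\<kappa> i" for i by (rule \<kappa>)
  interpret K': real_distribution "\<kappa>' i" for i by (rule \<kappa>')
  interpret PK: product_sigma_finite \<kappa> ..
  interpret PK': product_sigma_finite \<kappa>' ..
  interpret P: pair_prob_space "\<kappa> i" "\<kappa>' i" for i ..
  interpret Q': prob_space "PiM I \<kappa>'" by (intro prob_space_PiM) unfold_locales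
  have pd: "prob_space (distr (\<kappa> i \<Otimes>\<^sub>M \<kappa>' i) borel (f i))" for i by (rule P.prob_space_distr) simp
  interpret PD: product_sigma_finite "\<lambda>i. distr (\<kappa> i \<Otimes>\<^sub>M \<kappa>' i) borel (f i)"
    by (intro product_sigma_finite.intro prob_space_imp_sigma_finite pd)
  show ?thesis
  proof (rule PD.PiM_eqI[OF I])
    let ?D = "distr (PiM I \<kappa> \<Otimes>\<^sub>M PiM I \<kappa>') (PiM I (\<lambda>_. borel)) (\<lambda>x. \<lambda>i\<in>I. f i (fst x i, snd x i))"
    show "sets ?D = sets (PiM I (\<lambda>i. distr (\<kappa> i \<Otimes>\<^sub>M \<kappa>' i) borel (f i)))"
      by (simp cong: sets_PiM_cong)
    fix A assume A: "\<And>i. i \<in> I \<Longrightarrow> A i \<in> sets (distr (\<kappa> i \<Otimes>\<^sub>M \<kappa>' i) borel (f i))"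
    then have [measurable]: "i \<in> I \<Longrightarrow> A i \<in> sets borel" for i by simp
    have "Pi\<^sub>E I A \<in> sets (PiM I (\<lambda>_. borel :: real measure))" using I A by (intro sets_PiM_I_finite) auto
    then have "emeasure ?D (Pi\<^sub>E I A) =
       (\<integral>\<^sup>+x. indicator (Pi\<^sub>E I A) (\<lambda>i\<in>I. f i (fst x i, snd x i)) \<partial>(PiM I \<kappa> \<Otimes>\<^sub>M PiM I \<kappa>'))"
      by (subst nn_integral_indicator[symmetric], simp, subst nn_integral_distr) auto
    also have "\<dots> = (\<integral>\<^sup>+x. (\<Prod>i\<in>I. indicator (A i) (f i (fst x i, snd x i))) \<partial>(PiM I \<kappa> \<Otimes>\<^sub>M PiM I \<kappa>'))"
      using I by (intro nn_integral_cong) (auto simp: indicator_def PiE_def Pi_def prod_zero_iff)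
    also have "\<dots> = (\<integral>\<^sup>+w. (\<integral>\<^sup>+w'. (\<Prod>i\<in>I. indicator (A i) (f i (w i, w' i))) \<partial>PiM I \<kappa>') \<partial>PiM I \<kappa>)"
      by (subst Q'.nn_integral_fst[symmetric]) (auto intro!: borel_measurable_prod_ennreal)
    also have "\<dots> = (\<integral>\<^sup>+w. (\<Prod>i\<in>I. \<integral>\<^sup>+y. indicator (A i) (f i (w i, y)) \<partial>\<kappa>' i) \<partial>PiM I \<kappa>)"
    proof (rule nn_integral_cong)
      fix w assume "w \<in> space (PiM I \<kappa>)"
      show "(\<integral>\<^sup>+w'. (\<Prod>i\<in>I. indicator (A i) (f i (w i, w' i))) \<partial>PiM I \<kappa>') =
        (\<Prod>i\<in>I. \<integral>\<^sup>+y. indicator (A i) (f i (w i, y)) \<partial>\<kappa>' i)"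
        using I by (rule PK'.product_nn_integral_prod) measurable
    qed
    also have "\<dots> = (\<Prod>i\<in>I. \<integral>\<^sup>+x. (\<integral>\<^sup>+y. indicator (A i) (f i (x, y)) \<partial>\<kappa>' i) \<partial>\<kappa> i)"
      using I by (rule PK.product_nn_integral_prod) measurable
    also have "\<dots> = (\<Prod>i\<in>I. emeasure (distr (\<kappa> i \<Otimes>\<^sub>M \<kappa>' i) borel (f i)) (A i))"
    proof (rule prod.cong[OF refl])
      fix i assume i: "i \<in> I"
      then show "(\<integral>\<^sup>+x. (\<integral>\<^sup>+y. indicator (A i) (f i (x, y)) \<partial>\<kappa>' i) \<partial>\<kappa> i) =
        emeasure (distr (\<kappa> i \<Otimes>\<^sub>M \<kappa>' i) borel (f i)) (A i)"
        by (subst nn_integral_indicator[symmetric], simp, subst nn_integral_distr,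
            simp, simp, subst K'.nn_integral_fst[symmetric]) auto
    qed
    finally show "emeasure ?D (Pi\<^sub>E I A) = (\<Prod>i\<in>I. emeasure (distr (\<kappa> i \<Otimes>\<^sub>M \<kappa>' i) borel (f i)) (A i))" .
  qed
qed

lemma PiM_density:
  fixes p :: "'i \<Rightarrow> real \<Rightarrow> real"
  assumes I: "finite I" and p[measurable]: "\<And>i. p i \<in> borel_measurable borel" and nn: "\<And>i x. 0 \<le> p i x"
    and ps: "\<And>i. prob_space (density lborel (\<lambda>x. ennreal (p i x)))"
  shows "PiM I (\<lambda>i. density lborel (\<lambda>x. ennreal (p i x))) =
    density (PiM I (\<lambda>_. lborel)) (\<lambda>w. ennreal (\<Prod>i\<in>I. p i (w i)))"
proof -
  interpret L: product_sigma_finite "\<lambda>_::'i. lborel :: real measure" ..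
  interpret PD: product_sigma_finite "\<lambda>i. density lborel (\<lambda>x. ennreal (p i x))"
    by (intro product_sigma_finite.intro prob_space_imp_sigma_finite ps)
  show ?thesis
  proof (rule PD.PiM_eqI[OF I, symmetric])
    let ?D = "density (PiM I (\<lambda>_. lborel)) (\<lambda>w. ennreal (\<Prod>i\<in>I. p i (w i)))"
    show "sets ?D = sets (PiM I (\<lambda>i. density lborel (\<lambda>x. ennreal (p i x))))"
      by (simp cong: sets_PiM_cong)
    fix A assume A: "\<And>i. i \<in> I \<Longrightarrow> A i \<in> sets (density lborel (\<lambda>x. ennreal (p i x)))"
    then have [measurable]: "i \<in> I \<Longrightarrow> A i \<in> sets borel" for i by simp
    have "Pi\<^sub>E I A \<in> sets (PiM I (\<lambda>_. lborel :: real measure))" using I A by (intro sets_PiM_I_finite) auto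
    then have "emeasure ?D (Pi\<^sub>E I A) =
       (\<integral>\<^sup>+w. ennreal (\<Prod>i\<in>I. p i (w i)) * indicator (Pi\<^sub>E I A) w \<partial>PiM I (\<lambda>_. lborel))"
      by (subst emeasure_density) auto
    also have "\<dots> = (\<integral>\<^sup>+w. (\<Prod>i\<in>I. ennreal (p i (w i)) * indicator (A i) (w i)) \<partial>PiM I (\<lambda>_. lborel))"
    proof (rule nn_integral_cong)
      fix w assume "w \<in> space (PiM I (\<lambda>_. lborel :: real measure))"
      then have "indicator (Pi\<^sub>E I A) w = (\<Prod>i\<in>I. indicator (A i) (w i) :: ennreal)"
        using I by (auto simp: indicator_def PiE_def Pi_def prod_zero_iff space_PiM)
      then show "ennreal (\<Prod>i\<in>I. p i (w i)) * indicator (Pi\<^sub>E I A) w =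
        (\<Prod>i\<in>I. ennreal (p i (w i)) * indicator (A i) (w i))"
        by (simp add: prod.distrib prod_ennreal nn)
    qed
    also have "\<dots> = (\<Prod>i\<in>I. \<integral>\<^sup>+x. ennreal (p i x) * indicator (A i) x \<partial>lborel)"
      using I by (rule L.product_nn_integral_prod) measurable
    also have "\<dots> = (\<Prod>i\<in>I. emeasure (density lborel (\<lambda>x. ennreal (p i x))) (A i))"
      by (intro prod.cong refl) (simp add: emeasure_density)
    finally show "emeasure ?D (Pi\<^sub>E I A) = (\<Prod>i\<in>I. emeasure (density lborel (\<lambda>x. ennreal (p i x))) (A i))" .
  qed
qed

text \<open>Weierstrass' product inequality. Applied to affinities, it says that 1 minus the
  affinity is subadditive on products.\<close>

lemma prod_ge_one_minus_sum:
  fixes a :: "'i \<Rightarrow> real"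
  assumes "finite I" "\<And>i. i \<in> I \<Longrightarrow> 0 \<le> a i" "\<And>i. i \<in> I \<Longrightarrow> a i \<le> 1"
  shows "1 - (\<Sum>i\<in>I. 1 - a i) \<le> (\<Prod>i\<in>I. a i)"
  using assms
proof (induction I)
  case (insert j I)
  have "(1 - a j) * (\<Prod>i\<in>I. a i) \<le> (1 - a j) * 1"
    using insert.prems insert.hyps by (intro mult_left_mono prod_le_1) auto
  then have "(\<Prod>i\<in>I. a i) - (1 - a j) \<le> a j * (\<Prod>i\<in>I. a i)" by (simp add: algebra_simps)
  moreover have "1 - (\<Sum>i\<in>I. 1 - a i) \<le> (\<Prod>i\<in>I. a i)" using insert by auto
  ultimately show ?case using insert.hyps by simp
qed simp

text \<open>The Hellinger distance is subadditive on products, which makes this bound Euclidean in the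
  \<open>\<epsilon> i\<close>; a bound by the sum of the one-dimensional total variations would not be.\<close>

lemma product_density_hellinger_bound:
  fixes p q :: "'i \<Rightarrow> real \<Rightarrow> real"
  assumes I: "finite I"
    and p[measurable]: "\<And>i. p i \<in> borel_measurable borel" and p0: "\<And>i x. 0 \<le> p i x"
    and pint: "\<And>i. integrable lborel (p i)" and p1: "\<And>i. (\<integral>x. p i x \<partial>lborel) = 1"
    and q[measurable]: "\<And>i. q i \<in> borel_measurable borel" and q0: "\<And>i x. 0 \<le> q i x"
    and qint: "\<And>i. integrable lborel (q i)" and q1: "\<And>i. (\<integral>x. q i x \<partial>lborel) = 1"
    and aff: "\<And>i. i \<in> I \<Longrightarrow> 1 - \<epsilon> i \<le> (\<integral>x. sqrt (p i x * q i x) \<partial>lborel)"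
    and f[measurable]: "f \<in> borel_measurable (PiM I (\<lambda>_. borel))" and fB: "\<And>w. \<bar>f w\<bar> \<le> B"
  shows "\<bar>(\<integral>w. f w \<partial>PiM I (\<lambda>i. density lborel (\<lambda>x. ennreal (p i x)))) -
     (\<integral>w. f w \<partial>PiM I (\<lambda>i. density lborel (\<lambda>x. ennreal (q i x))))\<bar> \<le> 2 * B * sqrt (2 * (\<Sum>i\<in>I. \<epsilon> i))"
proof -
  interpret L: product_sigma_finite "\<lambda>_::'i. lborel :: real measure" ..
  let ?L = "PiM I (\<lambda>_. lborel :: real measure)"
  have [measurable]: "f \<in> borel_measurable ?L" by (simp cong: measurable_cong_sets sets_PiM_cong)
  have B: "0 \<le> B" using fB[of undefined] by linarith
  let ?P = "\<lambda>w. \<Prod>i\<in>I. p i (w i)" and ?Q = "\<lambda>w. \<Prod>i\<in>I. q i (w i)"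
  have P0: "0 \<le> ?P w" and Q0: "0 \<le> ?Q w" for w by (auto intro: prod_nonneg p0 q0)
  have dens: "prob_space (density lborel (\<lambda>x. ennreal (r x)))"
    if "r \<in> borel_measurable borel" "\<And>x. 0 \<le> r x" "integrable lborel r" "(\<integral>x. r x \<partial>lborel) = 1" for r :: "real \<Rightarrow> real"
    using that nn_integral_eq_integral[of lborel r] by (intro prob_spaceI) (simp add: emeasure_density)
  have eqP: "(\<integral>w. f w \<partial>PiM I (\<lambda>i. density lborel (\<lambda>x. ennreal (p i x)))) = (\<integral>w. f w * ?P w \<partial>?L)"
    using I p0 dens[OF p p0 pint p1] by (subst PiM_density) (auto simp: integral_density P0 mult.commute)
  have eqQ: "(\<integral>w. f w \<partial>PiM I (\<lambda>i. density lborel (\<lambda>x. ennreal (q i x)))) = (\<integral>w. f w * ?Q w \<partial>?L)"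
    using I q0 dens[OF q q0 qint q1] by (subst PiM_density) (auto simp: integral_density Q0 mult.commute)
  have Pi: "integrable ?L ?P" "(\<integral>w. ?P w \<partial>?L) = 1"
    using I pint p1 by (auto simp: L.product_integral_prod intro!: L.product_integrable_prod)
  have Qi: "integrable ?L ?Q" "(\<integral>w. ?Q w \<partial>?L) = 1"
    using I qint q1 by (auto simp: L.product_integral_prod intro!: L.product_integrable_prod)
  let ?a = "\<lambda>i. \<integral>x. sqrt (p i x * q i x) \<partial>lborel"
  have a0: "0 \<le> ?a i" for i by (intro integral_nonneg_AE AE_I2) (simp add: p0 q0)
  have a1: "?a i \<le> 1" for i
    using integral_sqrt_mult_le(2)[OF pint p0 qint q0, of i i] p1 q1 by simp
  have ai: "integrable lborel (\<lambda>x. sqrt (p i x * q i x))" for i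
    by (rule integral_sqrt_mult_le(1)[OF pint p0 qint q0])
  have sq: "sqrt (?P w * ?Q w) = (\<Prod>i\<in>I. sqrt (p i (w i) * q i (w i)))" for w
    using I by (induction I) (auto simp: real_sqrt_mult)
  have Ai: "integrable ?L (\<lambda>w. sqrt (?P w * ?Q w))" "(\<integral>w. sqrt (?P w * ?Q w) \<partial>?L) = (\<Prod>i\<in>I. ?a i)"
    unfolding sq using L.product_integrable_prod[OF I ai] L.product_integral_prod[OF I ai] by auto
  define A where "A = (\<Prod>i\<in>I. ?a i)"
  have A: "1 - (\<Sum>i\<in>I. \<epsilon> i) \<le> A"
  proof -
    have "(\<Sum>i\<in>I. 1 - ?a i) \<le> (\<Sum>i\<in>I. \<epsilon> i)" using aff by (intro sum_mono) (auto simp: algebra_simps)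
    then show ?thesis using prod_ge_one_minus_sum[OF I, of ?a] a0 a1 by (auto simp: A_def)
  qed
  have A1: "A \<le> 1" unfolding A_def using a0 a1 by (intro prod_le_1) auto
  \<comment> \<open>\<open>P - Q\<close> is the product of the difference and the sum of the square
    roots. By Cauchy-Schwarz the L1 distance is at most
    \<open>sqrt ((2 - 2 * A) * (2 + 2 * A))\<close>, where the second factor is at most 4.\<close>
  let ?d = "\<lambda>w. (sqrt (?P w) - sqrt (?Q w))\<^sup>2" and ?s = "\<lambda>w. (sqrt (?P w) + sqrt (?Q w))\<^sup>2"
  have d: "?d w = ?P w + ?Q w - 2 * sqrt (?P w * ?Q w)" for w
    using P0 Q0 by (simp add: power2_diff real_sqrt_mult)
  have s: "?s w = ?P w + ?Q w + 2 * sqrt (?P w * ?Q w)" for w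
    using P0 Q0 by (simp add: power2_sum real_sqrt_mult)
  have di: "integrable ?L ?d" "(\<integral>w. ?d w \<partial>?L) = 2 - 2 * A"
    unfolding d using Pi Qi Ai by (auto simp: A_def)
  have si: "integrable ?L ?s" "(\<integral>w. ?s w \<partial>?L) = 2 + 2 * A"
    unfolding s using Pi Qi Ai by (auto simp: A_def)
  have ds: "sqrt (?d w * ?s w) = \<bar>?P w - ?Q w\<bar>" for w
  proof -
    have "?d w * ?s w = ((sqrt (?P w) - sqrt (?Q w)) * (sqrt (?P w) + sqrt (?Q w)))\<^sup>2"
      by (simp add: power_mult_distrib)
    also have "(sqrt (?P w) - sqrt (?Q w)) * (sqrt (?P w) + sqrt (?Q w)) = ?P w - ?Q w"
    proof -
      have "(sqrt a - sqrt b) * (sqrt a + sqrt b) = a - b" if "0 \<le> a" "0 \<le> b" for a b :: real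
        using that by (simp add: algebra_simps)
      then show ?thesis using P0 Q0 by blast
    qed
    finally show ?thesis by simp
  qed
  have PQ: "(\<integral>w. \<bar>?P w - ?Q w\<bar> \<partial>?L) \<le> 2 * sqrt (2 * (\<Sum>i\<in>I. \<epsilon> i))"
  proof -
    have "(\<integral>w. \<bar>?P w - ?Q w\<bar> \<partial>?L) \<le> sqrt ((2 - 2 * A) * (2 + 2 * A))"
      using integral_sqrt_mult_le(2)[OF di(1) _ si(1)] di(2) si(2) by (simp add: ds)
    also have "\<dots> \<le> sqrt ((2 * (\<Sum>i\<in>I. \<epsilon> i)) * 4)"
      using A A1 a0 by (intro real_sqrt_le_mono mult_mono) (auto simp: A_def intro!: prod_nonneg add_nonneg_nonneg)
    also have "\<dots> = 2 * sqrt (2 * (\<Sum>i\<in>I. \<epsilon> i))"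
      by (subst real_sqrt_mult[of _ 4]) simp
    finally show ?thesis .
  qed
  have fP: "integrable ?L (\<lambda>w. f w * ?P w)"
    by (rule Bochner_Integration.integrable_bound[OF integrable_mult_right[OF Pi(1), of B]])
      (use fB B P0 in \<open>auto simp: abs_mult intro!: mult_mono AE_I2\<close>)
  have fQ: "integrable ?L (\<lambda>w. f w * ?Q w)"
    by (rule Bochner_Integration.integrable_bound[OF integrable_mult_right[OF Qi(1), of B]])
      (use fB B Q0 in \<open>auto simp: abs_mult intro!: mult_mono AE_I2\<close>)
  have "\<bar>(\<integral>w. f w * ?P w \<partial>?L) - (\<integral>w. f w * ?Q w \<partial>?L)\<bar> = \<bar>\<integral>w. f w * (?P w - ?Q w) \<partial>?L\<bar>"
    using fP fQ by (subst Bochner_Integration.integral_diff[symmetric]) (auto simp: right_diff_distrib)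
  also have "\<dots> \<le> (\<integral>w. \<bar>f w * (?P w - ?Q w)\<bar> \<partial>?L)" by (rule integral_abs_bound)
  also have "\<dots> \<le> (\<integral>w. B * \<bar>?P w - ?Q w\<bar> \<partial>?L)"
  proof (rule integral_mono)
    show "integrable ?L (\<lambda>w. \<bar>f w * (?P w - ?Q w)\<bar>)" using fP fQ by (simp add: right_diff_distrib)
    show "integrable ?L (\<lambda>w. B * \<bar>?P w - ?Q w\<bar>)" using Pi Qi by simp
    show "\<bar>f w * (?P w - ?Q w)\<bar> \<le> B * \<bar>?P w - ?Q w\<bar>" for w
      unfolding abs_mult using fB by (intro mult_right_mono) auto
  qed
  also have "\<dots> = B * (\<integral>w. \<bar>?P w - ?Q w\<bar> \<partial>?L)" by simp
  also have "\<dots> \<le> B * (2 * sqrt (2 * (\<Sum>i\<in>I. \<epsilon> i)))" using B PQ by (intro mult_left_mono) auto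
  finally show ?thesis unfolding eqP eqQ by simp
qed

section \<open>The noise operator: translation bound and iterates\<close>

definition smoothing :: "(nat \<Rightarrow> real measure) \<Rightarrow> (nat \<Rightarrow> 'h) \<Rightarrow> nat \<Rightarrow> ('h::real_normed_vector \<Rightarrow> real) \<Rightarrow> 'h \<Rightarrow> real" where
  "smoothing \<kappa> e N g z = (\<integral>w. g (z + (\<Sum>n<N. w n *\<^sub>R e n)) \<partial>PiM {..<N} \<kappa>)"

text \<open>A shift of the argument along the first \<open>N\<close> modes is a translation of the
  coordinate laws, so \<open>g\<close> enters through its bound alone and no regularity of
  \<open>g\<close> is used. With \<open>inv_moment \<alpha> / 8 * (h n / c n)\<^sup>2\<close> as
  Hellinger error, the factor \<open>2 * B * sqrt (2 * ...)\<close> collapses to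
  \<open>B * sqrt (inv_moment \<alpha>)\<close>.\<close>

lemma smoothing_shift_bound:
  fixes \<kappa> :: "nat \<Rightarrow> real measure" and e :: "nat \<Rightarrow> 'h::{real_normed_vector, second_countable_topology}"
  assumes \<alpha>: "1 < \<alpha>" "\<alpha> < 2" and c: "\<And>n. 0 < c n"
    and rd: "\<And>n. real_distribution (\<kappa> n)"
    and ch: "\<And>n h. char (\<kappa> n) h = of_real (exp (- (\<bar>c n * h\<bar> powr \<alpha>)))"
    and g[measurable]: "g \<in> borel_measurable borel" and gB: "\<And>z. \<bar>g z\<bar> \<le> B"
  shows "\<bar>smoothing \<kappa> e N g (z + (\<Sum>n<N. h n *\<^sub>R e n)) - smoothing \<kappa> e N g z\<bar>
    \<le> B * sqrt (inv_moment \<alpha>) * sqrt (\<Sum>n<N. (h n / c n)\<^sup>2)"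
proof -
  interpret K: real_distribution "\<kappa> n" for n by (rule rd)
  define Q where "Q n p \<longleftrightarrow> p \<in> borel_measurable borel \<and> (\<forall>w. 0 \<le> p w) \<and>
    \<kappa> n = density lborel (\<lambda>w. ennreal (p w)) \<and> integrable lborel p \<and> (\<integral>w. p w \<partial>lborel) = 1 \<and>
    (\<forall>a. 1 - inv_moment \<alpha> / 8 * (a / c n)\<^sup>2 \<le> (\<integral>w. sqrt (p w * p (w - a)) \<partial>lborel))" for n p
  have "\<exists>p. Q n p" for n
    by (rule stable_law_density[OF \<alpha> c rd ch, of n]) (unfold Q_def, blast)
  then obtain p where "\<And>n. Q n (p n)" using choice[of Q] by auto
  then have p[measurable]: "\<And>n. p n \<in> borel_measurable borel" and p0: "\<And>n w. 0 \<le> p n w"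
    and \<kappa>p: "\<And>n. \<kappa> n = density lborel (\<lambda>w. ennreal (p n w))" and pint: "\<And>n. integrable lborel (p n)"
    and p1: "\<And>n. (\<integral>w. p n w \<partial>lborel) = 1"
    and aff: "\<And>n a. 1 - inv_moment \<alpha> / 8 * (a / c n)\<^sup>2 \<le> (\<integral>w. sqrt (p n w * p n (w - a)) \<partial>lborel)"
    unfolding Q_def by blast+
  have im: "0 \<le> inv_moment \<alpha>" by (simp add: inv_moment_def)
  define q where "q n w = p n (w - h n)" for n w
  have [measurable]: "q n \<in> borel_measurable borel" for n unfolding q_def by measurable
  have qi: "integrable lborel (q n)" "(\<integral>w. q n w \<partial>lborel) = 1" for n
    using lborel_integrable_real_affine[OF pint[of n], of 1 "- h n"]
      lborel_integral_real_affine[of 1 "p n" "- h n"] p1[of n] by (simp_all add: q_def[abs_def])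
  have shift: "distr (\<kappa> n) borel (\<lambda>x. x + h n) = density lborel (\<lambda>w. ennreal (q n w))" for n
  proof (rule measure_eqI)
    fix A assume "A \<in> sets (distr (\<kappa> n) borel (\<lambda>x. x + h n))"
    then have [measurable]: "A \<in> sets borel" by simp
    have "emeasure (distr (\<kappa> n) borel (\<lambda>x. x + h n)) A = (\<integral>\<^sup>+x. indicator A (x + h n) \<partial>\<kappa> n)"
      by (subst nn_integral_indicator[symmetric], simp, subst nn_integral_distr) auto
    also have "\<dots> = (\<integral>\<^sup>+x. ennreal (p n x) * indicator A (x + h n) \<partial>lborel)"
      unfolding \<kappa>p by (subst nn_integral_density) auto
    also have "\<dots> = (\<integral>\<^sup>+x. ennreal (q n x) * indicator A x \<partial>lborel)"
      by (subst nn_integral_real_affine[where c=1 and t="- h n"]) (auto simp: q_def)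
    finally show "emeasure (distr (\<kappa> n) borel (\<lambda>x. x + h n)) A = emeasure (density lborel (\<lambda>w. ennreal (q n w))) A"
      by (subst emeasure_density) auto
  qed simp
  have q0: "0 \<le> q n w" for n w by (simp add: q_def p0)
  have aff': "1 - inv_moment \<alpha> / 8 * (h n / c n)\<^sup>2 \<le> (\<integral>w. sqrt (p n w * q n w) \<partial>lborel)" for n
    using aff[of "h n" n] by (simp only: q_def)
  let ?I = "{..<N}"
  let ?f = "\<lambda>w. g (z + (\<Sum>n<N. w n *\<^sub>R e n))"
  have "smoothing \<kappa> e N g (z + (\<Sum>n<N. h n *\<^sub>R e n)) = (\<integral>w. ?f (\<lambda>n\<in>?I. w n + h n) \<partial>PiM ?I \<kappa>)"
    unfolding smoothing_def
  proof (rule Bochner_Integration.integral_cong[OF refl])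
    fix w
    have "(\<Sum>n<N. (\<lambda>n\<in>?I. w n + h n) n *\<^sub>R e n) = (\<Sum>n<N. w n *\<^sub>R e n) + (\<Sum>n<N. h n *\<^sub>R e n)"
      by (simp add: scaleR_add_left sum.distrib)
    then show "g (z + (\<Sum>n<N. h n *\<^sub>R e n) + (\<Sum>n<N. w n *\<^sub>R e n)) = ?f (\<lambda>n\<in>?I. w n + h n)"
      by (simp add: add_ac)
  qed
  also have "\<dots> = (\<integral>w. ?f w \<partial>distr (PiM ?I \<kappa>) (PiM ?I (\<lambda>_. borel)) (\<lambda>w. \<lambda>n\<in>?I. w n + h n))"
    by (subst integral_distr) auto
  also have "\<dots> = (\<integral>w. ?f w \<partial>PiM ?I (\<lambda>n. density lborel (\<lambda>x. ennreal (q n x))))"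
    by (subst distr_PiM_componentwise[OF _ rd]) (auto simp: shift)
  finally have 1: "smoothing \<kappa> e N g (z + (\<Sum>n<N. h n *\<^sub>R e n)) =
    (\<integral>w. ?f w \<partial>PiM ?I (\<lambda>n. density lborel (\<lambda>x. ennreal (q n x))))" .
  have 2: "smoothing \<kappa> e N g z = (\<integral>w. ?f w \<partial>PiM ?I (\<lambda>n. density lborel (\<lambda>x. ennreal (p n x))))"
    unfolding smoothing_def \<kappa>p ..
  have "\<bar>smoothing \<kappa> e N g (z + (\<Sum>n<N. h n *\<^sub>R e n)) - smoothing \<kappa> e N g z\<bar>
    \<le> 2 * B * sqrt (2 * (\<Sum>n<N. inv_moment \<alpha> / 8 * (h n / c n)\<^sup>2))"
    unfolding 1 2
    by (subst abs_minus_commute, rule product_density_hellinger_bound)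
      (auto simp: p0 pint p1 qi gB q0 aff' simp del: times_divide_eq_left)
  also have "2 * (\<Sum>n<N. inv_moment \<alpha> / 8 * (h n / c n)\<^sup>2) = (inv_moment \<alpha> * (\<Sum>n<N. (h n / c n)\<^sup>2)) / 4"
    by (subst sum_distrib_left[symmetric]) simp
  also have "2 * B * sqrt \<dots> = B * sqrt (inv_moment \<alpha>) * sqrt (\<Sum>n<N. (h n / c n)\<^sup>2)"
    by (simp add: real_sqrt_mult real_sqrt_divide)
  finally show ?thesis .
qed

lemma char_distr_affine_sum:
  assumes "real_distribution \<kappa>" "real_distribution \<kappa>'"
  shows "real_distribution (distr (\<kappa> \<Otimes>\<^sub>M \<kappa>') borel (\<lambda>x. fst x + b * snd x))"
    and "char (distr (\<kappa> \<Otimes>\<^sub>M \<kappa>') borel (\<lambda>x. fst x + b * snd x)) h = char \<kappa> h * char \<kappa>' (b * h)"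
proof -
  interpret K: real_distribution \<kappa> by fact
  interpret K': real_distribution \<kappa>' by fact
  interpret P: pair_prob_space \<kappa> \<kappa>' ..
  show "real_distribution (distr (\<kappa> \<Otimes>\<^sub>M \<kappa>') borel (\<lambda>x. fst x + b * snd x))"
    unfolding real_distribution_def real_distribution_axioms_def by (simp add: P.prob_space_distr)
  have int: "integrable (\<kappa> \<Otimes>\<^sub>M \<kappa>') (\<lambda>x. iexp (h * (fst x + b * snd x)))"
    by (rule P.integrable_const_bound[where B=1]) auto
  have "char (distr (\<kappa> \<Otimes>\<^sub>M \<kappa>') borel (\<lambda>x. fst x + b * snd x)) h =
      (\<integral>x. iexp (h * (fst x + b * snd x)) \<partial>(\<kappa> \<Otimes>\<^sub>M \<kappa>'))"
    unfolding char_def by (subst integral_distr) auto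
  also have "\<dots> = (\<integral>x. (\<integral>y. iexp (h * x) * iexp (b * h * y) \<partial>\<kappa>') \<partial>\<kappa>)"
    using P.integral_fst'[OF int] by (simp add: exp_add[symmetric] algebra_simps)
  also have "\<dots> = char \<kappa> h * char \<kappa>' (b * h)" unfolding char_def by simp
  finally show "char (distr (\<kappa> \<Otimes>\<^sub>M \<kappa>') borel (\<lambda>x. fst x + b * snd x)) h = char \<kappa> h * char \<kappa>' (b * h)" .
qed

text \<open>Noise added after an application of \<open>T\<close> equals \<open>T\<close> applied to
  the noise divided by the eigenvalue \<open>q n\<close>. All noise can therefore be moved in front
  of all applications of \<open>T\<close>: the layer of index \<open>i\<close> is magnified by
  \<open>(1 / q n) ^ i\<close>, hence its stable exponent by the \<open>\<alpha>\<close>-th power of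
  that factor.\<close>

lemma smoothing_iterate:
  fixes \<kappa> :: "nat \<Rightarrow> real measure" and e :: "nat \<Rightarrow> 'h::{real_normed_vector, second_countable_topology}"
    and T :: "'h \<Rightarrow> 'h"
  assumes T: "bounded_linear T" and Te: "\<And>n. n < N \<Longrightarrow> T (e n) = q n *\<^sub>R e n" and q: "\<And>n. 0 < q n"
    and rd: "\<And>n. real_distribution (\<kappa> n)"
    and ch: "\<And>n h. char (\<kappa> n) h = of_real (exp (- (s n * \<bar>h\<bar> powr \<alpha>)))"
  shows "\<exists>\<kappa>'. (\<forall>n. real_distribution (\<kappa>' n)) \<and>
    (\<forall>n h. char (\<kappa>' n) h = of_real (exp (- ((s n * (\<Sum>i\<le>j. (1 / q n) powr (\<alpha> * real i))) * \<bar>h\<bar> powr \<alpha>)))) \<and>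
    (\<forall>g\<in>borel_measurable borel. (\<forall>B. (\<forall>z. \<bar>g z\<bar> \<le> B) \<longrightarrow>
       ((\<lambda>f. smoothing \<kappa> e N (f \<circ> T)) ^^ Suc j) g = smoothing \<kappa>' e N (g \<circ> (T ^^ Suc j))))"
proof (induction j)
  case 0
  have "q n \<noteq> 0" for n using q[of n] by simp
  then show ?case using rd ch by (intro exI[of _ \<kappa>]) (auto simp: o_def)
next
  case (Suc j)
  then obtain \<kappa>' where rd': "\<And>n. real_distribution (\<kappa>' n)"
    and ch': "\<And>n h. char (\<kappa>' n) h = of_real (exp (- ((s n * (\<Sum>i\<le>j. (1 / q n) powr (\<alpha> * real i))) * \<bar>h\<bar> powr \<alpha>)))"
    and eq: "\<And>g B. g \<in> borel_measurable borel \<Longrightarrow> (\<And>z. \<bar>g z\<bar> \<le> B) \<Longrightarrow>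
       ((\<lambda>f. smoothing \<kappa> e N (f \<circ> T)) ^^ Suc j) g = smoothing \<kappa>' e N (g \<circ> (T ^^ Suc j))"
    by blast
  interpret T: bounded_linear T by (rule T)
  have lin: "bounded_linear (T ^^ i)" for i
    by (induction i) (auto simp: bounded_linear_ident id_def intro: bounded_linear_compose[OF T])
  have Tm[measurable]: "(T ^^ i) \<in> borel_measurable borel" for i
    using lin[of i] by (intro borel_measurable_continuous_onI linear_continuous_on) 
  define \<mu> where "\<mu> n = distr (\<kappa> n \<Otimes>\<^sub>M \<kappa>' n) borel (\<lambda>x. fst x + (1 / q n) * snd x)" for n
  interpret K: real_distribution "\<kappa> n" for n by (rule rd)
  interpret K': real_distribution "\<kappa>' n" for n by (rule rd')
  interpret PK: prob_space "PiM {..<N} \<kappa>" by (intro prob_space_PiM) unfold_locales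
  interpret PK': prob_space "PiM {..<N} \<kappa>'" by (intro prob_space_PiM) unfold_locales
  interpret P: pair_prob_space "PiM {..<N} \<kappa>" "PiM {..<N} \<kappa>'" ..
  have "char (\<mu> n) h = of_real (exp (- ((s n * (\<Sum>i\<le>Suc j. (1 / q n) powr (\<alpha> * real i))) * \<bar>h\<bar> powr \<alpha>)))" for n h
  proof -
    let ?r = "1 / q n"
    have r: "0 < ?r" using q[of n] by simp
    have "(\<Sum>i\<le>Suc j. ?r powr (\<alpha> * real i)) = 1 + (\<Sum>i\<le>j. ?r powr (\<alpha> * real (Suc i)))"
      using q[of n] by (subst sum.atMost_Suc_shift) simp
    also have "\<dots> = 1 + ?r powr \<alpha> * (\<Sum>i\<le>j. ?r powr (\<alpha> * real i))"
      by (simp add: sum_distrib_left powr_add[symmetric] algebra_simps)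
    finally have sm: "(\<Sum>i\<le>Suc j. ?r powr (\<alpha> * real i)) = 1 + ?r powr \<alpha> * (\<Sum>i\<le>j. ?r powr (\<alpha> * real i))" .
    have "\<bar>?r * h\<bar> powr \<alpha> = ?r powr \<alpha> * \<bar>h\<bar> powr \<alpha>" using r by (simp only: abs_mult powr_mult abs_of_pos)
    then show ?thesis unfolding \<mu>_def char_distr_affine_sum(2)[OF rd rd'] ch ch' sm
      by (simp only: of_real_mult[symmetric] exp_add[symmetric]) (simp add: algebra_simps)
  qed
  moreover have "((\<lambda>f. smoothing \<kappa> e N (f \<circ> T)) ^^ Suc (Suc j)) g = smoothing \<mu> e N (g \<circ> (T ^^ Suc (Suc j)))"
    if g[measurable]: "g \<in> borel_measurable borel" and B: "\<And>z. \<bar>g z\<bar> \<le> B" for g B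
  proof
    fix z
    let ?Tj = "T ^^ Suc j" and ?I = "{..<N}"
    let ?G = "\<lambda>w. g ((T ^^ Suc (Suc j)) (z + (\<Sum>n<N. w n *\<^sub>R e n)))"
    \<comment> \<open>The later noise \<open>w'\<close> is moved in front of \<open>T\<close> and
      joins \<open>w\<close> with weight \<open>1 / q n\<close>; the restriction makes the combined
      vector a point of the product space.\<close>
    have comb: "?Tj (T (z + (\<Sum>n<N. w n *\<^sub>R e n)) + (\<Sum>n<N. w' n *\<^sub>R e n)) =
      (T ^^ Suc (Suc j)) (z + (\<Sum>n<N. (\<lambda>n\<in>?I. w n + (1 / q n) * w' n) n *\<^sub>R e n))" for w w'
    proof -
      have "(\<Sum>n<N. w' n *\<^sub>R e n) = T (\<Sum>n<N. ((1 / q n) * w' n) *\<^sub>R e n)"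
        unfolding T.sum T.scaleR by (intro sum.cong refl) (use q in \<open>simp add: Te less_imp_neq[symmetric]\<close>)
      then have "T (z + (\<Sum>n<N. w n *\<^sub>R e n)) + (\<Sum>n<N. w' n *\<^sub>R e n) =
        T (z + (\<Sum>n<N. (\<lambda>n\<in>?I. w n + (1 / q n) * w' n) n *\<^sub>R e n))"
        by (simp add: T.add[symmetric] scaleR_add_left sum.distrib add.assoc)
      then show ?thesis by (simp add: funpow_swap1)
    qed
    have mG[measurable]: "(\<lambda>w. ?G w) \<in> borel_measurable (PiM ?I (\<lambda>_. borel))" by measurable
    have mc[measurable]: "(\<lambda>x. \<lambda>n\<in>?I. fst x n + (1 / q n) * snd x n) \<in>
        measurable (PiM ?I \<kappa> \<Otimes>\<^sub>M PiM ?I \<kappa>') (PiM ?I (\<lambda>_. borel))"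
      by measurable
    have int: "integrable (PiM ?I \<kappa> \<Otimes>\<^sub>M PiM ?I \<kappa>') (\<lambda>x. ?G (\<lambda>n\<in>?I. fst x n + (1 / q n) * snd x n))"
      using B by (intro P.integrable_const_bound[where B=B] measurable_compose[OF mc mG]) (simp del: funpow.simps)
    have "((\<lambda>f. smoothing \<kappa> e N (f \<circ> T)) ^^ Suc (Suc j)) g z =
      smoothing \<kappa> e N (smoothing \<kappa>' e N (g \<circ> ?Tj) \<circ> T) z"
      by (subst funpow.simps(2), subst o_apply, subst eq[OF g B]) rule
    also have "\<dots> = (\<integral>w. (\<integral>w'. ?G (\<lambda>n\<in>?I. w n + (1 / q n) * w' n) \<partial>PiM ?I \<kappa>') \<partial>PiM ?I \<kappa>)"
      unfolding smoothing_def o_apply comb ..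
    also have "\<dots> = (\<integral>x. ?G (\<lambda>n\<in>?I. fst x n + (1 / q n) * snd x n) \<partial>(PiM ?I \<kappa> \<Otimes>\<^sub>M PiM ?I \<kappa>'))"
      using P.integral_fst'[OF int] by (simp del: funpow.simps)
    also have "\<dots> = (\<integral>w. ?G w \<partial>distr (PiM ?I \<kappa> \<Otimes>\<^sub>M PiM ?I \<kappa>') (PiM ?I (\<lambda>_. borel))
        (\<lambda>x. \<lambda>n\<in>?I. fst x n + (1 / q n) * snd x n))"
      by (rule integral_distr[OF mc mG, symmetric])
    also have "\<dots> = (\<integral>w. ?G w \<partial>PiM ?I \<mu>)"
      using distr_pair_PiM_componentwise[OF _ rd rd', of ?I "\<lambda>n x. fst x + (1 / q n) * snd x"]
      by (simp add: \<mu>_def[abs_def])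
    finally show "((\<lambda>f. smoothing \<kappa> e N (f \<circ> T)) ^^ Suc (Suc j)) g z = smoothing \<mu> e N (g \<circ> (T ^^ Suc (Suc j))) z"
      by (simp add: smoothing_def)
  qed
  moreover have "real_distribution (\<mu> n)" for n unfolding \<mu>_def by (rule char_distr_affine_sum(1)[OF rd rd'])
  ultimately show ?case by (intro exI[of _ \<mu>]) blast
qed

section \<open>Perturbation by a bounded drift\<close>

text \<open>Comparison with an integral, made in increments: by the mean value theorem the
  antiderivative \<open>z powr (1 - g) / (1 - g)\<close> grows by at least
  \<open>real (Suc n) powr - g\<close> between \<open>n\<close> and \<open>n + 1\<close>.\<close>

lemma sum_powr_neg_le:
  fixes g :: real
  assumes g: "0 \<le> g" "g < 1"
  shows "(\<Sum>k=1..n. real k powr - g) \<le> real n powr (1 - g) / (1 - g)"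
proof (induction n)
  case (Suc n)
  show ?case
  proof (cases "n = 0")
    case True
    then show ?thesis using g by simp
  next
    case False
    have "\<exists>z. real n < z \<and> z < real (Suc n) \<and>
        real (Suc n) powr (1 - g) - real n powr (1 - g) = (real (Suc n) - real n) * ((1 - g) * z powr (1 - g - 1))"
      using False by (intro MVT2) (auto intro!: derivative_eq_intros)
    then obtain z where z: "real n < z" "z < real (Suc n)"
      "real (Suc n) powr (1 - g) - real n powr (1 - g) = (1 - g) * z powr (- g)"
      by auto
    have "real (Suc n) powr (- g) \<le> z powr (- g)"
      using z False g by (intro powr_mono2') auto
    then have "(1 - g) * real (Suc n) powr (- g) \<le> real (Suc n) powr (1 - g) - real n powr (1 - g)"
      unfolding z(3) using g by (intro mult_left_mono) auto
    then have "real (Suc n) powr (- g) \<le> (real (Suc n) powr (1 - g) - real n powr (1 - g)) / (1 - g)"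
      using g by (simp add: field_simps)
    with Suc.IH show ?thesis by (simp add: diff_divide_distrib)
  qed
qed simp

text \<open>Discrete form of the Beta integral of \<open>s powr - g * (t - s) powr - g\<close>. One
  of \<open>k\<close> and \<open>n - k\<close> is at least \<open>n / 2\<close>, which freezes one
  factor, and the other is summed. The result is split into a factor that is small for short times
  and the original singularity, so that it can be absorbed in an inductive bound of the same
  shape.\<close>

lemma singular_convolution_sum_le:
  fixes g \<delta> :: real
  assumes g: "0 \<le> g" "g < 1" and \<delta>: "0 < \<delta>" and n: "1 \<le> n"
  shows "(\<Sum>k\<in>{1..<n}. \<delta> * (real k * \<delta>) powr - g * (real (n - k) * \<delta>) powr - g)
    \<le> 4 / (1 - g) * (real n * \<delta>) powr (1 - g) * (real n * \<delta>) powr - g"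
proof -
  have half: "real k powr - g * real (n - k) powr - g \<le> 2 * real n powr - g * (real k powr - g + real (n - k) powr - g)"
    if k: "k \<in> {1..<n}" for k
  proof -
    have n0: "0 < real n / 2" using n by simp
    have h: "(real n / 2) powr - g \<le> 2 * real n powr - g"
    proof -
      have "(real n / 2) powr - g = real n powr - g * 2 powr g"
        using n by (simp add: powr_divide powr_minus field_simps)
      also have "2 powr g \<le> 2 powr 1" using g by (intro powr_mono) auto
      finally show ?thesis using n by (simp add: mult.commute)
    qed
    have "real k powr - g * real (n - k) powr - g \<le> (real n / 2) powr - g * (real k powr - g + real (n - k) powr - g)"
    proof (cases "real n / 2 \<le> real k")
      case True
      then have "real k powr - g \<le> (real n / 2) powr - g" using n0 g by (intro powr_mono2') auto
      then have "real k powr - g * real (n - k) powr - g \<le> (real n / 2) powr - g * real (n - k) powr - g"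
        by (intro mult_right_mono) auto
      also have "\<dots> \<le> (real n / 2) powr - g * (real k powr - g + real (n - k) powr - g)"
        by (intro mult_left_mono) auto
      finally show ?thesis .
    next
      case False
      then have "real (n - k) powr - g \<le> (real n / 2) powr - g" using n0 g k by (intro powr_mono2') auto
      then have "real k powr - g * real (n - k) powr - g \<le> real k powr - g * (real n / 2) powr - g"
        by (intro mult_left_mono) auto
      also have "\<dots> \<le> (real n / 2) powr - g * (real k powr - g + real (n - k) powr - g)"
        by (subst mult.commute, intro mult_left_mono) auto
      finally show ?thesis .
    qed
    also have "\<dots> \<le> (2 * real n powr - g) * (real k powr - g + real (n - k) powr - g)"
      using h by (intro mult_right_mono) auto
    finally show ?thesis by simp
  qed
  have s1: "(\<Sum>k\<in>{1..<n}. real k powr - g) \<le> real n powr (1 - g) / (1 - g)"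
    by (rule order_trans[OF sum_mono2 sum_powr_neg_le[OF g]]) auto
  have "(\<Sum>k\<in>{1..<n}. real (n - k) powr - g) = (\<Sum>k\<in>{1..<n}. real k powr - g)"
    by (rule sum.reindex_bij_witness[where i="\<lambda>k. n - k" and j="\<lambda>k. n - k"]) auto
  with s1 have s2: "(\<Sum>k\<in>{1..<n}. real (n - k) powr - g) \<le> real n powr (1 - g) / (1 - g)" by simp
  have "(\<Sum>k\<in>{1..<n}. real k powr - g * real (n - k) powr - g)
    \<le> (\<Sum>k\<in>{1..<n}. 2 * real n powr - g * (real k powr - g + real (n - k) powr - g))"
    by (intro sum_mono half)
  also have "\<dots> = 2 * real n powr - g * ((\<Sum>k\<in>{1..<n}. real k powr - g) + (\<Sum>k\<in>{1..<n}. real (n - k) powr - g))"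
    by (simp only: sum_distrib_left[symmetric] sum.distrib)
  also have "\<dots> \<le> 2 * real n powr - g * (real n powr (1 - g) / (1 - g) + real n powr (1 - g) / (1 - g))"
    using s1 s2 by (intro mult_left_mono add_mono) auto
  finally have S: "(\<Sum>k\<in>{1..<n}. real k powr - g * real (n - k) powr - g)
    \<le> 4 / (1 - g) * (real n powr (1 - g) * real n powr - g)" by (simp add: mult_ac)
  have "(\<Sum>k\<in>{1..<n}. \<delta> * (real k * \<delta>) powr - g * (real (n - k) * \<delta>) powr - g) =
    \<delta> powr (1 - g) * \<delta> powr - g * (\<Sum>k\<in>{1..<n}. real k powr - g * real (n - k) powr - g)"
    unfolding sum_distrib_left
  proof (rule sum.cong[OF refl])
    fix k
    have "\<delta> powr (1 - g) = \<delta> * \<delta> powr - g" using \<delta> by (simp add: powr_diff powr_minus field_simps)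
    then show "\<delta> * (real k * \<delta>) powr - g * (real (n - k) * \<delta>) powr - g =
      \<delta> powr (1 - g) * \<delta> powr - g * (real k powr - g * real (n - k) powr - g)"
      using \<delta> by (simp add: powr_mult)
  qed
  also have "\<dots> \<le> \<delta> powr (1 - g) * \<delta> powr - g * (4 / (1 - g) * (real n powr (1 - g) * real n powr - g))"
    using S by (intro mult_left_mono) auto
  also have "\<dots> = 4 / (1 - g) * (real n * \<delta>) powr (1 - g) * (real n * \<delta>) powr - g"
    using \<delta> by (simp add: powr_mult)
  finally show ?thesis .
qed

text \<open>The bound is a parameter because it is what iterates preserve. Continuity passes through
  the noise operator by dominated convergence and makes every iterate measurable.\<close>

definition bcont :: "real \<Rightarrow> ('h::topological_space \<Rightarrow> real) \<Rightarrow> bool" where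
  "bcont B f \<longleftrightarrow> continuous_on UNIV f \<and> (\<forall>z. \<bar>f z\<bar> \<le> B)"

text \<open>\<open>R\<close> is one linear step and \<open>\<delta> *\<^sub>R G\<close> the drift of
  one step. Regularisation takes place along \<open>V\<close>, the span of the modes carrying noise,
  so the drift is confined to \<open>V\<close>. The gradient bound sees \<open>f\<close> through its
  bound \<open>B\<close> alone.\<close>

locale perturbed_kernel =
  fixes R :: "('h::real_normed_vector \<Rightarrow> real) \<Rightarrow> 'h \<Rightarrow> real" and V :: "'h set"
    and G :: "'h \<Rightarrow> 'h" and \<delta> \<Phi> C g :: real
  assumes R_bcont: "\<And>f B. bcont B f \<Longrightarrow> bcont B (R f)"
    and R_diff: "\<And>f f' B B'. bcont B f \<Longrightarrow> bcont B' f' \<Longrightarrow> R (\<lambda>z. f z - f' z) = (\<lambda>z. R f z - R f' z)"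
    and R_gradient: "\<And>f B j z h. bcont B f \<Longrightarrow> 1 \<le> j \<Longrightarrow> h \<in> V \<Longrightarrow>
       \<bar>(R ^^ j) f (z + h) - (R ^^ j) f z\<bar> \<le> C * (real j * \<delta>) powr - g * B * norm h"
    and \<delta>: "0 < \<delta>" and C: "0 \<le> C" and g: "0 \<le> g" "g < 1"
    and V: "subspace V" and G_cont: "continuous_on UNIV G" and GV: "\<And>z. G z \<in> V" and G_le: "\<And>z. norm (G z) \<le> \<Phi>"
begin

definition Q :: "('h \<Rightarrow> real) \<Rightarrow> 'h \<Rightarrow> real" where
  "Q f z = R f (z + \<delta> *\<^sub>R G z)"

lemma Q_bcont: "bcont B f \<Longrightarrow> bcont B (Q f)"
proof -
  assume "bcont B f"
  then have R: "bcont B (R f)" by (rule R_bcont)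
  then have c: "continuous_on UNIV (R f)" by (simp add: bcont_def)
  have "continuous_on UNIV (\<lambda>z. R f (z + \<delta> *\<^sub>R G z))"
    by (rule continuous_on_compose2[OF c]) (auto intro!: continuous_intros G_cont)
  then show "bcont B (Q f)" using R by (simp add: bcont_def Q_def[abs_def])
qed

lemma funpow_Q_bcont: "bcont B f \<Longrightarrow> bcont B ((Q ^^ n) f)"
  by (induction n) (auto intro: Q_bcont)

lemma funpow_R_bcont: "bcont B f \<Longrightarrow> bcont B ((R ^^ n) f)"
  by (induction n) (auto intro: R_bcont)

lemma funpow_Q_diff:
  "bcont B f \<Longrightarrow> bcont B' f' \<Longrightarrow> (Q ^^ n) (\<lambda>z. f z - f' z) = (\<lambda>z. (Q ^^ n) f z - (Q ^^ n) f' z)"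
proof (induction n)
  case (Suc n)
  then show ?case
    using R_diff[OF funpow_Q_bcont[OF Suc.prems(1)] funpow_Q_bcont[OF Suc.prems(2)], of n n]
    by (simp add: Q_def[abs_def])
qed simp

text \<open>Telescoping over \<open>k\<close> of \<open>(Q ^^ k) ((R ^^ (n - k)) f)\<close>: each
  difference exchanges one \<open>R\<close> for one \<open>Q\<close>, and these differ by the drift
  shift.\<close>

lemma duhamel:
  assumes f: "bcont B f"
  shows "(Q ^^ n) f z = (R ^^ n) f z +
    (\<Sum>k<n. (Q ^^ k) (\<lambda>z. (R ^^ (n - k)) f (z + \<delta> *\<^sub>R G z) - (R ^^ (n - k)) f z) z)"
proof -
  have "(Q ^^ k) (\<lambda>z. (R ^^ (n - k)) f (z + \<delta> *\<^sub>R G z) - (R ^^ (n - k)) f z) z =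
    (Q ^^ Suc k) ((R ^^ (n - Suc k)) f) z - (Q ^^ k) ((R ^^ (n - k)) f) z" if k: "k < n" for k
  proof -
    have Rs: "(R ^^ (n - k)) f = R ((R ^^ (n - Suc k)) f)" using k by (simp add: Suc_diff_Suc[symmetric])
    have "(\<lambda>z. (R ^^ (n - k)) f (z + \<delta> *\<^sub>R G z)) = Q ((R ^^ (n - Suc k)) f)"
      unfolding Rs by (simp add: Q_def fun_eq_iff)
    then show ?thesis
      using funpow_Q_diff[OF Q_bcont[OF funpow_R_bcont[OF f]] funpow_R_bcont[OF f], of k "n - Suc k" "n - k"]
      by (simp add: funpow_swap1 fun_eq_iff)
  qed
  then have "(\<Sum>k<n. (Q ^^ k) (\<lambda>z. (R ^^ (n - k)) f (z + \<delta> *\<^sub>R G z) - (R ^^ (n - k)) f z) z) =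
     (\<Sum>k<n. (Q ^^ Suc k) ((R ^^ (n - Suc k)) f) z - (Q ^^ k) ((R ^^ (n - k)) f) z)" by simp
  also have "\<dots> = (Q ^^ n) f z - (R ^^ n) f z"
    using sum_lessThan_telescope[of "\<lambda>k. (Q ^^ k) ((R ^^ (n - k)) f) z" n] by simp
  finally show ?thesis by simp
qed

text \<open>The term \<open>k = 0\<close> of Duhamel's formula is only estimated by the supremum norm. It carries
  a factor \<open>\<delta>\<close>, so it disappears in the limit; no a priori Lipschitz bound is needed.\<close>

lemma perturbed_gradient_bound:
  assumes xy: "x - y \<in> V" and f: "bcont B f" and n: "1 \<le> n"
    and small: "C * \<Phi> * (4 / (1 - g) * (real n * \<delta>) powr (1 - g)) \<le> 1 / 2"
  shows "\<bar>(Q ^^ n) f x - (Q ^^ n) f y\<bar>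
    \<le> 2 * (C * norm (x - y) + 2 * C * \<Phi> * \<delta>) * (real n * \<delta>) powr - g * B"
  using f n small
proof (induction n arbitrary: f B rule: less_induct)
  case (less n)
  let ?t = "\<lambda>k. (real k * \<delta>) powr - g"
  \<comment> \<open>Twice the joint contribution of \<open>R ^^ n\<close> and of the term
    \<open>k = 0\<close>; smallness of the time lets the remaining terms reproduce at most half of
    \<open>D\<close>.\<close>
  define D where "D = 2 * (C * norm (x - y) + 2 * C * \<Phi> * \<delta>)"
  have \<Phi>: "0 \<le> \<Phi>" using norm_ge_zero[of "G 0"] G_le[of 0] by linarith
  have B: "0 \<le> B" using less.prems(1) unfolding bcont_def by (meson abs_ge_zero order_trans)
  have D: "0 \<le> D" unfolding D_def using C \<Phi> \<delta> by (intro mult_nonneg_nonneg add_nonneg_nonneg) auto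
  define E where "E k z = (R ^^ (n - k)) f (z + \<delta> *\<^sub>R G z) - (R ^^ (n - k)) f z" for k z
  define \<epsilon> where "\<epsilon> k = C * ?t (n - k) * B * (\<delta> * \<Phi>)" for k
  have E: "bcont (\<epsilon> k) (E k)" if k: "k < n" for k
  proof -
    have c: "continuous_on UNIV ((R ^^ (n - k)) f)"
      using funpow_R_bcont[OF less.prems(1)] by (simp add: bcont_def)
    have "continuous_on UNIV (\<lambda>z. (R ^^ (n - k)) f (z + \<delta> *\<^sub>R G z))"
      by (rule continuous_on_compose2[OF c]) (auto intro!: continuous_intros G_cont)
    then have "continuous_on UNIV (E k)" unfolding E_def[abs_def] by (intro continuous_on_diff c)
    moreover have "\<bar>E k z\<bar> \<le> \<epsilon> k" for z
    proof -
      have "\<bar>E k z\<bar> \<le> C * ?t (n - k) * B * norm (\<delta> *\<^sub>R G z)"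
        unfolding E_def using k by (intro R_gradient less.prems(1) subspace_scale[OF V] GV) auto
      also have "\<dots> \<le> \<epsilon> k" unfolding \<epsilon>_def
        using G_le[of z] \<delta> C B by (intro mult_left_mono) auto
      finally show ?thesis .
    qed
    ultimately show ?thesis by (simp add: bcont_def)
  qed
  have main: "\<bar>(R ^^ n) f x - (R ^^ n) f y\<bar> \<le> C * ?t n * B * norm (x - y)"
    using R_gradient[OF less.prems(1,2) xy, of y] by simp
  have zero: "\<bar>(Q ^^ 0) (E 0) x - (Q ^^ 0) (E 0) y\<bar> \<le> 2 * \<epsilon> 0"
  proof -
    have "\<bar>E 0 x\<bar> \<le> \<epsilon> 0" "\<bar>E 0 y\<bar> \<le> \<epsilon> 0" using E[of 0] less.prems(2) by (auto simp: bcont_def)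
    then show ?thesis by simp
  qed
  \<comment> \<open>The induction hypothesis at \<open>k\<close> is applied to the error function
    \<open>E k\<close> with its own bound \<open>\<epsilon> k\<close>; this is why \<open>f\<close>
    and \<open>B\<close> are generalised. Smallness of the time at \<open>n\<close> implies it at
    \<open>k\<close>.\<close>
  have pos: "\<bar>(Q ^^ k) (E k) x - (Q ^^ k) (E k) y\<bar> \<le> D * C * \<Phi> * B * (\<delta> * ?t k * ?t (n - k))"
    if k: "k \<in> {1..<n}" for k
  proof -
    have "C * \<Phi> * (4 / (1 - g) * (real k * \<delta>) powr (1 - g)) \<le> C * \<Phi> * (4 / (1 - g) * (real n * \<delta>) powr (1 - g))"
      using k g C \<Phi> \<delta> by (intro mult_left_mono powr_mono2 mult_right_mono) auto
    then have "\<bar>(Q ^^ k) (E k) x - (Q ^^ k) (E k) y\<bar> \<le> D * ?t k * \<epsilon> k"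
      unfolding D_def using k less.prems(3) by (intro less.IH E) auto
    then show ?thesis by (simp add: \<epsilon>_def mult_ac)
  qed
  have "\<bar>(Q ^^ n) f x - (Q ^^ n) f y\<bar> \<le> \<bar>(R ^^ n) f x - (R ^^ n) f y\<bar> +
    (\<Sum>k<n. \<bar>(Q ^^ k) (E k) x - (Q ^^ k) (E k) y\<bar>)"
  proof -
    have "(Q ^^ n) f x - (Q ^^ n) f y = ((R ^^ n) f x - (R ^^ n) f y) +
       (\<Sum>k<n. (Q ^^ k) (E k) x - (Q ^^ k) (E k) y)"
      unfolding duhamel[OF less.prems(1), of n] E_def[abs_def] by (simp add: sum_subtractf)
    then show ?thesis
      using sum_abs[of "\<lambda>k. (Q ^^ k) (E k) x - (Q ^^ k) (E k) y" "{..<n}"] by linarith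
  qed
  also have "(\<Sum>k<n. \<bar>(Q ^^ k) (E k) x - (Q ^^ k) (E k) y\<bar>) =
    \<bar>(Q ^^ 0) (E 0) x - (Q ^^ 0) (E 0) y\<bar> + (\<Sum>k\<in>{1..<n}. \<bar>(Q ^^ k) (E k) x - (Q ^^ k) (E k) y\<bar>)"
    using less.prems(2) by (simp add: sum.atLeast_Suc_lessThan[of 0 n] atLeast0LessThan[symmetric])
  also have "(\<Sum>k\<in>{1..<n}. \<bar>(Q ^^ k) (E k) x - (Q ^^ k) (E k) y\<bar>) \<le>
    (\<Sum>k\<in>{1..<n}. D * C * \<Phi> * B * (\<delta> * ?t k * ?t (n - k)))"
    by (intro sum_mono pos)
  also have "\<dots> = D * C * \<Phi> * B * (\<Sum>k\<in>{1..<n}. \<delta> * ?t k * ?t (n - k))" by (simp add: sum_distrib_left)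
  also have "\<dots> \<le> D * C * \<Phi> * B * (4 / (1 - g) * (real n * \<delta>) powr (1 - g) * ?t n)"
    using D C \<Phi> B by (intro mult_left_mono singular_convolution_sum_le[OF g \<delta> less.prems(2)]) auto
  also have "\<dots> = (D * B * ?t n) * (C * \<Phi> * (4 / (1 - g) * (real n * \<delta>) powr (1 - g)))" by (simp add: mult_ac)
  also have "\<dots> \<le> (D * B * ?t n) * (1 / 2)"
    using D B less.prems(3) by (intro mult_left_mono) auto
  finally have "\<bar>(Q ^^ n) f x - (Q ^^ n) f y\<bar> \<le> C * ?t n * B * norm (x - y) + (2 * \<epsilon> 0 + (D * B * ?t n) * (1 / 2))"
    using main zero by linarith
  also have "\<dots> = D * ?t n * B" by (simp add: \<epsilon>_def D_def algebra_simps)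
  finally show ?case unfolding D_def .
qed

end

section \<open>From Lipschitz to Borel functions\<close>

lemma closed_indicator_lipschitz_approx:
  fixes C :: "'a::metric_space set"
  assumes C: "closed C" "C \<noteq> {}"
  defines "\<phi> \<equiv> \<lambda>n x. max 0 (1 - real n * infdist x C)"
  shows "\<And>n. (real n)-lipschitz_on UNIV (\<phi> n)" "\<And>n x. 0 \<le> \<phi> n x \<and> \<phi> n x \<le> 1"
    "\<And>x. (\<lambda>n. \<phi> n x) \<longlonglongrightarrow> indicator C x"
proof -
  show "(real n)-lipschitz_on UNIV (\<phi> n)" for n
  proof (rule lipschitz_onI)
    fix x y :: 'a
    have "\<bar>infdist x C - infdist y C\<bar> \<le> dist x y" by (rule infdist_triangle_abs)
    then have "real n * \<bar>infdist x C - infdist y C\<bar> \<le> real n * dist x y" by (intro mult_left_mono) auto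
    moreover have "\<bar>\<phi> n x - \<phi> n y\<bar> \<le> \<bar>real n * infdist x C - real n * infdist y C\<bar>"
      unfolding \<phi>_def by (auto simp: max_def abs_if)
    moreover have "\<bar>real n * infdist x C - real n * infdist y C\<bar> = real n * \<bar>infdist x C - infdist y C\<bar>"
      by (simp add: abs_mult right_diff_distrib[symmetric])
    ultimately show "dist (\<phi> n x) (\<phi> n y) \<le> real n * dist x y" by (simp add: dist_real_def)
  qed simp
  show "0 \<le> \<phi> n x \<and> \<phi> n x \<le> 1" for n x by (simp add: \<phi>_def infdist_nonneg)
  show "(\<lambda>n. \<phi> n x) \<longlonglongrightarrow> indicator C x" for x
  proof (cases "x \<in> C")
    case True
    then show ?thesis by (simp add: \<phi>_def infdist_zero)
  next
    case False
    then have d: "0 < infdist x C" using C in_closed_iff_infdist_zero[OF C] infdist_nonneg[of x C] by force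
    have "\<forall>\<^sub>F n in sequentially. 1 / infdist x C \<le> real n"
      using filterlim_real_sequentially by (simp add: filterlim_at_top)
    then have "\<forall>\<^sub>F n in sequentially. \<phi> n x = 0"
      by eventually_elim (use d in \<open>simp add: \<phi>_def field_simps\<close>)
    then show ?thesis using False by (simp add: tendsto_eventually)
  qed
qed

text \<open>Lipschitz functions approximate indicators of closed sets, closed sets exhaust Borel
  sets by inner regularity on a Polish space, and level sets approximate \<open>f\<close>. The
  estimate passes through all three stages without loss in the constant.\<close>

lemma bounded_borel_integral_diff_bound:
  fixes \<mu> \<nu> :: "'a::{metric_space, second_countable_topology, complete_space} measure"
  assumes \<mu>: "prob_space \<mu>" "sets \<mu> = sets borel" and \<nu>: "prob_space \<nu>" "sets \<nu> = sets borel"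
    and lip: "\<And>(g :: 'a \<Rightarrow> real) L. L-lipschitz_on UNIV g \<Longrightarrow> (\<And>x. \<bar>g x\<bar> \<le> 1) \<Longrightarrow> \<bar>(\<integral>x. g x \<partial>\<mu>) - (\<integral>x. g x \<partial>\<nu>)\<bar> \<le> K"
    and f: "f \<in> borel_measurable borel" and fB: "\<And>x. \<bar>f x\<bar> \<le> B"
  shows "\<bar>(\<integral>x. f x \<partial>\<mu>) - (\<integral>x. f x \<partial>\<nu>)\<bar> \<le> B * K"
proof -
  interpret \<mu>: prob_space \<mu> by fact
  interpret \<nu>: prob_space \<nu> by fact
  note [measurable_cong] = \<mu>(2) \<nu>(2)
  note f[measurable]
  have K: "0 \<le> K" using lip[of 0 "\<lambda>_. 0"] by (simp add: lipschitz_on_def)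
  have B: "0 \<le> B" using fB[of undefined] by linarith
  have closed: "\<bar>measure \<mu> C - measure \<nu> C\<bar> \<le> K / 2" if C: "closed C" for C
  proof (cases "C = {}")
    case False
    define \<phi> where "\<phi> n x = max 0 (1 - real n * infdist x C)" for n and x :: 'a
    note \<phi> = closed_indicator_lipschitz_approx[OF C False, folded \<phi>_def]
    have [measurable]: "\<phi> n \<in> borel_measurable borel" for n
      using \<phi>(1)[of n] by (intro borel_measurable_continuous_onI lipschitz_on_continuous_on)
    have [measurable]: "C \<in> sets borel" using C by simp
    have lim: "(\<lambda>n. \<integral>x. \<phi> n x \<partial>m) \<longlonglongrightarrow> measure m C" if m: "prob_space m" and [measurable_cong]: "sets m = sets borel" for m
    proof -
      interpret m: prob_space m by fact
      have "(\<lambda>n. \<integral>x. \<phi> n x \<partial>m) \<longlonglongrightarrow> (\<integral>x. indicator C x \<partial>m)"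
        by (rule integral_dominated_convergence[where w="\<lambda>_. 1"]) (use \<phi> in \<open>auto\<close>)
      moreover have "C \<in> sets m" by measurable
      ultimately show ?thesis using sets.sets_into_space[of C m] by (simp add: Int_absorb2)
    qed
    have "\<bar>(\<integral>x. \<phi> n x \<partial>\<mu>) - (\<integral>x. \<phi> n x \<partial>\<nu>)\<bar> \<le> K / 2" for n
    proof -
      have i: "integrable \<mu> (\<phi> n)" "integrable \<nu> (\<phi> n)"
        using \<phi>(2) by (auto intro!: \<mu>.integrable_const_bound[where B=1] \<nu>.integrable_const_bound[where B=1])
      \<comment> \<open>Recentring to the range between -1 and 1 gains the factor 1/2 on sets. At
        the end \<open>f\<close>, of oscillation at most \<open>2 * B\<close>, gives back exactly
        \<open>B * K\<close>.\<close>
      have "(2 * real n)-lipschitz_on UNIV (\<lambda>x. 2 * \<phi> n x - 1)"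
      proof (rule lipschitz_onI)
        show "dist (2 * \<phi> n x - 1) (2 * \<phi> n y - 1) \<le> 2 * real n * dist x y" for x y
          using lipschitz_onD[OF \<phi>(1), of x y n] by (simp add: dist_real_def)
      qed simp
      moreover have "\<bar>2 * \<phi> n x - 1\<bar> \<le> 1" for x using \<phi>(2)[of n x] by auto
      ultimately have "\<bar>(\<integral>x. 2 * \<phi> n x - 1 \<partial>\<mu>) - (\<integral>x. 2 * \<phi> n x - 1 \<partial>\<nu>)\<bar> \<le> K" by (rule lip)
      moreover have "(\<integral>x. 2 * \<phi> n x - 1 \<partial>\<mu>) - (\<integral>x. 2 * \<phi> n x - 1 \<partial>\<nu>) = 2 * ((\<integral>x. \<phi> n x \<partial>\<mu>) - (\<integral>x. \<phi> n x \<partial>\<nu>))"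
        using i \<mu>.prob_space \<nu>.prob_space by simp
      ultimately show ?thesis by (simp only: abs_mult) simp
    qed
    moreover have "(\<lambda>n. \<bar>(\<integral>x. \<phi> n x \<partial>\<mu>) - (\<integral>x. \<phi> n x \<partial>\<nu>)\<bar>) \<longlonglongrightarrow> \<bar>measure \<mu> C - measure \<nu> C\<bar>"
      by (intro tendsto_intros lim \<mu> \<nu>)
    ultimately show ?thesis by (intro LIMSEQ_le_const2) auto
  qed (use K in simp)
  have inner: "\<exists>C. C \<subseteq> A \<and> closed C \<and> measure m A - e < measure m C"
    if m: "prob_space m" "sets m = sets borel" and A: "A \<in> sets borel" and e: "0 < e" for m :: "'a measure" and A e
  proof -
    interpret m: prob_space m by fact
    have "emeasure m A = (SUP K \<in> {K. K \<subseteq> A \<and> compact K}. emeasure m K)"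
      using m A by (intro inner_regular) (auto simp: m.emeasure_eq_measure)
    show ?thesis
    proof (cases "measure m A - e < 0")
      case True
      then show ?thesis by (intro exI[of _ "{}"]) auto
    next
      case False
      then have "ennreal (measure m A - e) < emeasure m A"
        using e by (simp add: m.emeasure_eq_measure ennreal_less_iff)
      also have "\<dots> = (SUP K \<in> {K. K \<subseteq> A \<and> compact K}. emeasure m K)" by fact
      finally obtain C where "C \<subseteq> A" "compact C" "ennreal (measure m A - e) < emeasure m C"
        unfolding less_SUP_iff by auto
      then show ?thesis using False
        by (intro exI[of _ C]) (auto simp: m.emeasure_eq_measure ennreal_less_iff compact_imp_closed)
    qed
  qed
  have sets: "\<bar>measure \<mu> A - measure \<nu> A\<bar> \<le> K / 2" if A: "A \<in> sets borel" for A
  proof (rule field_le_epsilon)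
    fix e :: real assume e: "0 < e"
    obtain C1 where C1: "C1 \<subseteq> A" "closed C1" "measure \<mu> A - e < measure \<mu> C1" using inner[OF \<mu> A e] by blast
    obtain C2 where C2: "C2 \<subseteq> A" "closed C2" "measure \<nu> A - e < measure \<nu> C2" using inner[OF \<nu> A e] by blast
    \<comment> \<open>The union is one closed set that approximates \<open>A\<close> from inside for
      both measures at once.\<close>
    have C: "closed (C1 \<union> C2)" "C1 \<union> C2 \<subseteq> A" using C1 C2 by auto
    have "measure \<mu> C1 \<le> measure \<mu> (C1 \<union> C2)" "measure \<mu> (C1 \<union> C2) \<le> measure \<mu> A"
      "measure \<nu> C2 \<le> measure \<nu> (C1 \<union> C2)" "measure \<nu> (C1 \<union> C2) \<le> measure \<nu> A"
      using C C1 C2 A \<mu> \<nu> by (auto intro!: \<mu>.finite_measure_mono \<nu>.finite_measure_mono)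
    then show "\<bar>measure \<mu> A - measure \<nu> A\<bar> \<le> K / 2 + e"
      using closed[OF C(1)] C1(3) C2(3) by linarith
  qed
  show ?thesis
  proof (cases "B = 0")
    case True
    then have "f x = 0" for x using fB[of x] by simp
    then show ?thesis using True by simp
  next
    case False
    then have Bp: "0 < B" using B by simp
    define h where "h x = (f x + B) / (2 * B)" for x
    have h: "0 \<le> h x" "h x \<le> 1" for x using fB[of x] Bp by (auto simp: h_def field_simps abs_le_iff)
    have [measurable]: "h \<in> borel_measurable borel" unfolding h_def by measurable
    have hi: "integrable \<mu> h" "integrable \<nu> h"
      using h by (auto intro!: \<mu>.integrable_const_bound[where B=1] \<nu>.integrable_const_bound[where B=1])
    have "\<bar>(\<integral>x. h x \<partial>\<mu>) - (\<integral>x. h x \<partial>\<nu>)\<bar> \<le> K / 2"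
    proof (rule field_le_epsilon)
      fix e :: real assume "0 < e"
      then obtain n :: nat where n: "0 < n" "2 / real n < e"
      proof -
        obtain n :: nat where n: "2 / e < real n" using reals_Archimedean2 by blast
        have "0 < 2 / e" using \<open>0 < e\<close> by simp
        then have "0 < real n" using n by linarith
        then show ?thesis using n \<open>0 < e\<close> by (intro that[of n]) (auto simp: field_simps)
      qed
      define A where "A i = {x. real i / real n \<le> h x}" for i
      have [measurable]: "A i \<in> sets borel" for i unfolding A_def by measurable
      \<comment> \<open>Layer-cake approximation: it counts the levels not above \<open>h x\<close>,
        so it is within \<open>1 / real n\<close> of \<open>h\<close>. This error occurs once for
        each measure, whence \<open>2 / real n < e\<close>.\<close>
      define hn where "hn x = (\<Sum>i=1..n. indicator (A i) x) / real n" for x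
      have hn: "\<bar>h x - hn x\<bar> \<le> 1 / real n" for x
      proof -
        define k where "k = nat \<lfloor>real n * h x\<rfloor>"
        have nh: "0 \<le> real n * h x" "real n * h x \<le> real n" using h[of x] n by (auto simp: mult_left_le)
        have k: "real k \<le> real n * h x" "real n * h x < real k + 1" using nh by (auto simp: k_def)
        then have kn: "k \<le> n" using nh by linarith
        have "x \<in> A i \<longleftrightarrow> i \<le> k" for i
        proof -
          have "x \<in> A i \<longleftrightarrow> real i \<le> real n * h x" using n by (simp add: A_def field_simps)
          also have "\<dots> \<longleftrightarrow> i \<le> k" using k by linarith
          finally show ?thesis .
        qed
        then have "(\<Sum>i=1..n. indicator (A i) x :: real) = (\<Sum>i=1..n. if i \<in> {1..k} then 1 else 0)"
          by (intro sum.cong) (auto simp: indicator_def)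
        also have "\<dots> = real k" using kn by (subst sum.inter_restrict[symmetric]) (auto simp: Int_absorb1)
        finally have "hn x = real k / real n" by (simp add: hn_def)
        then show ?thesis using k n by (simp add: abs_le_iff field_simps)
      qed
      have int: "(\<integral>x. hn x \<partial>m) = (\<Sum>i=1..n. measure m (A i)) / real n" "integrable m hn" 
        if m: "prob_space m" and [measurable_cong]: "sets m = sets borel" for m
      proof -
        interpret m: prob_space m by fact
        have "space m = UNIV" using sets_eq_imp_space_eq[OF that(2)] by simp
        then show "(\<integral>x. hn x \<partial>m) = (\<Sum>i=1..n. measure m (A i)) / real n" "integrable m hn"
          unfolding hn_def[abs_def] by (auto simp: m.emeasure_eq_measure)
      qed
      have d: "\<bar>(\<integral>x. h x \<partial>m) - (\<integral>x. hn x \<partial>m)\<bar> \<le> 1 / real n"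
        if m: "prob_space m" and s: "sets m = sets borel" and i: "integrable m h" for m
      proof -
        interpret m: prob_space m by fact
        have "\<bar>(\<integral>x. h x \<partial>m) - (\<integral>x. hn x \<partial>m)\<bar> = \<bar>\<integral>x. h x - hn x \<partial>m\<bar>" using int[OF m s] i by simp
        also have "\<dots> \<le> (\<integral>x. \<bar>h x - hn x\<bar> \<partial>m)" by (rule integral_abs_bound)
        also have "\<dots> \<le> (\<integral>x. 1 / real n \<partial>m)" using int[OF m s] i hn by (intro integral_mono) auto
        finally show ?thesis using m.prob_space by simp
      qed
      have "\<bar>(\<integral>x. hn x \<partial>\<mu>) - (\<integral>x. hn x \<partial>\<nu>)\<bar> = \<bar>\<Sum>i=1..n. measure \<mu> (A i) - measure \<nu> (A i)\<bar> / real n"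
        using int(1)[OF \<mu>] int(1)[OF \<nu>] n by (simp add: sum_subtractf diff_divide_distrib[symmetric])
      also have "\<dots> \<le> (\<Sum>i=1..n. K / 2) / real n"
        using sets n by (intro divide_right_mono order_trans[OF sum_abs] sum_mono) auto
      also have "\<dots> = K / 2" using n by simp
      finally show "\<bar>(\<integral>x. h x \<partial>\<mu>) - (\<integral>x. h x \<partial>\<nu>)\<bar> \<le> K / 2 + e"
        using d[OF \<mu> hi(1)] d[OF \<nu> hi(2)] n by linarith
    qed
    then have "2 * B * \<bar>(\<integral>x. h x \<partial>\<mu>) - (\<integral>x. h x \<partial>\<nu>)\<bar> \<le> 2 * B * (K / 2)"
      using Bp by (intro mult_left_mono) auto
    moreover have "(\<integral>x. f x \<partial>m) = 2 * B * (\<integral>x. h x \<partial>m) - B" if m: "prob_space m" and [measurable_cong]: "sets m = sets borel" for m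
    proof -
      interpret m: prob_space m by fact
      have "integrable m f" using fB by (intro m.integrable_const_bound[where B=B]) auto
      then have "(\<integral>x. h x \<partial>m) = ((\<integral>x. f x \<partial>m) + B) / (2 * B)"
        unfolding h_def using m.prob_space by simp
      then show ?thesis using Bp by simp
    qed
    then have "(\<integral>x. f x \<partial>\<mu>) - (\<integral>x. f x \<partial>\<nu>) = 2 * B * ((\<integral>x. h x \<partial>\<mu>) - (\<integral>x. h x \<partial>\<nu>))"
      using \<mu> \<nu> by (simp add: right_diff_distrib)
    ultimately show ?thesis using Bp by (simp add: abs_mult)
  qed
qed

section \<open>The diagonal semigroup\<close>

definition proj :: "(nat \<Rightarrow> 'h) \<Rightarrow> nat \<Rightarrow> 'h::real_inner \<Rightarrow> 'h" where
  "proj e N x = (\<Sum>n<N. (x \<bullet> e n) *\<^sub>R e n)"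

context
  fixes e :: "nat \<Rightarrow> 'h::{real_inner, banach, second_countable_topology}"
  assumes ob: "orthonormal_basis e"
begin

lemma inner_basis: "e m \<bullet> e n = (if m = n then 1 else 0)"
  using ob unfolding orthonormal_basis_def by blast

lemma inner_sum_basis:
  assumes "finite I"
  shows "(\<Sum>n\<in>I. c n *\<^sub>R e n) \<bullet> e k = (if k \<in> I then c k else 0)"
proof -
  have "(\<Sum>n\<in>I. c n *\<^sub>R e n) \<bullet> e k = (\<Sum>n\<in>I. if n = k then c n else 0)"
    unfolding inner_sum_left by (intro sum.cong refl) (simp add: inner_basis)
  then show ?thesis using assms by simp
qed

lemma norm_sum_basis:
  assumes "finite I"
  shows "(norm (\<Sum>n\<in>I. c n *\<^sub>R e n))\<^sup>2 = (\<Sum>n\<in>I. (c n)\<^sup>2)"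
  using assms unfolding power2_norm_eq_inner
  by (subst inner_sum_right) (simp add: inner_sum_basis power2_eq_square)

lemma norm_proj_pythagoras: "(norm x)\<^sup>2 = (norm (proj e N x))\<^sup>2 + (norm (x - proj e N x))\<^sup>2"
proof -
  have "proj e N x \<bullet> x = (\<Sum>n<N. (x \<bullet> e n)\<^sup>2)"
    unfolding proj_def inner_sum_left inner_scaleR_left power2_eq_square
    by (intro sum.cong refl) (simp only: inner_commute[of "e _" x])
  moreover have "proj e N x \<bullet> proj e N x = (\<Sum>n<N. (x \<bullet> e n)\<^sup>2)"
    unfolding proj_def power2_norm_eq_inner[symmetric] by (rule norm_sum_basis) simp
  ultimately show ?thesis
    unfolding power2_norm_eq_inner inner_diff_left inner_diff_right inner_commute[of x "proj e N x"] by simp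
qed

lemma norm_proj_le: "norm (proj e N x) \<le> norm x"
proof (rule power2_le_imp_le)
  show "(norm (proj e N x))\<^sup>2 \<le> (norm x)\<^sup>2"
    using norm_proj_pythagoras[of x N] zero_le_power2[of "norm (x - proj e N x)"] by linarith
qed simp

lemma norm_proj_compl_le: "norm (x - proj e N x) \<le> norm x"
proof (rule power2_le_imp_le)
  show "(norm (x - proj e N x))\<^sup>2 \<le> (norm x)\<^sup>2"
    using norm_proj_pythagoras[of x N] zero_le_power2[of "norm (proj e N x)"] by linarith
qed simp

lemma bounded_linear_proj: "bounded_linear (proj e N)"
proof (rule bounded_linear_intro)
  show "proj e N (x + y) = proj e N x + proj e N y" for x y
    unfolding proj_def inner_add_left scaleR_add_left sum.distrib ..
  show "proj e N (r *\<^sub>R x) = r *\<^sub>R proj e N x" for r x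
    unfolding proj_def inner_scaleR_left scaleR_sum_right scaleR_scaleR ..
  show "norm (proj e N x) \<le> norm x * 1" for x using norm_proj_le by simp
qed

lemma proj_sum_basis: "proj e N (\<Sum>n<N. c n *\<^sub>R e n) = (\<Sum>n<N. c n *\<^sub>R e n)"
  unfolding proj_def by (intro sum.cong refl) (simp add: inner_sum_basis)

lemma proj_idem: "proj e N (proj e N x) = proj e N x"
  using proj_sum_basis[of N "\<lambda>n. x \<bullet> e n"] by (simp only: proj_def[of e N x, symmetric])

text \<open>On each vector of the span the projections are eventually the identity; they are
  contractions, so the convergence extends to the closure.\<close>

lemma proj_tendsto: "(\<lambda>N. proj e N x) \<longlonglongrightarrow> x"
proof -
  have span: "\<exists>N0. \<forall>N\<ge>N0. proj e N y = y" if "y \<in> span (range e)" for y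
    using that
  proof (induction rule: span_induct)
    show "subspace {y. \<exists>N0. \<forall>N\<ge>N0. proj e N y = y}"
    proof (intro subspaceI CollectI; (elim CollectE exE)?)
      fix x y Nx Ny assume "\<forall>N\<ge>Nx. proj e N x = x" "\<forall>N\<ge>Ny. proj e N y = y"
      then show "\<exists>N0. \<forall>N\<ge>N0. proj e N (x + y) = x + y"
        by (intro exI[of _ "max Nx Ny"]) (simp add: linear_simps[OF bounded_linear_proj])
    next
      fix c x N0 assume "\<forall>N\<ge>N0. proj e N x = x"
      then show "\<exists>N0. \<forall>N\<ge>N0. proj e N (c *\<^sub>R x) = c *\<^sub>R x"
        by (intro exI[of _ N0]) (simp add: linear_simps[OF bounded_linear_proj])
    qed (simp add: proj_def)
  next
    fix y assume "y \<in> range e"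
    then obtain k where k: "y = e k" by auto
    show "\<exists>N0. \<forall>N\<ge>N0. proj e N y = y"
    proof (intro exI[of _ "Suc k"] allI impI)
      fix N assume "Suc k \<le> N"
      moreover have "proj e N (e k) = (\<Sum>n<N. if n = k then e k else 0)"
        unfolding proj_def by (intro sum.cong refl) (simp add: inner_basis)
      ultimately show "proj e N y = y" by (simp add: k)
    qed
  qed
  have "x \<in> closure (span (range e))" using ob by (simp add: orthonormal_basis_def)
  show ?thesis
  proof (rule LIMSEQ_I)
    fix r :: real assume r: "0 < r"
    then obtain y where y: "y \<in> span (range e)" "dist y x < r / 3"
      using \<open>x \<in> closure (span (range e))\<close> closure_approachable[of x "span (range e)"]
      by (metis divide_pos_pos zero_less_numeral)
    obtain N0 where N0: "\<And>N. N \<ge> N0 \<Longrightarrow> proj e N y = y" using span[OF y(1)] by blast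
    have "norm (proj e N x - x) < r" if "N \<ge> N0" for N
    proof -
      have "proj e N x - x = proj e N (x - y) + (y - x)"
        using N0[OF that] by (simp add: linear_simps[OF bounded_linear_proj])
      then have "norm (proj e N x - x) = norm (proj e N (x - y) + (y - x))" by (rule arg_cong)
      also have "\<dots> \<le> norm (x - y) + norm (y - x)"
        using norm_proj_le[of N "x - y"] norm_triangle_ineq[of "proj e N (x - y)" "y - x"] by linarith
      finally have "norm (proj e N x - x) \<le> norm (x - y) + norm (y - x)" .
      then show ?thesis using y(2) r by (simp add: dist_norm norm_minus_commute)
    qed
    then show "\<exists>no. \<forall>N\<ge>no. norm (proj e N x - x) < r" by blast
  qed
qed

lemma expansion_finite:
  assumes I: "finite I" and z: "\<And>k. k \<notin> I \<Longrightarrow> x \<bullet> e k = 0"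
  shows "x = (\<Sum>k\<in>I. (x \<bullet> e k) *\<^sub>R e k)"
proof (rule LIMSEQ_unique[OF proj_tendsto])
  obtain N0 where N0: "I \<subseteq> {..<N0}" using finite_nat_iff_bounded I by blast
  have "proj e N x = (\<Sum>k\<in>I. (x \<bullet> e k) *\<^sub>R e k)" if "N0 \<le> N" for N
    unfolding proj_def using that N0 z by (intro sum.mono_neutral_right) auto
  then show "(\<lambda>N. proj e N x) \<longlonglongrightarrow> (\<Sum>k\<in>I. (x \<bullet> e k) *\<^sub>R e k)"
    by (intro tendsto_eventually) (auto simp: eventually_sequentially)
qed

section \<open>The diagonal semigroup: action on the basis, contractivity and regularity in
  time\<close>

context
  fixes \<gamma> :: "nat \<Rightarrow> real" and D :: "'h set" and A :: "'h \<Rightarrow> 'h" and S :: "real \<Rightarrow> 'h \<Rightarrow> 'h"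
  assumes \<gamma>0: "\<And>n. 0 < \<gamma> n" and \<gamma>inf: "filterlim \<gamma> at_top sequentially"
    and sa: "self_adjoint_op D A" and eig: "\<And>n. e n \<in> D \<and> A (e n) = - \<gamma> n *\<^sub>R e n"
    and gen: "semigroup_generated_by D A S"
begin

lemma semigroup_bounded_linear: "0 \<le> t \<Longrightarrow> bounded_linear (S t)"
  using gen by (auto simp: semigroup_generated_by_def C0_semigroup_def)

lemma semigroup_zero: "S 0 x = x"
  using gen by (auto simp: semigroup_generated_by_def C0_semigroup_def)

lemma semigroup_add: "0 \<le> s \<Longrightarrow> 0 \<le> t \<Longrightarrow> S (s + t) x = S s (S t x)"
  using gen by (auto simp: semigroup_generated_by_def C0_semigroup_def)

lemma generator_iff: "((\<lambda>h. (S h x - x) /\<^sub>R h) \<longlongrightarrow> y) (at_right 0) \<longleftrightarrow> (x \<in> D \<and> y = A x)"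
  using gen by (auto simp: semigroup_generated_by_def)

lemma generator_commutes:
  assumes t: "0 \<le> t" and x: "x \<in> D"
  shows "S t x \<in> D" "A (S t x) = S t (A x)"
proof -
  note lin = semigroup_bounded_linear[OF t]
  have "((\<lambda>h. S t ((S h x - x) /\<^sub>R h)) \<longlongrightarrow> S t (A x)) (at_right 0)"
    using generator_iff[of x "A x"] x by (intro bounded_linear.tendsto[OF lin]) auto
  moreover have "\<forall>\<^sub>F h in at_right 0. S t ((S h x - x) /\<^sub>R h) = (S h (S t x) - S t x) /\<^sub>R h"
    using eventually_at_right_less[of "0::real"]
  proof eventually_elim
    case (elim h)
    have "S t (S h x) = S h (S t x)"
      using elim t by (simp add: semigroup_add[symmetric] add.commute)
    then show ?case by (simp add: linear_simps[OF lin])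
  qed
  ultimately have "((\<lambda>h. (S h (S t x) - S t x) /\<^sub>R h) \<longlongrightarrow> S t (A x)) (at_right 0)"
    by (simp add: tendsto_cong)
  then show "S t x \<in> D" "A (S t x) = S t (A x)" using generator_iff[of "S t x" "S t (A x)"] by auto
qed

text \<open>The semigroup commutes with its generator, so \<open>S t (e n)\<close> satisfies the
  eigenvalue equation for \<open>- \<gamma> n\<close>; self-adjointness makes it orthogonal to
  eigenvectors of other eigenvalues.\<close>

lemma semigroup_eigenspace:
  assumes t: "0 \<le> t" and ne: "\<gamma> k \<noteq> \<gamma> n"
  shows "S t (e n) \<bullet> e k = 0"
proof -
  have "\<forall>x\<in>D. A x \<bullet> e k = x \<bullet> A (e k)"
    using sa eig[of k] unfolding self_adjoint_op_def by blast
  then have "A (S t (e n)) \<bullet> e k = S t (e n) \<bullet> A (e k)"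
    using generator_commutes(1)[OF t] eig by blast
  moreover have "A (S t (e n)) = - \<gamma> n *\<^sub>R S t (e n)"
    using generator_commutes(2)[OF t, of "e n"] eig[of n] by (simp add: linear_simps[OF semigroup_bounded_linear[OF t]])
  ultimately have "\<gamma> n * (S t (e n) \<bullet> e k) = \<gamma> k * (S t (e n) \<bullet> e k)" using eig[of k] by simp
  then show ?thesis using ne by simp
qed

text \<open>On the eigenspace of \<open>\<gamma> n\<close>, which is finite-dimensional and invariant, the rescaled
  semigroup \<open>exp (\<gamma> n * h) *\<^sub>R S h\<close> is \<open>1 + o(h)\<close> in operator norm, so its powers stay close to
  the identity.\<close>

lemma semigroup_basis:
  assumes t: "0 \<le> t"
  shows "S t (e n) = exp (- \<gamma> n * t) *\<^sub>R e n"
proof -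
  \<comment> \<open>Eigenvalues may repeat, so orthogonality confines \<open>S t (e n)\<close> only
    to the span of the modes in \<open>I\<close>. This set is finite because \<open>\<gamma>\<close>
    tends to infinity.\<close>
  define I where "I = {k. \<gamma> k = \<gamma> n}"
  have fin: "finite I"
  proof -
    have "\<forall>\<^sub>F k in sequentially. \<gamma> n < \<gamma> k" using \<gamma>inf by (simp add: filterlim_at_top_dense)
    then obtain K where K: "\<And>k. K \<le> k \<Longrightarrow> \<gamma> n < \<gamma> k" unfolding eventually_sequentially by blast
    have "k < K" if "k \<in> I" for k using K[of k] that by (cases "K \<le> k") (auto simp: I_def)
    then have "I \<subseteq> {..<K}" by auto
    then show ?thesis by (rule finite_subset) simp
  qed
  define E where "E = {x. \<forall>k. k \<notin> I \<longrightarrow> x \<bullet> e k = 0}"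
  have Esum: "x = (\<Sum>k\<in>I. (x \<bullet> e k) *\<^sub>R e k)" if "x \<in> E" for x
    using that by (intro expansion_finite fin) (auto simp: E_def)
  define U where "U h x = exp (\<gamma> n * h) *\<^sub>R S h x" for h x
  have Ulin: "U h (\<Sum>k\<in>I. c k *\<^sub>R e k) = (\<Sum>k\<in>I. c k *\<^sub>R U h (e k))" if "0 \<le> h" for h c
  proof -
    interpret L: bounded_linear "S h" by (rule semigroup_bounded_linear[OF that])
    show ?thesis unfolding U_def L.sum L.scaleR scaleR_sum_right
      by (intro sum.cong refl) (simp add: mult.commute)
  qed
  have Usum: "U h x = (\<Sum>k\<in>I. (x \<bullet> e k) *\<^sub>R U h (e k))" if h: "0 \<le> h" and x: "x \<in> E" for h x
  proof -
    have "U h x = U h (\<Sum>k\<in>I. (x \<bullet> e k) *\<^sub>R e k)" by (rule arg_cong[OF Esum[OF x]])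
    then show ?thesis by (simp only: Ulin[OF h])
  qed
  have UE: "U h x \<in> E" if h: "0 \<le> h" and x: "x \<in> E" for h x
  proof -
    have "U h x \<bullet> e l = 0" if l: "l \<notin> I" for l
    proof -
      have "U h (e k) \<bullet> e l = 0" if "k \<in> I" for k
        using semigroup_eigenspace[OF h, of l k] that l by (auto simp: I_def U_def)
      then show ?thesis by (subst Usum[OF h x]) (simp add: inner_sum_left)
    qed
    then show ?thesis by (simp add: E_def)
  qed
  have lim: "((\<lambda>h. (U h (e k) - e k) /\<^sub>R h) \<longlongrightarrow> 0) (at_right 0)" if k: "k \<in> I" for k
  proof -
    have A: "((\<lambda>h. (S h (e k) - e k) /\<^sub>R h) \<longlongrightarrow> - \<gamma> n *\<^sub>R e k) (at_right 0)"
      using generator_iff[of "e k" "A (e k)"] eig[of k] k by (simp add: I_def)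
    have B: "((\<lambda>h. (exp (\<gamma> n * h) - 1) / h) \<longlongrightarrow> \<gamma> n) (at_right 0)" by real_asymp
    have C: "((\<lambda>h. exp (\<gamma> n * h)) \<longlongrightarrow> 1) (at_right 0)" by real_asymp
    have "((\<lambda>h. exp (\<gamma> n * h) *\<^sub>R ((S h (e k) - e k) /\<^sub>R h) + ((exp (\<gamma> n * h) - 1) / h) *\<^sub>R e k) \<longlongrightarrow>
      1 *\<^sub>R (- \<gamma> n *\<^sub>R e k) + \<gamma> n *\<^sub>R e k) (at_right 0)"
      by (intro tendsto_intros A B C)
    moreover have "exp (\<gamma> n * h) *\<^sub>R ((S h (e k) - e k) /\<^sub>R h) + ((exp (\<gamma> n * h) - 1) / h) *\<^sub>R e k =
      (U h (e k) - e k) /\<^sub>R h" for h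
      by (simp add: U_def algebra_simps divide_inverse)
    ultimately show ?thesis by simp
  qed
  \<comment> \<open>The derivative at 0 vanishes on finitely many basis vectors, hence uniformly on
    their span; \<open>c\<close> below leaves room for the sum over \<open>card I\<close>
    directions.\<close>
  have near: "\<exists>h0>0. \<forall>h. 0 < h \<and> h < h0 \<longrightarrow> (\<forall>x\<in>E. norm (U h x - x) \<le> \<epsilon> * h * norm x)" if \<epsilon>: "0 < \<epsilon>" for \<epsilon>
  proof -
    define c where "c = \<epsilon> / (real (card I) + 1)"
    have c: "0 < c" using \<epsilon> by (simp add: c_def)
    have "\<forall>\<^sub>F h in at_right 0. \<forall>k\<in>I. norm ((U h (e k) - e k) /\<^sub>R h) < c"
    proof (intro eventually_ball_finite fin ballI)
      fix k assume "k \<in> I"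
      from tendstoD[OF lim[OF this] c] show "\<forall>\<^sub>F h in at_right 0. norm ((U h (e k) - e k) /\<^sub>R h) < c" by simp
    qed
    then obtain h0 where h0: "0 < h0" "\<And>h k. 0 < h \<Longrightarrow> h < h0 \<Longrightarrow> k \<in> I \<Longrightarrow> norm ((U h (e k) - e k) /\<^sub>R h) < c"
      unfolding eventually_at_right_field by auto
    have "norm (U h x - x) \<le> \<epsilon> * h * norm x" if h: "0 < h" "h < h0" and x: "x \<in> E" for h x
    proof -
      have "U h x - x = (\<Sum>k\<in>I. (x \<bullet> e k) *\<^sub>R U h (e k)) - (\<Sum>k\<in>I. (x \<bullet> e k) *\<^sub>R e k)"
        using h by (intro arg_cong2[where f=minus] Usum Esum x) simp
      also have "\<dots> = (\<Sum>k\<in>I. (x \<bullet> e k) *\<^sub>R (U h (e k) - e k))"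
        by (simp add: sum_subtractf scaleR_diff_right)
      finally have eq: "U h x - x = (\<Sum>k\<in>I. (x \<bullet> e k) *\<^sub>R (U h (e k) - e k))" .
      have b: "norm (U h (e k) - e k) \<le> c * h" if "k \<in> I" for k
        using h0(2)[OF h that] h unfolding norm_scaleR by (simp add: field_simps)
      have "norm (U h x - x) \<le> (\<Sum>k\<in>I. norm x * (c * h))"
        unfolding eq
      proof (rule order_trans[OF norm_sum sum_mono])
        fix k assume k: "k \<in> I"
        have "\<bar>x \<bullet> e k\<bar> \<le> norm x * norm (e k)" by (rule Cauchy_Schwarz_ineq2)
        then have "\<bar>x \<bullet> e k\<bar> \<le> norm x" by (simp add: norm_eq_sqrt_inner[of "e k"] inner_basis)
        then show "norm ((x \<bullet> e k) *\<^sub>R (U h (e k) - e k)) \<le> norm x * (c * h)"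
          using b[OF k] by (auto intro!: mult_mono)
      qed
      also have "\<dots> = (real (card I) * c) * (h * norm x)" by simp
      also have "\<dots> \<le> \<epsilon> * (h * norm x)"
        using h \<epsilon> by (intro mult_right_mono) (auto simp: c_def field_simps)
      finally show ?thesis by (simp add: mult.assoc)
    qed
    then show ?thesis using h0(1) by (intro exI[of _ h0]) auto
  qed
  \<comment> \<open>A deviation of \<open>\<epsilon> * h\<close> per step compounds to
    \<open>(1 + \<epsilon> * h) ^ k - 1\<close>, which for \<open>real k * h = t\<close> is at most
    \<open>exp (\<epsilon> * t) - 1\<close>; then \<open>\<epsilon>\<close> tends to 0 at fixed
    \<open>t\<close>.\<close>
  have pow: "U (real k * h) x \<in> E \<and> norm (U (real k * h) x - x) \<le> ((1 + \<epsilon> * h) ^ k - 1) * norm x"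
    if \<epsilon>: "0 < \<epsilon>" and h: "0 < h" and N: "\<And>x. x \<in> E \<Longrightarrow> norm (U h x - x) \<le> \<epsilon> * h * norm x" and x: "x \<in> E" for \<epsilon> h k x
  proof (induction k)
    case 0
    then show ?case using x by (simp add: U_def semigroup_zero)
  next
    case (Suc k)
    let ?y = "U (real k * h) x"
    have y: "?y \<in> E" "norm (?y - x) \<le> ((1 + \<epsilon> * h) ^ k - 1) * norm x" using Suc by auto
    have eq: "U (real (Suc k) * h) x = U h ?y"
    proof -
      have "real (Suc k) * h = h + real k * h" by (simp add: algebra_simps)
      then show ?thesis using h unfolding U_def
        by (simp add: semigroup_add linear_simps[OF semigroup_bounded_linear] exp_add algebra_simps)
    qed
    have ny: "norm ?y \<le> (1 + \<epsilon> * h) ^ k * norm x"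
      using y(2) norm_triangle_ineq2[of ?y x] by (simp add: algebra_simps)
    have "norm (U h ?y - x) \<le> norm (U h ?y - ?y) + norm (?y - x)"
      using norm_triangle_ineq[of "U h ?y - ?y" "?y - x"] by simp
    moreover have "norm (U h ?y - ?y) \<le> \<epsilon> * h * ((1 + \<epsilon> * h) ^ k * norm x)"
    proof -
      have "\<epsilon> * h * norm ?y \<le> \<epsilon> * h * ((1 + \<epsilon> * h) ^ k * norm x)"
        using \<epsilon> h by (intro mult_left_mono ny) auto
      then show ?thesis using N[OF y(1)] by linarith
    qed
    ultimately have "norm (U h ?y - x) \<le>
        \<epsilon> * h * ((1 + \<epsilon> * h) ^ k * norm x) + ((1 + \<epsilon> * h) ^ k - 1) * norm x"
      using y(2) by linarith
    also have "\<dots> = ((1 + \<epsilon> * h) ^ Suc k - 1) * norm x" by (simp add: algebra_simps)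
    finally show ?case using UE[OF less_imp_le[OF h] y(1)] unfolding eq by blast
  qed
  have en: "e n \<in> E" by (auto simp: E_def I_def inner_basis)
  have ne: "norm (e n) = 1" by (simp add: norm_eq_sqrt_inner inner_basis)
  have bd: "norm (U t (e n) - e n) \<le> exp (\<epsilon> * t) - 1" if \<epsilon>: "0 < \<epsilon>" for \<epsilon>
  proof (cases "t = 0")
    case True
    then show ?thesis by (simp add: U_def semigroup_zero)
  next
    case False
    obtain h0 where h0: "0 < h0" "\<And>h x. 0 < h \<Longrightarrow> h < h0 \<Longrightarrow> x \<in> E \<Longrightarrow> norm (U h x - x) \<le> \<epsilon> * h * norm x"
      using near[OF \<epsilon>] by blast
    obtain k :: nat where k: "t / h0 < real k" using reals_Archimedean2 by blast
    have k0: "0 < real k" using k t h0(1) by (meson divide_nonneg_pos le_less_trans)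
    define h where "h = t / real k"
    have h: "0 < h" "h < h0" "real k * h = t" using k k0 t False h0(1) by (auto simp: h_def field_simps)
    have "norm (U t (e n) - e n) \<le> (1 + \<epsilon> * h) ^ k - 1"
      using pow[OF \<epsilon> h(1) h0(2)[OF h(1,2)] en, of k] h(3) ne by simp
    also have "(1 + \<epsilon> * h) ^ k \<le> exp (\<epsilon> * h) ^ k"
      using \<epsilon> h by (intro power_mono exp_ge_add_one_self) auto
    also have "exp (\<epsilon> * h) ^ k = exp (\<epsilon> * t)" by (simp add: exp_of_nat_mult[symmetric] h(3)[symmetric])
    finally show ?thesis by simp
  qed
  have "((\<lambda>\<epsilon>. exp (\<epsilon> * t) - 1) \<longlongrightarrow> exp (0 * t) - 1) (at_right 0)" by (intro tendsto_intros)
  then have "norm (U t (e n) - e n) \<le> exp (0 * t) - 1"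
    by (rule tendsto_lowerbound) (use bd in \<open>auto simp: eventually_at_right_field intro!: exI[of _ 1]\<close>)
  then have "U t (e n) = e n" by simp
  then have "exp (- \<gamma> n * t) *\<^sub>R U t (e n) = exp (- \<gamma> n * t) *\<^sub>R e n" by simp
  then show ?thesis by (simp add: U_def mult_exp_exp)
qed

lemma semigroup_proj:
  assumes t: "0 \<le> t"
  shows "S t (proj e N x) = (\<Sum>n<N. (exp (- \<gamma> n * t) * (x \<bullet> e n)) *\<^sub>R e n)"
proof -
  interpret L: bounded_linear "S t" by (rule semigroup_bounded_linear[OF t])
  have "S t (proj e N x) = (\<Sum>n<N. (x \<bullet> e n) *\<^sub>R S t (e n))"
    by (simp only: proj_def L.sum L.scaleR)
  then show ?thesis by (simp add: semigroup_basis[OF t] mult.commute)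
qed

lemma norm_semigroup_le:
  assumes t: "0 \<le> t"
  shows "norm (S t x) \<le> norm x"
proof (rule LIMSEQ_le_const2)
  show "(\<lambda>N. norm (S t (proj e N x))) \<longlonglongrightarrow> norm (S t x)"
    by (rule tendsto_norm[OF bounded_linear.tendsto[OF semigroup_bounded_linear[OF t] proj_tendsto]])
  have "norm (S t (proj e N x)) \<le> norm x" for N
  proof -
    have "(norm (S t (proj e N x)))\<^sup>2 = (\<Sum>n<N. (exp (- \<gamma> n * t) * (x \<bullet> e n))\<^sup>2)"
      unfolding semigroup_proj[OF t] by (rule norm_sum_basis) simp
    also have "\<dots> \<le> (\<Sum>n<N. (x \<bullet> e n)\<^sup>2)"
      using t \<gamma>0 by (intro sum_mono) (simp add: power_mult_distrib mult_left_le_one_le power_le_one less_imp_le)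
    also have "\<dots> = (norm (proj e N x))\<^sup>2" unfolding proj_def by (simp add: norm_sum_basis)
    finally have "norm (S t (proj e N x)) \<le> norm (proj e N x)" by (rule power2_le_imp_le) simp
    then show ?thesis using norm_proj_le[of N x] by linarith
  qed
  then show "\<exists>M. \<forall>N\<ge>M. norm (S t (proj e N x)) \<le> norm x" by blast
qed

text \<open>On the range of \<open>proj e N\<close> the generator is bounded by
  \<open>\<Gamma>\<close>, so the semigroup is Lipschitz in time there, whereas on the whole space
  it is only strongly continuous. This is why the scheme is truncated before the step tends to
  0.\<close>

lemma semigroup_proj_lipschitz:
  assumes u: "0 \<le> u" "0 \<le> u'" and \<Gamma>: "\<And>n. n < N \<Longrightarrow> \<gamma> n \<le> \<Gamma>" "0 \<le> \<Gamma>"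
  shows "norm (S u (proj e N x) - S u' (proj e N x)) \<le> \<Gamma> * \<bar>u - u'\<bar> * norm x"
proof -
  have exp_lip: "\<bar>exp (- a) - exp (- b)\<bar> \<le> \<bar>a - b\<bar>" if "0 \<le> a" "0 \<le> b" for a b :: real
  proof -
    have *: "\<bar>exp (- a) - exp (- b)\<bar> \<le> \<bar>a - b\<bar>" if "0 \<le> a" "a \<le> b" for a b :: real
    proof -
      have "exp (- a) - exp (- b) = exp (- a) * (1 - exp (- (b - a)))" by (simp add: algebra_simps exp_add[symmetric])
      also have "\<dots> \<le> 1 * (b - a)"
      proof (rule mult_mono)
        show "1 - exp (- (b - a)) \<le> b - a" using exp_ge_add_one_self[of "- (b - a)"] by linarith
      qed (use that in auto)
      finally show ?thesis using that by simp
    qed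
    show ?thesis using *[of a b] *[of b a] that by (cases "a \<le> b") (auto simp: abs_minus_commute)
  qed
  have "(norm (S u (proj e N x) - S u' (proj e N x)))\<^sup>2 =
     (norm (\<Sum>n<N. ((exp (- \<gamma> n * u) - exp (- \<gamma> n * u')) * (x \<bullet> e n)) *\<^sub>R e n))\<^sup>2"
    unfolding semigroup_proj[OF u(1)] semigroup_proj[OF u(2)]
    by (simp add: sum_subtractf left_diff_distrib scaleR_diff_left)
  also have "\<dots> = (\<Sum>n<N. ((exp (- \<gamma> n * u) - exp (- \<gamma> n * u')) * (x \<bullet> e n))\<^sup>2)" by (rule norm_sum_basis) simp
  also have "\<dots> \<le> (\<Sum>n<N. (\<Gamma> * \<bar>u - u'\<bar>)\<^sup>2 * (x \<bullet> e n)\<^sup>2)"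
  proof (rule sum_mono)
    fix n assume n: "n \<in> {..<N}"
    have "\<bar>exp (- \<gamma> n * u) - exp (- \<gamma> n * u')\<bar> \<le> \<bar>\<gamma> n * u - \<gamma> n * u'\<bar>"
      using exp_lip[of "\<gamma> n * u" "\<gamma> n * u'"] u \<gamma>0[of n] by simp
    also have "\<dots> = \<gamma> n * \<bar>u - u'\<bar>" using \<gamma>0[of n] by (simp add: right_diff_distrib[symmetric] abs_mult)
    also have "\<dots> \<le> \<Gamma> * \<bar>u - u'\<bar>" using \<Gamma>(1)[of n] n by (intro mult_right_mono) auto
    finally have "\<bar>exp (- \<gamma> n * u) - exp (- \<gamma> n * u')\<bar>\<^sup>2 \<le> (\<Gamma> * \<bar>u - u'\<bar>)\<^sup>2" by (rule power_mono) simp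
    then show "((exp (- \<gamma> n * u) - exp (- \<gamma> n * u')) * (x \<bullet> e n))\<^sup>2 \<le> (\<Gamma> * \<bar>u - u'\<bar>)\<^sup>2 * (x \<bullet> e n)\<^sup>2"
      unfolding power_mult_distrib[of "exp (- \<gamma> n * u) - exp (- \<gamma> n * u')"] by (intro mult_right_mono) auto
  qed
  also have "\<dots> = (\<Gamma> * \<bar>u - u'\<bar>)\<^sup>2 * (norm (proj e N x))\<^sup>2"
    unfolding proj_def by (simp add: norm_sum_basis sum_distrib_left)
  also have "\<dots> \<le> (\<Gamma> * \<bar>u - u'\<bar>)\<^sup>2 * (norm x)\<^sup>2"
    by (intro mult_left_mono power_mono norm_proj_le) auto
  also have "\<dots> = (\<Gamma> * \<bar>u - u'\<bar> * norm x)\<^sup>2" by (simp add: power_mult_distrib)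
  finally show ?thesis by (rule power2_le_imp_le) (use \<Gamma> in simp)
qed

end

end

section \<open>The exponential Euler scheme\<close>

text \<open>Drift and noise are added before \<open>T\<close> acts, so that the expectation of one
  step is \<open>smoothing \<kappa> e N (f \<circ> T)\<close> evaluated at the drifted
  point.\<close>

primrec euler :: "('h \<Rightarrow> 'h) \<Rightarrow> ('h \<Rightarrow> 'h) \<Rightarrow> real \<Rightarrow> (nat \<Rightarrow> 'h::real_normed_vector) \<Rightarrow> nat \<Rightarrow> 'h \<Rightarrow>
    (nat \<times> nat \<Rightarrow> real) \<Rightarrow> nat \<Rightarrow> 'h" where
  "euler T G \<delta> e N x w 0 = x"
| "euler T G \<delta> e N x w (Suc k) =
    T (euler T G \<delta> e N x w k + \<delta> *\<^sub>R G (euler T G \<delta> e N x w k) + (\<Sum>n<N. w (n, k) *\<^sub>R e n))"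

lemma euler_cong:
  "(\<And>n j. n < N \<Longrightarrow> j < k \<Longrightarrow> w (n, j) = w' (n, j)) \<Longrightarrow> euler T G \<delta> e N x w k = euler T G \<delta> e N x w' k"
proof (induction k)
  case (Suc k)
  have "euler T G \<delta> e N x w k = euler T G \<delta> e N x w' k" using Suc by auto
  moreover have "(\<Sum>n<N. w (n, k) *\<^sub>R e n) = (\<Sum>n<N. w' (n, k) *\<^sub>R e n)" using Suc.prems by simp
  ultimately show ?case by simp
qed simp

lemma euler_measurable:
  fixes e :: "nat \<Rightarrow> 'h::{real_normed_vector, second_countable_topology}"
  assumes T: "continuous_on UNIV T" and G: "continuous_on UNIV G"
  shows "k \<le> m \<Longrightarrow> (\<lambda>w. euler T G \<delta> e N x w k) \<in> borel_measurable (PiM ({..<N} \<times> {..<m}) (\<lambda>_. borel))"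
proof (induction k)
  case (Suc k)
  have [measurable]: "T \<in> borel_measurable borel" "G \<in> borel_measurable borel"
    using T G by (auto intro: borel_measurable_continuous_onI)
  have [measurable]: "(\<lambda>w. euler T G \<delta> e N x w k) \<in> borel_measurable (PiM ({..<N} \<times> {..<m}) (\<lambda>_. borel))"
    using Suc by simp
  have [measurable]: "(\<lambda>w. \<Sum>n<N. w (n, k) *\<^sub>R e n) \<in> borel_measurable (PiM ({..<N} \<times> {..<m}) (\<lambda>_. borel))"
    using Suc.prems by (intro borel_measurable_sum borel_measurable_scaleR measurable_component_singleton) auto
  show ?case by simp
qed simp

text \<open>The noise of the last step is independent of the state before it; integrating it out
  first replaces \<open>f\<close> by \<open>Q f\<close>, so \<open>f\<close> varies in the
  induction.\<close>

lemma euler_expectation: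
  fixes e :: "nat \<Rightarrow> 'h::{real_normed_vector, second_countable_topology}" and \<xi> :: "nat \<times> nat \<Rightarrow> 'w \<Rightarrow> real"
  assumes M: "prob_space M" and N: "0 < N"
    and ind: "prob_space.indep_vars M (\<lambda>_. borel) \<xi> ({..<N} \<times> {..<m})"
    and law: "\<And>n k. n < N \<Longrightarrow> k < m \<Longrightarrow> distr M borel (\<xi> (n, k)) = \<kappa> n"
    and T: "continuous_on UNIV T" and G: "continuous_on UNIV G"
    and Q: "\<And>f B. bcont B f \<Longrightarrow> bcont B (Q f)"
    and Q_eq: "\<And>f z. Q f z = smoothing \<kappa> e N (f \<circ> T) (z + \<delta> *\<^sub>R G z)"
  shows "k \<le> m \<Longrightarrow> bcont B f \<Longrightarrow> (\<integral>\<omega>. f (euler T G \<delta> e N x (\<lambda>i. \<xi> i \<omega>) k) \<partial>M) = (Q ^^ k) f x"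
proof (induction k arbitrary: f)
  case 0
  interpret prob_space M by (rule M)
  show ?case using prob_space by simp
next
  case (Suc k)
  interpret prob_space M by (rule M)
  have k: "k < m" using Suc.prems by simp
  have fc: "continuous_on UNIV f" and fB: "\<And>z. \<bar>f z\<bar> \<le> B" using Suc.prems by (auto simp: bcont_def)
  have [measurable]: "T \<in> borel_measurable borel" "G \<in> borel_measurable borel" "f \<in> borel_measurable borel"
    using T G fc by (auto intro: borel_measurable_continuous_onI)
  \<comment> \<open>The columns before \<open>k\<close> are the past and column \<open>k\<close> is
    the fresh noise; grouping the indices into these disjoint blocks gives a product law for
    \<open>(U, V)\<close>.\<close>
  let ?A = "{..<N} \<times> {..<k}" and ?B = "{..<N} \<times> {k}"
  let ?PA = "PiM ?A (\<lambda>_. borel :: real measure)" and ?PB = "PiM ?B (\<lambda>_. borel :: real measure)"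
  let ?E = "\<lambda>w. euler T G \<delta> e N x w k"
  define U where "U \<omega> = (\<lambda>i\<in>?A. \<xi> i \<omega>)" for \<omega>
  define V where "V \<omega> = (\<lambda>i\<in>?B. \<xi> i \<omega>)" for \<omega>
  \<comment> \<open>The fresh column indexed by the mode alone, to match the product measure in
    \<open>smoothing\<close>.\<close>
  define Y where "Y \<omega> = (\<lambda>n\<in>{..<N}. \<xi> (n, k) \<omega>)" for \<omega>
  have rv: "random_variable borel (\<xi> i)" if "i \<in> {..<N} \<times> {..<m}" for i
    using ind that by (auto simp: indep_vars_def)
  have "indep_var ?PA U ?PB V"
    using k unfolding U_def[abs_def] V_def[abs_def] by (intro indep_var_restrict[OF ind]) auto
  then have U[measurable]: "U \<in> measurable M ?PA" and V[measurable]: "V \<in> measurable M ?PB"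
    and joint: "distr M ?PA U \<Otimes>\<^sub>M distr M ?PB V = distr M (?PA \<Otimes>\<^sub>M ?PB) (\<lambda>\<omega>. (U \<omega>, V \<omega>))"
    unfolding indep_var_distribution_eq by auto
  have indY: "indep_vars (\<lambda>_. borel) (\<lambda>n. \<xi> (n, k)) {..<N}"
  proof -
    have "indep_vars (\<lambda>j. PiM {(j, k)} (\<lambda>_. borel)) (\<lambda>j \<omega>. \<lambda>i\<in>{(j, k)}. \<xi> i \<omega>) {..<N}"
      using k by (intro indep_vars_restrict[OF ind]) (auto simp: disjoint_family_on_def)
    then have "indep_vars (\<lambda>_. borel) (\<lambda>j \<omega>. (\<lambda>i\<in>{(j, k)}. \<xi> i \<omega>) (j, k)) {..<N}"
      by (rule indep_vars_compose2[where Y="\<lambda>j y. y (j, k)"]) simp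
    then show ?thesis by simp
  qed
  have Ym[measurable]: "Y \<in> measurable M (PiM {..<N} (\<lambda>_. borel))"
    unfolding Y_def[abs_def] using rv k by (intro measurable_restrict) auto
  have lawY: "distr M (PiM {..<N} (\<lambda>_. borel)) Y = PiM {..<N} \<kappa>"
  proof -
    have "distr M (PiM {..<N} (\<lambda>_. borel)) Y = PiM {..<N} (\<lambda>n. distr M borel (\<xi> (n, k)))"
      using indY N k rv unfolding Y_def by (subst (asm) indep_vars_iff_distr_eq_PiM') auto
    also have "\<dots> = PiM {..<N} \<kappa>" using law k by (intro PiM_cong) auto
    finally show ?thesis .
  qed
  define \<Phi> where "\<Phi> z w = f (T (z + \<delta> *\<^sub>R G z + (\<Sum>n<N. w n *\<^sub>R e n)))" for z and w :: "nat \<Rightarrow> real"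
  have Em[measurable]: "?E \<in> borel_measurable ?PA" by (rule euler_measurable[OF T G]) simp
  have [measurable]: "(\<lambda>b. \<Sum>n<N. b (n, k) *\<^sub>R e n) \<in> borel_measurable ?PB"
    by (intro borel_measurable_sum borel_measurable_scaleR measurable_component_singleton) auto
  have \<Phi>m[measurable]: "(\<lambda>(a, b). \<Phi> (?E a) (\<lambda>n. b (n, k))) \<in> borel_measurable (?PA \<Otimes>\<^sub>M ?PB)"
    unfolding \<Phi>_def by measurable
  interpret DU: prob_space "distr M ?PA U" by (rule prob_space_distr) simp
  interpret DV: prob_space "distr M ?PB V" by (rule prob_space_distr) simp
  interpret P: pair_prob_space "distr M ?PA U" "distr M ?PB V" ..
  have int: "integrable (distr M ?PA U \<Otimes>\<^sub>M distr M ?PB V) (\<lambda>(a, b). \<Phi> (?E a) (\<lambda>n. b (n, k)))"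
    by (rule P.integrable_const_bound[where B=B])
      (use fB \<Phi>m in \<open>auto simp: \<Phi>_def cong: measurable_cong_sets\<close>)
  have "(\<integral>\<omega>. f (euler T G \<delta> e N x (\<lambda>i. \<xi> i \<omega>) (Suc k)) \<partial>M) =
    (\<integral>\<omega>. (case (U \<omega>, V \<omega>) of (a, b) \<Rightarrow> \<Phi> (?E a) (\<lambda>n. b (n, k))) \<partial>M)"
  proof (intro Bochner_Integration.integral_cong refl)
    fix \<omega>
    have "?E (\<lambda>i. \<xi> i \<omega>) = ?E (U \<omega>)" unfolding U_def by (intro euler_cong) auto
    then show "f (euler T G \<delta> e N x (\<lambda>i. \<xi> i \<omega>) (Suc k)) = (case (U \<omega>, V \<omega>) of (a, b) \<Rightarrow> \<Phi> (?E a) (\<lambda>n. b (n, k)))"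
      by (simp add: \<Phi>_def V_def)
  qed
  also have "\<dots> = (\<integral>p. (case p of (a, b) \<Rightarrow> \<Phi> (?E a) (\<lambda>n. b (n, k))) \<partial>distr M (?PA \<Otimes>\<^sub>M ?PB) (\<lambda>\<omega>. (U \<omega>, V \<omega>)))"
    by (rule integral_distr[OF _ \<Phi>m, symmetric]) measurable
  also have "\<dots> = (\<integral>a. (\<integral>b. \<Phi> (?E a) (\<lambda>n. b (n, k)) \<partial>distr M ?PB V) \<partial>distr M ?PA U)"
    unfolding joint[symmetric] using P.integral_fst'[OF int] by simp
  also have "\<dots> = (\<integral>a. Q f (?E a) \<partial>distr M ?PA U)"
  proof (intro Bochner_Integration.integral_cong refl)
    fix a
    have "(\<integral>b. \<Phi> (?E a) (\<lambda>n. b (n, k)) \<partial>distr M ?PB V) = (\<integral>\<omega>. \<Phi> (?E a) (\<lambda>n. V \<omega> (n, k)) \<partial>M)"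
      by (rule integral_distr[OF V]) (unfold \<Phi>_def, measurable)
    also have "\<dots> = (\<integral>\<omega>. \<Phi> (?E a) (Y \<omega>) \<partial>M)" by (simp add: \<Phi>_def V_def Y_def)
    also have "\<dots> = (\<integral>w. \<Phi> (?E a) w \<partial>distr M (PiM {..<N} (\<lambda>_. borel)) Y)"
      by (rule integral_distr[OF Ym, symmetric]) (unfold \<Phi>_def, measurable)
    also have "\<dots> = Q f (?E a)" unfolding lawY by (simp add: Q_eq smoothing_def \<Phi>_def)
    finally show "(\<integral>b. \<Phi> (?E a) (\<lambda>n. b (n, k)) \<partial>distr M ?PB V) = Q f (?E a)" .
  qed
  also have "\<dots> = (\<integral>\<omega>. Q f (?E (U \<omega>)) \<partial>M)"
    using Q[OF Suc.prems(2)]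
    by (intro integral_distr U measurable_compose[OF Em]) (auto simp: bcont_def intro: borel_measurable_continuous_onI)
  also have "\<dots> = (\<integral>\<omega>. Q f (?E (\<lambda>i. \<xi> i \<omega>)) \<partial>M)"
    unfolding U_def by (intro Bochner_Integration.integral_cong refl arg_cong[where f="Q f"] euler_cong) auto
  also have "\<dots> = (Q ^^ k) (Q f) x"
    using Suc.IH[OF _ Q[OF Suc.prems(2)]] Suc.prems(1) by simp
  also have "\<dots> = (Q ^^ Suc k) f x" by (simp add: funpow_swap1)
  finally show ?case .
qed

text \<open>The first \<open>m\<close> increments are measurable at time
  \<open>real m * \<delta>\<close>, and the next one is independent of that sigma-algebra, so the
  last factor splits off.\<close>

lemma increments_prob:
  assumes sb: "stochastic_basis M Fil" and levy: "levy_process M Fil Z" and \<delta>: "0 \<le> \<delta>"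
    and A: "\<And>k. A k \<in> sets borel"
  shows "{\<omega>\<in>space M. \<forall>k<m. Z (real (Suc k) * \<delta>) \<omega> - Z (real k * \<delta>) \<omega> \<in> A k} \<in> sets (Fil (real m * \<delta>))"
    and "measure M {\<omega>\<in>space M. \<forall>k<m. Z (real (Suc k) * \<delta>) \<omega> - Z (real k * \<delta>) \<omega> \<in> A k} =
      (\<Prod>k<m. measure M {\<omega>\<in>space M. Z (real (Suc k) * \<delta>) \<omega> - Z (real k * \<delta>) \<omega> \<in> A k})"
proof -
  interpret prob_space M using sb by (simp add: stochastic_basis_def)
  have Zm: "Z t \<in> borel_measurable (Fil t)" if "0 \<le> t" for t using levy that by (simp add: levy_process_def)
  have sp: "space (Fil t) = space M" and sub: "sets (Fil t) \<subseteq> sets M" if "0 \<le> t" for t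
    using sb that by (auto simp: stochastic_basis_def subalgebra_def)
  have mono: "sets (Fil s) \<subseteq> sets (Fil t)" if "0 \<le> s" "s \<le> t" for s t using sb that by (simp add: stochastic_basis_def)
  have Zm': "Z s \<in> borel_measurable (Fil t)" if "0 \<le> s" "s \<le> t" for s t
  proof (rule measurable_from_subalg[OF _ Zm[OF that(1)]])
    show "subalgebra (Fil t) (Fil s)" unfolding subalgebra_def using mono[OF that] sp that by auto
  qed
  let ?E = "\<lambda>m. {\<omega>\<in>space M. \<forall>k<m. Z (real (Suc k) * \<delta>) \<omega> - Z (real k * \<delta>) \<omega> \<in> A k}"
  let ?D = "\<lambda>k. {\<omega>\<in>space M. Z (real (Suc k) * \<delta>) \<omega> - Z (real k * \<delta>) \<omega> \<in> A k}"
  show E: "?E m \<in> sets (Fil (real m * \<delta>))" for m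
  proof -
    have t: "0 \<le> real m * \<delta>" using \<delta> by simp
    have "?E m = {\<omega>\<in>space (Fil (real m * \<delta>)). \<forall>k\<in>{..<m}. Z (real (Suc k) * \<delta>) \<omega> - Z (real k * \<delta>) \<omega> \<in> A k}"
      unfolding sp[OF t] by auto
    also have "\<dots> \<in> sets (Fil (real m * \<delta>))"
    proof (rule sets.sets_Collect_finite_All)
      fix k assume k: "k \<in> {..<m}"
      have "(\<lambda>\<omega>. Z (real (Suc k) * \<delta>) \<omega> - Z (real k * \<delta>) \<omega>) \<in> borel_measurable (Fil (real m * \<delta>))"
        using k \<delta> by (intro borel_measurable_diff Zm' mult_right_mono) auto
      from measurable_sets[OF this A[of k]]
      show "{\<omega>\<in>space (Fil (real m * \<delta>)). Z (real (Suc k) * \<delta>) \<omega> - Z (real k * \<delta>) \<omega> \<in> A k} \<in> sets (Fil (real m * \<delta>))"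
        by (simp add: vimage_def Int_def conj_commute)
    qed auto
    finally show ?thesis .
  qed
  show "measure M (?E m) = (\<Prod>k<m. measure M (?D k))"
  proof (induction m)
    case 0
    then show ?case using prob_space by simp
  next
    case (Suc m)
    have ind: "indep_set (sets (Fil (real m * \<delta>)))
        (sets (vimage_algebra (space M) (\<lambda>\<omega>. Z (real (Suc m) * \<delta>) \<omega> - Z (real m * \<delta>) \<omega>) borel))"
      using levy \<delta> by (simp add: levy_process_def mult_right_mono)
    have D: "?D m \<in> sets (vimage_algebra (space M) (\<lambda>\<omega>. Z (real (Suc m) * \<delta>) \<omega> - Z (real m * \<delta>) \<omega>) borel)"
      using in_vimage_algebra[OF A[of m], of "\<lambda>\<omega>. Z (real (Suc m) * \<delta>) \<omega> - Z (real m * \<delta>) \<omega>" "space M"]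
      by (simp add: vimage_def Int_def conj_commute)
    have "?E (Suc m) = ?E m \<inter> ?D m" by (auto simp: less_Suc_eq)
    then have "measure M (?E (Suc m)) = measure M (?E m) * measure M (?D m)"
      using indep_setD[OF ind E[of m] D] by simp
    then show ?case using Suc by simp
  qed
qed

text \<open>Independence across modes holds for whole paths, hence for vectors of increments; within
  one mode it comes from independence of the past. The probability of a rectangle is factored first
  over modes, then over time.\<close>

lemma increments_indep:
  assumes sb: "stochastic_basis M Fil" and levy: "\<And>n. levy_process M Fil (Z n)"
    and indZ: "independent_processes M Z" and \<delta>: "0 \<le> \<delta>" and Nm: "0 < N" "0 < m"
  shows "prob_space.indep_vars M (\<lambda>_. borel)
    (\<lambda>(n, k) \<omega>. Z n (real (Suc k) * \<delta>) \<omega> - Z n (real k * \<delta>) \<omega>) ({..<N} \<times> {..<m})"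
proof -
  interpret prob_space M using sb by (simp add: stochastic_basis_def)
  let ?d = "\<lambda>n k \<omega>. Z n (real (Suc k) * \<delta>) \<omega> - Z n (real k * \<delta>) \<omega>"
  have Zm: "Z n t \<in> borel_measurable M" if "0 \<le> t" for n t
    using levy[of n] sb that
    by (auto simp: levy_process_def stochastic_basis_def intro: measurable_from_subalg)
  have dm[measurable]: "?d n k \<in> borel_measurable M" for n k
    using \<delta> by (intro borel_measurable_diff Zm) auto
  have "indep_vars (\<lambda>_. PiM {0..} (\<lambda>_. borel)) (\<lambda>n \<omega>. \<lambda>t\<in>{0..}. Z n t \<omega>) UNIV"
    using indZ by (simp add: independent_processes_def)
  then have "indep_vars (\<lambda>_. PiM {..<m} (\<lambda>_. borel))
      (\<lambda>n \<omega>. (\<lambda>k\<in>{..<m}. (\<lambda>t\<in>{0..}. Z n t \<omega>) (real (Suc k) * \<delta>) - (\<lambda>t\<in>{0..}. Z n t \<omega>) (real k * \<delta>))) UNIV"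
    by (rule indep_vars_compose2)
      (use \<delta> in \<open>intro measurable_restrict borel_measurable_diff measurable_component_singleton; simp\<close>)
  then have "indep_vars (\<lambda>_. PiM {..<m} (\<lambda>_. borel)) (\<lambda>n \<omega>. \<lambda>k\<in>{..<m}. ?d n k \<omega>) UNIV"
    using \<delta> by simp
  then have indn: "indep_vars (\<lambda>_. PiM {..<m} (\<lambda>_. borel)) (\<lambda>n \<omega>. \<lambda>k\<in>{..<m}. ?d n k \<omega>) {..<N}"
    by (rule indep_vars_subset) simp
  show ?thesis
  proof (rule iffD2[OF indep_vars_finite[where E="\<lambda>_. sets borel"]])
    show "{..<N} \<times> {..<m} \<noteq> {}" using Nm by auto
    show "sets borel = sigma_sets (space borel) (sets borel)" for i :: "nat \<times> nat"
      by (rule sets.sigma_sets_eq[symmetric])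
    show "random_variable borel (case i of (n, k) \<Rightarrow> ?d n k)" for i by (cases i) (simp only: case_prod_conv dm)
    show "\<forall>A\<in>{..<N} \<times> {..<m} \<rightarrow> sets borel.
      prob (\<Inter>j\<in>{..<N} \<times> {..<m}. (case j of (n, k) \<Rightarrow> ?d n k) -` A j \<inter> space M) =
      (\<Prod>j\<in>{..<N} \<times> {..<m}. prob ((case j of (n, k) \<Rightarrow> ?d n k) -` A j \<inter> space M))"
    proof
      fix A :: "nat \<times> nat \<Rightarrow> real set" assume A: "A \<in> {..<N} \<times> {..<m} \<rightarrow> sets borel"
      \<comment> \<open>\<open>increments_prob\<close> asks for a Borel set at every index; outside
        the grid the empty set serves.\<close>
      define A' where "A' n k = (if n < N \<and> k < m then A (n, k) else {})" for n k
      have A': "A' n k \<in> sets borel" for n k using A by (auto simp: A'_def)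
      let ?C = "\<lambda>n. PiE {..<m} (A' n)"
      have C: "?C n \<in> sets (PiM {..<m} (\<lambda>_. borel))" for n using A' by (intro sets_PiM_I_finite) auto
      have vC: "(\<lambda>\<omega>. \<lambda>k\<in>{..<m}. ?d n k \<omega>) -` ?C n \<inter> space M = {\<omega>\<in>space M. \<forall>k<m. ?d n k \<omega> \<in> A' n k}" for n
        by (auto simp: PiE_def Pi_def)
      have "(\<Inter>j\<in>{..<N} \<times> {..<m}. (case j of (n, k) \<Rightarrow> ?d n k) -` A j \<inter> space M) =
        (\<Inter>n\<in>{..<N}. (\<lambda>\<omega>. \<lambda>k\<in>{..<m}. ?d n k \<omega>) -` ?C n \<inter> space M)"
        unfolding vC using Nm by (auto simp: A'_def)
      also have "prob \<dots> = (\<Prod>n<N. prob ((\<lambda>\<omega>. \<lambda>k\<in>{..<m}. ?d n k \<omega>) -` ?C n \<inter> space M))"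
        using Nm C by (intro indep_varsD[OF indn]) auto
      also have "\<dots> = (\<Prod>n<N. \<Prod>k<m. prob {\<omega>\<in>space M. ?d n k \<omega> \<in> A' n k})"
        unfolding vC by (intro prod.cong refl increments_prob(2)[OF sb levy \<delta> A'])
      also have "\<dots> = (\<Prod>j\<in>{..<N} \<times> {..<m}. prob ((case j of (n, k) \<Rightarrow> ?d n k) -` A j \<inter> space M))"
        unfolding prod.cartesian_product
        by (intro prod.cong refl) (auto simp: A'_def vimage_def Int_def conj_commute)
      finally show "prob (\<Inter>j\<in>{..<N} \<times> {..<m}. (case j of (n, k) \<Rightarrow> ?d n k) -` A j \<inter> space M) =
        (\<Prod>j\<in>{..<N} \<times> {..<m}. prob ((case j of (n, k) \<Rightarrow> ?d n k) -` A j \<inter> space M))" .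
    qed
  qed (auto simp: Int_stable_def sets.sets_into_space)
qed

section \<open>Convergence of the scheme\<close>

text \<open>Integrated against the weight \<open>exp (- (s * (2 * L)))\<close>, the memory term
  becomes at most half of the left side. The argument works for merely measurable \<open>d\<close>,
  which is all that is known of a distance between a predictable process and a step process.\<close>

lemma nn_integral_gronwall:
  fixes d a :: "real \<Rightarrow> ennreal" and L t :: real
  assumes d[measurable]: "d \<in> borel_measurable borel" and a[measurable]: "a \<in> borel_measurable borel"
    and L: "0 < L" and t: "0 \<le> t" and d1: "\<And>s. d s \<le> 1"
    and le: "\<And>r. 0 \<le> r \<Longrightarrow> r \<le> t \<Longrightarrow> d r \<le> a r + ennreal L * (\<integral>\<^sup>+s\<in>{0..r}. d s \<partial>lborel)"
  shows "(\<integral>\<^sup>+s\<in>{0..t}. d s \<partial>lborel) \<le> ennreal (2 * exp (2 * L * t)) * (\<integral>\<^sup>+s\<in>{0..t}. a s \<partial>lborel)"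
proof -
  define E where "E s = ennreal (exp (- (s * (2 * L))))" for s :: real
  have [measurable]: "E \<in> borel_measurable borel" unfolding E_def by measurable
  define I where "I = (\<integral>\<^sup>+s\<in>{0..t}. E s * d s \<partial>lborel)"
  define A where "A = (\<integral>\<^sup>+s\<in>{0..t}. a s \<partial>lborel)"
  have E1: "E s \<le> 1" if "0 \<le> s" for s using that L by (simp add: E_def)
  \<comment> \<open>After the integrals are exchanged, \<open>d u\<close> is weighted by the tail of
    \<open>E\<close> beyond \<open>u\<close>, at most \<open>E u / (2 * L)\<close>; multiplied by
    \<open>L\<close> this is the one half.\<close>
  have tail: "(\<integral>\<^sup>+s. E s * indicator {u..t} s \<partial>lborel) \<le> E u * ennreal (1 / (2 * L))" for u
  proof -
    have "(\<integral>\<^sup>+s. E s * indicator {u..t} s \<partial>lborel) \<le> (\<integral>\<^sup>+s. E s * indicator {u..} s \<partial>lborel)"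
      by (intro nn_integral_mono) (auto simp: indicator_def)
    also have "\<dots> = ennreal (0 - (- exp (- (u * (2 * L))) / (2 * L)))"
      unfolding E_def
    proof (rule nn_integral_FTC_atLeast)
      show "((\<lambda>x. - exp (- (x * (2 * L))) / (2 * L)) has_real_derivative exp (- (x * (2 * L)))) (at x)" for x
        using L by (auto intro!: derivative_eq_intros)
      show "((\<lambda>x. - exp (- (x * (2 * L))) / (2 * L)) \<longlongrightarrow> 0) at_top" using L by real_asymp
    qed auto
    also have "\<dots> = E u * ennreal (1 / (2 * L))" unfolding E_def by (subst ennreal_mult'[symmetric]) (auto simp: L less_imp_le)
    finally show ?thesis .
  qed
  have "(\<integral>\<^sup>+s\<in>{0..t}. E s * (\<integral>\<^sup>+u\<in>{0..s}. d u \<partial>lborel) \<partial>lborel) =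
    (\<integral>\<^sup>+s. (\<integral>\<^sup>+u. E s * d u * (indicator {0..s} u * indicator {0..t} s) \<partial>lborel) \<partial>lborel)"
    by (intro nn_integral_cong) (simp add: nn_integral_cmult[symmetric] nn_integral_multc[symmetric] mult_ac)
  also have "\<dots> = (\<integral>\<^sup>+s. (\<integral>\<^sup>+u. d u * indicator {0..t} u * (E s * indicator {u..t} s) \<partial>lborel) \<partial>lborel)"
    by (intro nn_integral_cong) (auto simp: indicator_def mult_ac)
  also have "\<dots> = (\<integral>\<^sup>+u. (\<integral>\<^sup>+s. d u * indicator {0..t} u * (E s * indicator {u..t} s) \<partial>lborel) \<partial>lborel)"
    by (rule lborel_pair.Fubini') (simp add: indicator_def[abs_def], measurable)
  also have "\<dots> = (\<integral>\<^sup>+u. d u * indicator {0..t} u * (\<integral>\<^sup>+s. E s * indicator {u..t} s \<partial>lborel) \<partial>lborel)"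
    by (intro nn_integral_cong nn_integral_cmult) measurable
  also have "\<dots> \<le> (\<integral>\<^sup>+u. d u * indicator {0..t} u * (E u * ennreal (1 / (2 * L))) \<partial>lborel)"
    by (intro nn_integral_mono mult_left_mono tail) auto
  also have "\<dots> = (\<integral>\<^sup>+u. (E u * d u * indicator {0..t} u) * ennreal (1 / (2 * L)) \<partial>lborel)"
    by (simp add: mult_ac)
  also have "\<dots> = I * ennreal (1 / (2 * L))" unfolding I_def by (rule nn_integral_multc) measurable
  finally have dbl: "(\<integral>\<^sup>+s\<in>{0..t}. E s * (\<integral>\<^sup>+u\<in>{0..s}. d u \<partial>lborel) \<partial>lborel) \<le> I * ennreal (1 / (2 * L))" .
  have [measurable]: "(\<lambda>s. \<integral>\<^sup>+u\<in>{0..s}. d u \<partial>lborel) \<in> borel_measurable borel"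
    by (rule lborel.borel_measurable_nn_integral) (simp add: indicator_def[abs_def], measurable)
  have "I \<le> (\<integral>\<^sup>+s. (a s * indicator {0..t} s + ennreal L * (E s * (\<integral>\<^sup>+u\<in>{0..s}. d u \<partial>lborel) * indicator {0..t} s)) \<partial>lborel)"
    unfolding I_def
  proof (rule nn_integral_mono)
    fix s :: real
    show "E s * d s * indicator {0..t} s \<le>
      a s * indicator {0..t} s + ennreal L * (E s * (\<integral>\<^sup>+u\<in>{0..s}. d u \<partial>lborel) * indicator {0..t} s)"
    proof (cases "s \<in> {0..t}")
      case True
      then have "E s * d s \<le> E s * (a s + ennreal L * (\<integral>\<^sup>+u\<in>{0..s}. d u \<partial>lborel))"
        using le[of s] by (intro mult_left_mono) auto
      also have "\<dots> \<le> a s + ennreal L * (E s * (\<integral>\<^sup>+u\<in>{0..s}. d u \<partial>lborel))"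
        using mult_right_mono[OF E1[of s], of "a s"] True by (simp add: distrib_left mult_ac)
      finally show ?thesis using True by simp
    qed simp
  qed
  also have "\<dots> = A + ennreal L * (\<integral>\<^sup>+s. E s * (\<integral>\<^sup>+u\<in>{0..s}. d u \<partial>lborel) * indicator {0..t} s \<partial>lborel)"
    unfolding A_def by (subst nn_integral_add, measurable, subst nn_integral_cmult, measurable)
  also have "\<dots> \<le> A + ennreal L * (I * ennreal (1 / (2 * L)))"
    by (intro add_left_mono mult_left_mono dbl) simp
  also have "ennreal L * (I * ennreal (1 / (2 * L))) = ennreal (1 / 2) * I"
  proof -
    have "ennreal L * (I * ennreal (1 / (2 * L))) = (ennreal L * ennreal (1 / (2 * L))) * I" by (simp add: mult_ac)
    also have "ennreal L * ennreal (1 / (2 * L)) = ennreal (1 / 2)"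
      using L by (subst ennreal_mult[symmetric]) auto
    finally show ?thesis .
  qed
  finally have half: "I \<le> A + ennreal (1 / 2) * I" .
  \<comment> \<open>Finiteness of \<open>I\<close>, from \<open>d s \<le> 1\<close>, permits half of
    \<open>I\<close> to be cancelled in the extended reals.\<close>
  have "I \<le> (\<integral>\<^sup>+s. indicator {0..t} s \<partial>lborel)"
    unfolding I_def using E1 d1 by (intro nn_integral_mono) (auto simp: indicator_def intro: mult_le_one)
  then have fin: "I < \<infinity>" using t by (simp add: le_less_trans)
  have IA: "I \<le> 2 * A"
  proof (cases "A = \<infinity>")
    case True
    then show ?thesis by (simp add: ennreal_mult_top)
  next
    case False
    then obtain a' i where ai: "A = ennreal a'" "0 \<le> a'" "I = ennreal i" "0 \<le> i"
      using fin by (cases A; cases I) auto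
    have "ennreal a' + ennreal (1 / 2) * ennreal i = ennreal (a' + 1 / 2 * i)"
      using ai by (subst ennreal_mult[symmetric], simp, simp, subst ennreal_plus[symmetric]) simp_all
    then have "ennreal i \<le> ennreal (a' + 1 / 2 * i)" using half ai by simp
    then have "i \<le> 2 * a'" using ai by (subst (asm) ennreal_le_iff) simp_all
    then have "ennreal i \<le> ennreal (2 * a')" by (rule ennreal_leI)
    then show ?thesis using ai by (simp add: ennreal_mult')
  qed
  have "(\<integral>\<^sup>+s\<in>{0..t}. d s \<partial>lborel) \<le> (\<integral>\<^sup>+s. ennreal (exp (2 * L * t)) * (E s * d s * indicator {0..t} s) \<partial>lborel)"
  proof (rule nn_integral_mono)
    fix s :: real
    show "d s * indicator {0..t} s \<le> ennreal (exp (2 * L * t)) * (E s * d s * indicator {0..t} s)"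
    proof (cases "s \<in> {0..t}")
      case True
      have "1 \<le> ennreal (exp (2 * L * t)) * E s"
      proof -
        have "0 \<le> 2 * L * t - s * (2 * L)" using True L by (simp add: field_simps)
        then have "1 \<le> exp (2 * L * t) * exp (- (s * (2 * L)))" by (simp add: exp_add[symmetric])
        then show ?thesis unfolding E_def by (subst ennreal_mult[symmetric]) (auto simp: ennreal_ge_1)
      qed
      then have "1 * d s \<le> ennreal (exp (2 * L * t)) * E s * d s" by (intro mult_right_mono) auto
      then show ?thesis using True by (simp add: mult.assoc)
    qed simp
  qed
  also have "\<dots> = ennreal (exp (2 * L * t)) * I" unfolding I_def by (rule nn_integral_cmult) measurable
  also have "\<dots> \<le> ennreal (exp (2 * L * t)) * (2 * A)" by (intro mult_left_mono IA) simp
  also have "\<dots> = ennreal (2 * exp (2 * L * t)) * A"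
    by (simp add: ennreal_mult' mult_ac)
  finally show ?thesis unfolding A_def .
qed

text \<open>Negative times are sent to 0, which gives a jointly measurable process on the whole line
  and lets Fubini be applied with \<open>lborel\<close>. Each generator of the predictable algebra
  pulls back to a measurable rectangle.\<close>

lemma predictable_measurable_pair:
  fixes X :: "real \<Rightarrow> 'w \<Rightarrow> 'h::topological_space"
  assumes sb: "stochastic_basis M Fil" and X: "predictable_process M Fil X"
  shows "(\<lambda>(s, \<omega>). X (max 0 s) \<omega>) \<in> borel_measurable (borel \<Otimes>\<^sub>M M)"
proof -
  have sub: "B \<in> sets M" if "B \<in> sets (Fil s)" "0 \<le> s" for B s
    using sb that by (auto simp: stochastic_basis_def subalgebra_def)
  have sp: "B \<subseteq> space M" if "B \<in> sets (Fil s)" "0 \<le> s" for B s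
    using sub[OF that] by (rule sets.sets_into_space)
  have "(\<lambda>p. (max 0 (fst p), snd p)) \<in> measurable (borel \<Otimes>\<^sub>M M) (predictable_algebra M Fil)"
    unfolding predictable_algebra_def
  proof (rule measurable_measure_of)
    show "{{0} \<times> B | B. B \<in> sets (Fil 0)} \<union> {{s<..t} \<times> B | s t B. 0 \<le> s \<and> s < t \<and> B \<in> sets (Fil s)}
      \<subseteq> Pow ({0::real..} \<times> space M)"
      using sp by fastforce
    show "(\<lambda>p. (max 0 (fst p), snd p)) \<in> space (borel \<Otimes>\<^sub>M M) \<rightarrow> {0::real..} \<times> space M"
      by (auto simp: space_pair_measure)
    fix C assume "C \<in> {{0} \<times> B | B. B \<in> sets (Fil 0)} \<union> {{s<..t} \<times> B | s t B. 0 \<le> s \<and> s < t \<and> B \<in> sets (Fil s)}"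
    then consider B where "C = {0} \<times> B" "B \<in> sets (Fil 0)"
      | s t B where "C = {s<..t} \<times> B" "0 \<le> s" "s < t" "B \<in> sets (Fil s)" by blast
    then show "(\<lambda>p. (max 0 (fst p), snd p)) -` C \<inter> space (borel \<Otimes>\<^sub>M M) \<in> sets (borel \<Otimes>\<^sub>M M)"
    proof cases
      case 1
      have "(\<lambda>p. (max 0 (fst p), snd p)) -` C \<inter> space (borel \<Otimes>\<^sub>M M) = {..0::real} \<times> B"
        using sp[OF 1(2)] by (auto simp: 1 space_pair_measure max_def split: if_splits)
      then show ?thesis using sub[OF 1(2)] by (simp add: pair_measureI)
    next
      case 2
      have "(\<lambda>p. (max 0 (fst p), snd p)) -` C \<inter> space (borel \<Otimes>\<^sub>M M) = {s<..t} \<times> B"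
        using sp[OF 2(4)] 2(2,3) by (auto simp: 2(1) space_pair_measure max_def split: if_splits)
      then show ?thesis using sub[OF 2(4)] 2(2) by (simp add: pair_measureI)
    qed
  qed
  then have "(\<lambda>p. case (max 0 (fst p), snd p) of (t, \<omega>) \<Rightarrow> X t \<omega>) \<in> borel_measurable (borel \<Otimes>\<^sub>M M)"
    using X unfolding predictable_process_def by (rule measurable_compose)
  then show ?thesis by (simp add: case_prod_beta')
qed

text \<open>The expectation of the truncated distance controls convergence in probability. This
  converts the estimate built into \<open>stochastic_integral\<close> into an additive quantity
  suited to Gronwall's inequality.\<close>

lemma nn_integral_min_prob_le:
  fixes D :: "'w \<Rightarrow> real"
  assumes M: "prob_space M" and D[measurable]: "D \<in> borel_measurable M" and C: "0 \<le> C" and \<epsilon>: "0 < \<epsilon>"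
    and P: "measure M {\<omega>\<in>space M. \<bar>D \<omega>\<bar> > \<epsilon>} \<le> \<epsilon>"
  shows "(\<integral>\<^sup>+\<omega>. ennreal (min 1 (C * \<bar>D \<omega>\<bar>)) \<partial>M) \<le> ennreal ((1 + C) * \<epsilon>)"
proof -
  interpret prob_space M by (rule M)
  let ?B = "{\<omega>\<in>space M. \<bar>D \<omega>\<bar> > \<epsilon>}"
  have "(\<integral>\<^sup>+\<omega>. ennreal (min 1 (C * \<bar>D \<omega>\<bar>)) \<partial>M) \<le> (\<integral>\<^sup>+\<omega>. indicator ?B \<omega> + ennreal (C * \<epsilon>) \<partial>M)"
  proof (rule nn_integral_mono)
    fix \<omega> assume "\<omega> \<in> space M"
    then show "ennreal (min 1 (C * \<bar>D \<omega>\<bar>)) \<le> indicator ?B \<omega> + ennreal (C * \<epsilon>)"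
    proof (cases "\<bar>D \<omega>\<bar> > \<epsilon>")
      case True
      then have "ennreal (min 1 (C * \<bar>D \<omega>\<bar>)) \<le> 1" by (simp add: ennreal_le_1)
      then show ?thesis using True \<open>\<omega> \<in> space M\<close> by (simp add: add_increasing2)
    next
      case False
      then have "C * \<bar>D \<omega>\<bar> \<le> C * \<epsilon>" using C by (intro mult_left_mono) auto
      then show ?thesis using False by (auto intro!: ennreal_leI)
    qed
  qed
  also have "\<dots> = emeasure M ?B + ennreal (C * \<epsilon>)"
    by (subst nn_integral_add) (auto simp: emeasure_space_1)
  also have "\<dots> \<le> ennreal \<epsilon> + ennreal (C * \<epsilon>)"
    using P by (intro add_right_mono) (simp add: emeasure_eq_measure ennreal_leI)
  also have "\<dots> = ennreal ((1 + C) * \<epsilon>)" using C \<epsilon> by (subst ennreal_plus[symmetric]) (auto simp: algebra_simps)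
  finally show ?thesis .
qed

lemma ennreal_min_add_le:
  "0 \<le> a \<Longrightarrow> 0 \<le> b \<Longrightarrow> ennreal (min 1 (a + b)) \<le> ennreal (min 1 a) + ennreal (min 1 b)"
  by (subst ennreal_plus[symmetric]) (auto intro!: ennreal_leI simp del: ennreal_plus)

lemma tendsto_0_if_eventually_le:
  fixes u :: "nat \<Rightarrow> ennreal"
  assumes "\<And>e. 0 < e \<Longrightarrow> \<forall>\<^sub>F m in sequentially. u m \<le> ennreal e"
  shows "u \<longlonglongrightarrow> 0"
proof (rule order_tendstoI)
  fix a :: ennreal assume "0 < a"
  then obtain b where b: "0 < b" "b < a" using dense by blast
  then obtain e where "b = ennreal e" "0 \<le> e" by (cases b) auto
  with b have e: "0 < e" "ennreal e < a" by (auto simp: ennreal_less_zero_iff)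
  show "\<forall>\<^sub>F m in sequentially. u m < a"
    using assms[OF e(1)] by eventually_elim (rule le_less_trans[OF _ e(2)])
qed simp

text \<open>These are the sums that the scheme produces: they stop at the last grid point before
  \<open>r\<close> and measure the exponent from there. Compared with Riemann sums up to
  \<open>r\<close>, this changes a factor tending to 1 and one incomplete cell.\<close>

lemma riemann_sums_converge:
  fixes Z :: "real \<Rightarrow> 'w \<Rightarrow> real"
  assumes sb: "stochastic_basis M Fil" and levy: "levy_process M Fil Z"
    and J: "stochastic_integral M (\<lambda>s. exp (- \<gamma> * (r - s)) * \<beta>) Z r J"
    and \<gamma>: "0 < \<gamma>" and \<beta>: "0 < \<beta>" and t: "0 < t" and r: "0 \<le> r"
  defines "\<delta> \<equiv> \<lambda>m. t / real (Suc m)"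
  defines "k \<equiv> \<lambda>m. nat \<lfloor>r / \<delta> m\<rfloor>"
  shows "(\<lambda>m. \<integral>\<^sup>+\<omega>. ennreal (min 1 \<bar>J \<omega> - (\<Sum>j<k m. exp (- \<gamma> * (real (k m - j) * \<delta> m)) *
      (\<beta> * (Z (real (Suc j) * \<delta> m) \<omega> - Z (real j * \<delta> m) \<omega>)))\<bar>) \<partial>M) \<longlonglongrightarrow> 0"
proof -
  interpret prob_space M using sb by (simp add: stochastic_basis_def)
  have Zm[measurable]: "0 \<le> s \<Longrightarrow> Z s \<in> borel_measurable M" for s
    using levy sb by (auto simp: levy_process_def stochastic_basis_def intro: measurable_from_subalg)
  have Jm[measurable]: "J \<in> borel_measurable M" using J by (simp add: stochastic_integral_def)
  have \<delta>: "0 < \<delta> m" "\<delta> m \<le> t" for m using t by (auto simp: \<delta>_def field_simps)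
  have \<delta>0: "\<delta> \<longlonglongrightarrow> 0" unfolding \<delta>_def by real_asymp
  define \<eta> where "\<eta> m = r - real (k m) * \<delta> m" for m
  have k: "0 \<le> \<eta> m" "\<eta> m \<le> \<delta> m" for m
  proof -
    have "0 \<le> r / \<delta> m" using r \<delta>[of m] by simp
    then have "real (k m) = of_int \<lfloor>r / \<delta> m\<rfloor>" by (simp add: k_def)
    then have "real (k m) \<le> r / \<delta> m" "r / \<delta> m \<le> real (k m) + 1" by linarith+
    then show "0 \<le> \<eta> m" "\<eta> m \<le> \<delta> m" using \<delta>(1)[of m] by (auto simp: \<eta>_def field_simps)
  qed
  have kr: "real (k m) * \<delta> m \<le> r" for m using k(1)[of m] by (simp add: \<eta>_def)
  have \<eta>0: "\<eta> \<longlonglongrightarrow> 0"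
    by (rule tendsto_sandwich[OF _ _ tendsto_const \<delta>0]) (auto simp: k)
  let ?g = "\<lambda>s. exp (- \<gamma> * (r - s)) * \<beta>"
  \<comment> \<open>The grid up to its last point not beyond \<open>r\<close>, followed by
    \<open>r\<close> itself: a partition into \<open>k m + 1\<close> cells of length at most
    \<open>\<delta> m\<close>, the last one possibly empty.\<close>
  define p where "p m i = (if i \<le> k m then real i * \<delta> m else r)" for m i
  define R where "R m \<omega> = (\<Sum>i<Suc (k m). ?g (p m i) * (Z (p m (Suc i)) \<omega> - Z (p m i) \<omega>))" for m \<omega>
  let ?Q = "\<lambda>m \<omega>. \<Sum>j<k m. exp (- \<gamma> * (real (k m - j) * \<delta> m)) * (\<beta> * (Z (real (Suc j) * \<delta> m) \<omega> - Z (real j * \<delta> m) \<omega>))"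
  define H where "H m \<omega> = Z r \<omega> - Z (real (k m) * \<delta> m) \<omega>" for m \<omega>
  have p0: "0 \<le> p m i" for m i using \<delta>(1)[of m] r by (auto simp: p_def less_imp_le)
  have Rm[measurable]: "R m \<in> borel_measurable M" for m
    unfolding R_def by (intro borel_measurable_sum borel_measurable_times borel_measurable_diff Zm p0) auto
  have Hm[measurable]: "H m \<in> borel_measurable M" for m
    unfolding H_def using \<delta>(1)[of m] r by (intro borel_measurable_diff Zm) auto
  \<comment> \<open>Multiplication by \<open>exp (\<gamma> * \<eta> m)\<close> moves the reference
    time of the exponent from \<open>r\<close> to the last grid point; the incomplete cell then has
    coefficient \<open>\<beta>\<close> and is subtracted.\<close>
  have RQ: "?Q m \<omega> = exp (\<gamma> * \<eta> m) * R m \<omega> - \<beta> * H m \<omega>" for m \<omega>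
  proof -
    have "R m \<omega> = (\<Sum>j<k m. ?g (real j * \<delta> m) * (Z (real (Suc j) * \<delta> m) \<omega> - Z (real j * \<delta> m) \<omega>))
       + ?g (real (k m) * \<delta> m) * H m \<omega>"
      unfolding R_def H_def by (simp add: p_def)
    then have "exp (\<gamma> * \<eta> m) * R m \<omega> =
      (\<Sum>j<k m. (exp (\<gamma> * \<eta> m) * exp (- \<gamma> * (r - real j * \<delta> m))) * (\<beta> * (Z (real (Suc j) * \<delta> m) \<omega> - Z (real j * \<delta> m) \<omega>)))
       + (exp (\<gamma> * \<eta> m) * exp (- \<gamma> * (r - real (k m) * \<delta> m))) * (\<beta> * H m \<omega>)"
      by (simp only: distrib_left sum_distrib_left mult.assoc)
    also have "exp (\<gamma> * \<eta> m) * exp (- \<gamma> * (r - real (k m) * \<delta> m)) = 1"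
      by (simp add: \<eta>_def mult_exp_exp)
    also have "(\<Sum>j<k m. (exp (\<gamma> * \<eta> m) * exp (- \<gamma> * (r - real j * \<delta> m))) * (\<beta> * (Z (real (Suc j) * \<delta> m) \<omega> - Z (real j * \<delta> m) \<omega>))) = ?Q m \<omega>"
    proof (rule sum.cong[OF refl])
      fix j assume j: "j \<in> {..<k m}"
      have "\<gamma> * \<eta> m + - \<gamma> * (r - real j * \<delta> m) = - \<gamma> * (real (k m - j) * \<delta> m)"
        using j by (simp add: \<eta>_def of_nat_diff algebra_simps)
      then show "(exp (\<gamma> * \<eta> m) * exp (- \<gamma> * (r - real j * \<delta> m))) * (\<beta> * (Z (real (Suc j) * \<delta> m) \<omega> - Z (real j * \<delta> m) \<omega>)) =
        exp (- \<gamma> * (real (k m - j) * \<delta> m)) * (\<beta> * (Z (real (Suc j) * \<delta> m) \<omega> - Z (real j * \<delta> m) \<omega>))"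
        by (simp only: mult_exp_exp)
    qed
    finally show ?thesis by simp
  qed
  define C where "C = exp (\<gamma> * t)"
  have C: "0 \<le> C" "1 \<le> C" using \<gamma> t by (auto simp: C_def)
  have bound: "ennreal (min 1 \<bar>J \<omega> - ?Q m \<omega>\<bar>) \<le> ennreal (min 1 (C * \<bar>R m \<omega> - J \<omega>\<bar>)) +
     (ennreal (min 1 ((exp (\<gamma> * \<delta> m) - 1) * \<bar>J \<omega>\<bar>)) + ennreal (min 1 (\<beta> * \<bar>H m \<omega>\<bar>)))" for m \<omega>
  proof -
    have e: "exp (\<gamma> * \<eta> m) \<le> C" "exp (\<gamma> * \<eta> m) \<le> exp (\<gamma> * \<delta> m)" "1 \<le> exp (\<gamma> * \<eta> m)" "1 \<le> exp (\<gamma> * \<delta> m)"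
      using k[of m] \<delta>[of m] \<gamma> by (auto simp: C_def intro!: mult_left_mono)
    have "J \<omega> - ?Q m \<omega> = - (exp (\<gamma> * \<eta> m) * (R m \<omega> - J \<omega>)) - (exp (\<gamma> * \<eta> m) - 1) * J \<omega> + \<beta> * H m \<omega>"
      unfolding RQ by (simp add: algebra_simps)
    then have "\<bar>J \<omega> - ?Q m \<omega>\<bar> \<le> \<bar>exp (\<gamma> * \<eta> m) * (R m \<omega> - J \<omega>)\<bar> + \<bar>(exp (\<gamma> * \<eta> m) - 1) * J \<omega>\<bar> + \<bar>\<beta> * H m \<omega>\<bar>"
      by linarith
    also have "\<dots> = exp (\<gamma> * \<eta> m) * \<bar>R m \<omega> - J \<omega>\<bar> + (exp (\<gamma> * \<eta> m) - 1) * \<bar>J \<omega>\<bar> + \<beta> * \<bar>H m \<omega>\<bar>"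
      using e \<beta> by (simp add: abs_mult)
    also have "\<dots> \<le> C * \<bar>R m \<omega> - J \<omega>\<bar> + (exp (\<gamma> * \<delta> m) - 1) * \<bar>J \<omega>\<bar> + \<beta> * \<bar>H m \<omega>\<bar>"
      using e by (intro add_mono mult_right_mono) auto
    finally have "ennreal (min 1 \<bar>J \<omega> - ?Q m \<omega>\<bar>) \<le>
      ennreal (min 1 (C * \<bar>R m \<omega> - J \<omega>\<bar> + ((exp (\<gamma> * \<delta> m) - 1) * \<bar>J \<omega>\<bar> + \<beta> * \<bar>H m \<omega>\<bar>)))"
      by (intro ennreal_leI) auto
    also have "\<dots> \<le> ennreal (min 1 (C * \<bar>R m \<omega> - J \<omega>\<bar>)) +
      ennreal (min 1 ((exp (\<gamma> * \<delta> m) - 1) * \<bar>J \<omega>\<bar> + \<beta> * \<bar>H m \<omega>\<bar>))"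
      using C(1) e(4) \<beta> by (intro ennreal_min_add_le add_nonneg_nonneg mult_nonneg_nonneg) auto
    also have "\<dots> \<le> ennreal (min 1 (C * \<bar>R m \<omega> - J \<omega>\<bar>)) +
     (ennreal (min 1 ((exp (\<gamma> * \<delta> m) - 1) * \<bar>J \<omega>\<bar>)) + ennreal (min 1 (\<beta> * \<bar>H m \<omega>\<bar>)))"
      using e(4) \<beta> by (intro add_left_mono ennreal_min_add_le mult_nonneg_nonneg) auto
    finally show ?thesis .
  qed
  have T1: "(\<lambda>m. \<integral>\<^sup>+\<omega>. ennreal (min 1 (C * \<bar>R m \<omega> - J \<omega>\<bar>)) \<partial>M) \<longlonglongrightarrow> 0"
  proof (rule tendsto_0_if_eventually_le)
    fix e :: real assume e: "0 < e"
    define \<epsilon> where "\<epsilon> = e / (1 + C)"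
    have \<epsilon>: "0 < \<epsilon>" "(1 + C) * \<epsilon> = e" using e C by (auto simp: \<epsilon>_def)
    obtain d where d: "0 < d" "\<And>N (q :: nat \<Rightarrow> real). q 0 = 0 \<Longrightarrow> q N = r \<Longrightarrow>
        (\<forall>i<N. q i \<le> q (Suc i) \<and> q (Suc i) - q i \<le> d) \<Longrightarrow>
        measure M {\<omega>\<in>space M. \<bar>(\<Sum>i<N. ?g (q i) * (Z (q (Suc i)) \<omega> - Z (q i) \<omega>)) - J \<omega>\<bar> > \<epsilon>} \<le> \<epsilon>"
      using J \<epsilon>(1) unfolding stochastic_integral_def by blast
    have "\<forall>\<^sub>F m in sequentially. \<delta> m < d" using order_tendstoD(2)[OF \<delta>0 d(1)] .
    then show "\<forall>\<^sub>F m in sequentially. (\<integral>\<^sup>+\<omega>. ennreal (min 1 (C * \<bar>R m \<omega> - J \<omega>\<bar>)) \<partial>M) \<le> ennreal e"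
    proof eventually_elim
      case (elim m)
      have "p m i \<le> p m (Suc i) \<and> p m (Suc i) - p m i \<le> d" if i: "i < Suc (k m)" for i
      proof (cases "i = k m")
        case True
        then show ?thesis using k[of m] elim by (simp add: p_def \<eta>_def)
      next
        case False
        then show ?thesis using i elim \<delta>(1)[of m] by (simp add: p_def algebra_simps)
      qed
      then have "measure M {\<omega>\<in>space M. \<bar>R m \<omega> - J \<omega>\<bar> > \<epsilon>} \<le> \<epsilon>"
        unfolding R_def by (intro d(2)) (auto simp: p_def)
      then show ?case
        using nn_integral_min_prob_le[OF prob_space_axioms, of "\<lambda>\<omega>. R m \<omega> - J \<omega>" C \<epsilon>] C \<epsilon> by simp
    qed
  qed
  have T2: "(\<lambda>m. \<integral>\<^sup>+\<omega>. ennreal (min 1 ((exp (\<gamma> * \<delta> m) - 1) * \<bar>J \<omega>\<bar>)) \<partial>M) \<longlonglongrightarrow> (\<integral>\<^sup>+\<omega>. 0 \<partial>M)"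
  proof (rule nn_integral_dominated_convergence[where w="\<lambda>_. 1"])
    show "AE \<omega> in M. (\<lambda>m. ennreal (min 1 ((exp (\<gamma> * \<delta> m) - 1) * \<bar>J \<omega>\<bar>))) \<longlonglongrightarrow> 0"
    proof (rule AE_I2)
      fix \<omega>
      have "(\<lambda>m. ennreal (min 1 ((exp (\<gamma> * \<delta> m) - 1) * \<bar>J \<omega>\<bar>))) \<longlonglongrightarrow> ennreal (min 1 ((exp (\<gamma> * 0) - 1) * \<bar>J \<omega>\<bar>))"
        by (intro tendsto_intros \<delta>0 tendsto_ennrealI)
      then show "(\<lambda>m. ennreal (min 1 ((exp (\<gamma> * \<delta> m) - 1) * \<bar>J \<omega>\<bar>))) \<longlonglongrightarrow> 0" by simp
    qed
  qed (auto simp: emeasure_space_1 ennreal_le_1)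
  \<comment> \<open>The grid points approach \<open>r\<close> from the left, where a cadlag path may
    jump. Stationarity replaces the increment by \<open>Z (\<eta> m)\<close> in law, and right
    continuity at 0 applies.\<close>
  have T3: "(\<lambda>m. \<integral>\<^sup>+\<omega>. ennreal (min 1 (\<beta> * \<bar>H m \<omega>\<bar>)) \<partial>M) \<longlonglongrightarrow> 0"
  proof -
    have eq: "(\<integral>\<^sup>+\<omega>. ennreal (min 1 (\<beta> * \<bar>H m \<omega>\<bar>)) \<partial>M) = (\<integral>\<^sup>+\<omega>. ennreal (min 1 (\<beta> * \<bar>Z (\<eta> m) \<omega>\<bar>)) \<partial>M)" for m
    proof -
      have "distr M borel (H m) = distr M borel (Z (\<eta> m))"
        using levy kr[of m] \<delta>(1)[of m] unfolding levy_process_def H_def[abs_def] \<eta>_def by (simp add: less_imp_le)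
      then have "(\<integral>\<^sup>+x. ennreal (min 1 (\<beta> * \<bar>x\<bar>)) \<partial>distr M borel (H m)) = (\<integral>\<^sup>+x. ennreal (min 1 (\<beta> * \<bar>x\<bar>)) \<partial>distr M borel (Z (\<eta> m)))"
        by simp
      then show ?thesis using k(1)[of m] by (simp add: nn_integral_distr)
    qed
    have "(\<lambda>m. \<integral>\<^sup>+\<omega>. ennreal (min 1 (\<beta> * \<bar>Z (\<eta> m) \<omega>\<bar>)) \<partial>M) \<longlonglongrightarrow> (\<integral>\<^sup>+\<omega>. 0 \<partial>M)"
    proof (rule nn_integral_dominated_convergence[where w="\<lambda>_. 1"])
      have "AE \<omega> in M. Z 0 \<omega> = 0" "AE \<omega> in M. cadlag (\<lambda>s. Z s \<omega>)" using levy by (auto simp: levy_process_def)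
      then show "AE \<omega> in M. (\<lambda>m. ennreal (min 1 (\<beta> * \<bar>Z (\<eta> m) \<omega>\<bar>))) \<longlonglongrightarrow> 0"
      proof eventually_elim
        case (elim \<omega>)
        have "continuous (at 0 within {0..}) (\<lambda>s. Z s \<omega>)"
          using elim(2) by (simp add: cadlag_def continuous_within at_within_Ici_at_right)
        then have "(\<lambda>m. Z (\<eta> m) \<omega>) \<longlonglongrightarrow> Z 0 \<omega>"
          using k(1) \<eta>0 by (auto simp: continuous_within_sequentially o_def)
        then have "(\<lambda>m. ennreal (min 1 (\<beta> * \<bar>Z (\<eta> m) \<omega>\<bar>))) \<longlonglongrightarrow> ennreal (min 1 (\<beta> * \<bar>Z 0 \<omega>\<bar>))"
          by (intro tendsto_intros tendsto_ennrealI)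
        then show ?case using elim(1) by simp
      qed
      show "(\<lambda>\<omega>. ennreal (min 1 (\<beta> * \<bar>Z (\<eta> m) \<omega>\<bar>))) \<in> borel_measurable M" for m
        using Zm[OF k(1)[of m]] by measurable
    qed (auto simp: emeasure_space_1 ennreal_le_1)
    then show ?thesis by (simp add: eq)
  qed
  have "(\<lambda>m. (\<integral>\<^sup>+\<omega>. ennreal (min 1 (C * \<bar>R m \<omega> - J \<omega>\<bar>)) \<partial>M) +
     ((\<integral>\<^sup>+\<omega>. ennreal (min 1 ((exp (\<gamma> * \<delta> m) - 1) * \<bar>J \<omega>\<bar>)) \<partial>M) + (\<integral>\<^sup>+\<omega>. ennreal (min 1 (\<beta> * \<bar>H m \<omega>\<bar>)) \<partial>M))) \<longlonglongrightarrow> 0 + (0 + 0)"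
    using T2 by (intro tendsto_add T1 T3) simp
  then have lim: "(\<lambda>m. \<integral>\<^sup>+\<omega>. (ennreal (min 1 (C * \<bar>R m \<omega> - J \<omega>\<bar>)) +
     (ennreal (min 1 ((exp (\<gamma> * \<delta> m) - 1) * \<bar>J \<omega>\<bar>)) + ennreal (min 1 (\<beta> * \<bar>H m \<omega>\<bar>)))) \<partial>M) \<longlonglongrightarrow> 0"
    by (simp add: nn_integral_add)
  show ?thesis
    by (rule tendsto_sandwich[OF _ _ tendsto_const lim];
      intro always_eventually allI zero_le nn_integral_mono bound)
qed

section \<open>Pathwise comparison of the mild solution with the scheme\<close>

context
  fixes e :: "nat \<Rightarrow> 'h::{real_inner, banach, second_countable_topology}"
    and \<gamma> :: "nat \<Rightarrow> real" and D :: "'h set" and A :: "'h \<Rightarrow> 'h" and S :: "real \<Rightarrow> 'h \<Rightarrow> 'h"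
  assumes ob: "orthonormal_basis e"
    and \<gamma>0: "\<And>n. 0 < \<gamma> n" and \<gamma>inf: "filterlim \<gamma> at_top sequentially"
    and sa: "self_adjoint_op D A" and eig: "\<And>n. e n \<in> D \<and> A (e n) = - \<gamma> n *\<^sub>R e n"
    and gen: "semigroup_generated_by D A S"
begin

lemmas sg_lin = semigroup_bounded_linear[OF ob \<gamma>0 \<gamma>inf sa eig gen]
lemmas sg_zero = semigroup_zero[OF ob \<gamma>0 \<gamma>inf sa eig gen]
lemmas sg_add = semigroup_add[OF ob \<gamma>0 \<gamma>inf sa eig gen]
lemmas sg_basis = semigroup_basis[OF ob \<gamma>0 \<gamma>inf sa eig gen]
lemmas sg_norm_le = norm_semigroup_le[OF ob \<gamma>0 \<gamma>inf sa eig gen]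
lemmas sg_proj_lipschitz = semigroup_proj_lipschitz[OF ob \<gamma>0 \<gamma>inf sa eig gen]

text \<open>Discrete variation of constants. What is added in step \<open>j\<close> passes through
  \<open>k - j\<close> applications of \<open>S \<delta>\<close>, its own step included.\<close>

lemma euler_explicit:
  assumes \<delta>: "0 \<le> \<delta>"
  shows "euler (S \<delta>) G \<delta> e N x w k = S (real k * \<delta>) x +
    (\<Sum>j<k. \<delta> *\<^sub>R S (real (k - j) * \<delta>) (G (euler (S \<delta>) G \<delta> e N x w j))) +
    (\<Sum>n<N. (\<Sum>j<k. exp (- \<gamma> n * (real (k - j) * \<delta>)) * w (n, j)) *\<^sub>R e n)"
proof (induction k)
  case 0
  show ?case by (simp add: sg_zero)
next
  case (Suc k)
  interpret L: bounded_linear "S \<delta>" by (rule sg_lin[OF \<delta>])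
  let ?E = "\<lambda>k. euler (S \<delta>) G \<delta> e N x w k"
  have step: "S \<delta> (S (real i * \<delta>) y) = S (real (Suc i) * \<delta>) y" for i y
    using sg_add[of \<delta> "real i * \<delta>" y] \<delta> by (simp add: algebra_simps)
  have 1: "S \<delta> (S (real k * \<delta>) x) = S (real (Suc k) * \<delta>) x" by (rule step)
  have 2: "S \<delta> (\<Sum>j<k. \<delta> *\<^sub>R S (real (k - j) * \<delta>) (G (?E j))) + S \<delta> (\<delta> *\<^sub>R G (?E k)) =
    (\<Sum>j<Suc k. \<delta> *\<^sub>R S (real (Suc k - j) * \<delta>) (G (?E j)))"
    unfolding L.sum L.scaleR step by (simp add: Suc_diff_le)
  have 3: "S \<delta> (\<Sum>n<N. (\<Sum>j<k. exp (- \<gamma> n * (real (k - j) * \<delta>)) * w (n, j)) *\<^sub>R e n) + S \<delta> (\<Sum>n<N. w (n, k) *\<^sub>R e n) =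
    (\<Sum>n<N. (\<Sum>j<Suc k. exp (- \<gamma> n * (real (Suc k - j) * \<delta>)) * w (n, j)) *\<^sub>R e n)"
    unfolding L.sum L.scaleR sg_basis[OF \<delta>] sum.distrib[symmetric]
  proof (rule sum.cong[OF refl])
    fix n
    have "(\<Sum>j<k. exp (- \<gamma> n * (real (k - j) * \<delta>)) * w (n, j)) * exp (- \<gamma> n * \<delta>) + w (n, k) * exp (- \<gamma> n * \<delta>) =
      (\<Sum>j<Suc k. exp (- \<gamma> n * (real (Suc k - j) * \<delta>)) * w (n, j))"
    proof -
      have "(\<Sum>j<k. exp (- \<gamma> n * (real (k - j) * \<delta>)) * w (n, j)) * exp (- \<gamma> n * \<delta>) =
        (\<Sum>j<k. exp (- \<gamma> n * (real (Suc k - j) * \<delta>)) * w (n, j))"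
        unfolding sum_distrib_right
      proof (rule sum.cong[OF refl])
        fix j assume j: "j \<in> {..<k}"
        have "exp (- \<gamma> n * (real (k - j) * \<delta>)) * exp (- \<gamma> n * \<delta>) = exp (- \<gamma> n * (real (Suc k - j) * \<delta>))"
          using j by (simp add: mult_exp_exp Suc_diff_le algebra_simps)
        then show "exp (- \<gamma> n * (real (k - j) * \<delta>)) * w (n, j) * exp (- \<gamma> n * \<delta>) = exp (- \<gamma> n * (real (Suc k - j) * \<delta>)) * w (n, j)"
          by (simp only: mult.assoc mult.commute[of "w (n, j)"]) (simp only: mult.assoc[symmetric])
      qed
      then show ?thesis by simp
    qed
    then show "(\<Sum>j<k. exp (- \<gamma> n * (real (k - j) * \<delta>)) * w (n, j)) *\<^sub>R exp (- \<gamma> n * \<delta>) *\<^sub>R e n + w (n, k) *\<^sub>R exp (- \<gamma> n * \<delta>) *\<^sub>R e n =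
      (\<Sum>j<Suc k. exp (- \<gamma> n * (real (Suc k - j) * \<delta>)) * w (n, j)) *\<^sub>R e n"
      by (simp only: scaleR_scaleR scaleR_add_left[symmetric])
  qed
  have "?E (Suc k) = S \<delta> (S (real k * \<delta>) x) +
     (S \<delta> (\<Sum>j<k. \<delta> *\<^sub>R S (real (k - j) * \<delta>) (G (?E j))) + S \<delta> (\<delta> *\<^sub>R G (?E k))) +
     (S \<delta> (\<Sum>n<N. (\<Sum>j<k. exp (- \<gamma> n * (real (k - j) * \<delta>)) * w (n, j)) *\<^sub>R e n) + S \<delta> (\<Sum>n<N. w (n, k) *\<^sub>R e n))"
    by (subst euler.simps(2), subst (1) Suc.IH) (simp only: L.add add_ac)
  then show ?case by (simp only: 1 2 3)
qed

text \<open>Writes the drift sum of the scheme as an integral over time, so that its integrand can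
  be compared pointwise with the one in the mild equation.\<close>

lemma step_function_integral:
  fixes v :: "nat \<Rightarrow> 'h" and k :: nat and \<delta> :: real
  assumes \<delta>: "0 < \<delta>"
  defines "h \<equiv> \<lambda>s. \<Sum>j<k. indicator {real j * \<delta>..<real (Suc j) * \<delta>} s *\<^sub>R v j"
  shows "integrable lborel h" "(\<integral>s. h s \<partial>lborel) = (\<Sum>j<k. \<delta> *\<^sub>R v j)"
    "\<And>s. 0 \<le> s \<Longrightarrow> h s = (if nat \<lfloor>s / \<delta>\<rfloor> < k then v (nat \<lfloor>s / \<delta>\<rfloor>) else 0)"
proof -
  have i: "integrable lborel (\<lambda>s. indicator {real j * \<delta>..<real (Suc j) * \<delta>} s *\<^sub>R v j)" for j
    using \<delta> by (intro integrable_scaleR_left integrable_real_indicator) (auto simp: emeasure_lborel_Ico algebra_simps)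
  show "integrable lborel h" unfolding h_def by (intro Bochner_Integration.integrable_sum i)
  have "(\<integral>s. indicator {real j * \<delta>..<real (Suc j) * \<delta>} s *\<^sub>R v j \<partial>lborel) = \<delta> *\<^sub>R v j" for j
  proof -
    have "measure lborel {real j * \<delta>..<real (Suc j) * \<delta>} = \<delta>"
      using \<delta> by (simp add: algebra_simps)
    moreover have "(\<integral>s. indicator {real j * \<delta>..<real (Suc j) * \<delta>} s *\<^sub>R v j \<partial>lborel) =
      measure lborel {real j * \<delta>..<real (Suc j) * \<delta>} *\<^sub>R v j"
      using \<delta> by (subst integral_scaleR_left) (auto intro!: integrable_real_indicator simp: algebra_simps)
    ultimately show ?thesis by simp
  qed
  then show "(\<integral>s. h s \<partial>lborel) = (\<Sum>j<k. \<delta> *\<^sub>R v j)"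
    unfolding h_def by (subst Bochner_Integration.integral_sum) (auto simp: i simp del: of_nat_Suc)
  fix s :: real assume s: "0 \<le> s"
  have "s \<in> {real j * \<delta>..<real (Suc j) * \<delta>} \<longleftrightarrow> j = nat \<lfloor>s / \<delta>\<rfloor>" for j
  proof -
    have "s \<in> {real j * \<delta>..<real (Suc j) * \<delta>} \<longleftrightarrow> of_int (int j) \<le> s / \<delta> \<and> s / \<delta> < of_int (int j) + 1"
      using \<delta> by (simp add: field_simps)
    also have "\<dots> \<longleftrightarrow> \<lfloor>s / \<delta>\<rfloor> = int j" by (auto simp: floor_eq_iff)
    also have "\<dots> \<longleftrightarrow> j = nat \<lfloor>s / \<delta>\<rfloor>" using s \<delta> by auto
    finally show ?thesis .
  qed
  then have "h s = (\<Sum>j<k. if j = nat \<lfloor>s / \<delta>\<rfloor> then v j else 0)"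
    unfolding h_def by (intro sum.cong) (auto simp: indicator_def simp del: of_nat_Suc atLeastLessThan_iff)
  then show "h s = (if nat \<lfloor>s / \<delta>\<rfloor> < k then v (nat \<lfloor>s / \<delta>\<rfloor>) else 0)" by (simp add: sum.delta)
qed

text \<open>Distances are truncated at 1 because the noise converges only in probability. The
  hypothesis on \<open>F\<close> combines its Lipschitz bound with its boundedness, so that the
  Gronwall term is truncated as well; contractivity of the semigroup and of the projection keeps all
  constants independent of \<open>N\<close> except \<open>\<Gamma>\<close>, which comes with a
  factor \<open>\<delta>\<close>.\<close>

lemma mild_euler_estimate:
  fixes F :: "'h \<Rightarrow> 'h" and Xs :: "real \<Rightarrow> 'h" and w :: "nat \<times> nat \<Rightarrow> real"
  assumes \<delta>: "0 < \<delta>" and r: "0 \<le> r"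
    and F: "\<And>z. norm (F z) \<le> \<Phi>" "\<And>a b. norm (F a - F b) \<le> L * min 1 (norm (a - b))" and L: "0 \<le> L"
    and \<Gamma>: "\<And>n. n < N \<Longrightarrow> \<gamma> n \<le> \<Gamma>" "0 \<le> \<Gamma>"
    and int: "set_integrable lborel {0..r} (\<lambda>s. S (r - s) (F (Xs s)))"
    and Xr: "Xs r = S r x + (LINT s:{0..r}|lborel. S (r - s) (F (Xs s))) + za"
    and m1[measurable]: "(\<lambda>s. norm (F (Xs s) - proj e N (F (Xs s)))) \<in> borel_measurable borel"
  defines "E \<equiv> euler (S \<delta>) (\<lambda>z. proj e N (F z)) \<delta> e N (proj e N x) w" and "\<kappa> \<equiv> \<lambda>s. nat \<lfloor>s / \<delta>\<rfloor>"
  assumes m2[measurable]: "(\<lambda>s. norm (Xs s - E (\<kappa> s))) \<in> borel_measurable borel"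
  shows "ennreal (min 1 (norm (Xs r - E (\<kappa> r)))) \<le>
    ennreal (norm (x - proj e N x) + \<Gamma> * \<delta> * norm x + (\<Gamma> * r + 1) * \<delta> * \<Phi>) +
    (\<integral>\<^sup>+s\<in>{0..r}. ennreal (norm (F (Xs s) - proj e N (F (Xs s)))) \<partial>lborel) +
    (ennreal (min 1 (norm (za - proj e N za))) +
     (\<Sum>n<N. ennreal (min 1 \<bar>za \<bullet> e n - (\<Sum>j<\<kappa> r. exp (- \<gamma> n * (real (\<kappa> r - j) * \<delta>)) * w (n, j))\<bar>))) +
    ennreal L * (\<integral>\<^sup>+s\<in>{0..r}. ennreal (min 1 (norm (Xs s - E (\<kappa> s)))) \<partial>lborel)"
proof -
  let ?P = "proj e N"
  note lipP = bounded_linear_proj[OF ob, of N]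
  let ?k = "\<kappa> r"
  have \<Phi>: "0 \<le> \<Phi>" using F(1)[of 0] norm_ge_zero[of "F 0"] by linarith
  have \<kappa>: "real (\<kappa> s) * \<delta> \<le> s" "s < real (\<kappa> s) * \<delta> + \<delta>" if "0 \<le> s" for s
  proof -
    have "real (\<kappa> s) = of_int \<lfloor>s / \<delta>\<rfloor>" using that \<delta> by (simp add: \<kappa>_def)
    then have "real (\<kappa> s) \<le> s / \<delta>" "s / \<delta> < real (\<kappa> s) + 1" by linarith+
    then show "real (\<kappa> s) * \<delta> \<le> s" "s < real (\<kappa> s) * \<delta> + \<delta>" using \<delta> by (auto simp: field_simps)
  qed
  define v where "v j = S (real (?k - j) * \<delta>) (?P (F (E j)))" for j
  define h where "h s = (\<Sum>j<?k. indicator {real j * \<delta>..<real (Suc j) * \<delta>} s *\<^sub>R v j)" for s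
  note step = step_function_integral[OF \<delta>, where k="?k" and v=v, folded h_def]
  have step3: "h s = (if \<kappa> s < ?k then v (\<kappa> s) else 0)" if "0 \<le> s" for s
    using step(3)[OF that] by (simp add: \<kappa>_def)
  define noise where "noise n = (\<Sum>j<?k. exp (- \<gamma> n * (real (?k - j) * \<delta>)) * w (n, j))" for n
  have Ek: "E ?k = S (real ?k * \<delta>) (?P x) + (\<Sum>j<?k. \<delta> *\<^sub>R v j) + (\<Sum>n<N. noise n *\<^sub>R e n)"
    unfolding E_def v_def noise_def using \<delta> by (intro euler_explicit) simp
  define f where "f s = indicator {0..r} s *\<^sub>R S (r - s) (F (Xs s)) - h s" for s
  have fi: "integrable lborel (\<lambda>s. indicator {0..r} s *\<^sub>R S (r - s) (F (Xs s)))"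
    using int by (simp add: set_integrable_def)
  have f: "integrable lborel f" "(\<integral>s. f s \<partial>lborel) = (LINT s:{0..r}|lborel. S (r - s) (F (Xs s))) - (\<Sum>j<?k. \<delta> *\<^sub>R v j)"
    unfolding f_def using fi step(1,2) by (auto simp: set_lebesgue_integral_def)
  have decomp: "Xs r - E ?k = (S r x - S (real ?k * \<delta>) (?P x)) + (\<integral>s. f s \<partial>lborel) + (za - (\<Sum>n<N. noise n *\<^sub>R e n))"
    unfolding Ek Xr f(2) by simp
  have init: "norm (S r x - S (real ?k * \<delta>) (?P x)) \<le> norm (x - ?P x) + \<Gamma> * \<delta> * norm x"
  proof -
    have k0: "0 \<le> real ?k * \<delta>" using \<delta> by simp
    have "S r x - S (real ?k * \<delta>) (?P x) = S r (x - ?P x) + (S r (?P x) - S (real ?k * \<delta>) (?P x))"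
      by (simp add: linear_simps[OF sg_lin[OF r]])
    then have "norm (S r x - S (real ?k * \<delta>) (?P x)) \<le> norm (S r (x - ?P x)) + norm (S r (?P x) - S (real ?k * \<delta>) (?P x))"
      by (metis norm_triangle_ineq)
    moreover have "norm (S r (x - ?P x)) \<le> norm (x - ?P x)" by (rule sg_norm_le[OF r])
    moreover have "norm (S r (?P x) - S (real ?k * \<delta>) (?P x)) \<le> \<Gamma> * \<bar>r - real ?k * \<delta>\<bar> * norm x"
      by (rule sg_proj_lipschitz[OF r k0 \<Gamma>])
    moreover have "\<Gamma> * \<bar>r - real ?k * \<delta>\<bar> * norm x \<le> \<Gamma> * \<delta> * norm x"
      using \<kappa>[OF r] \<Gamma>(2) by (intro mult_right_mono mult_left_mono) auto
    ultimately show ?thesis by linarith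
  qed
  \<comment> \<open>In a complete cell the integrands differ by the projection error, a change of at
    most \<open>\<delta>\<close> in the time argument of \<open>S\<close>, and the Lipschitz error
    of \<open>F\<close>. On the incomplete last cell the scheme has no term, which costs
    \<open>\<Phi>\<close> over a length below \<open>\<delta>\<close>.\<close>
  have ptw: "ennreal (norm (f s)) \<le>
     (ennreal (norm (F (Xs s) - ?P (F (Xs s)))) + ennreal (\<Gamma> * \<delta> * \<Phi>) + ennreal L * ennreal (min 1 (norm (Xs s - E (\<kappa> s))))) * indicator {0..r} s
     + ennreal \<Phi> * indicator {real ?k * \<delta>..r} s" for s
  proof (cases "s \<in> {0..r}")
    case False
    then have "h s = 0"
    proof (cases "0 \<le> s")
      case True
      then have "r < s" using False by auto
      then have "r / \<delta> \<le> s / \<delta>" using \<delta> by (simp add: divide_right_mono)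
      then have "?k \<le> \<kappa> s" unfolding \<kappa>_def by (intro nat_mono floor_mono)
      then show ?thesis using step3[OF True] by simp
    next
      case False
      then have "s \<notin> {real j * \<delta>..<real (Suc j) * \<delta>}" for j
      proof -
        have "0 \<le> real j * \<delta>" using \<delta> by simp
        then show ?thesis using False by auto
      qed
      then show ?thesis unfolding h_def by (intro sum.neutral) (simp del: atLeastLessThan_iff)
    qed
    then show ?thesis using False by (simp add: f_def)
  next
    case True
    then have s: "0 \<le> s" "s \<le> r" by auto
    have rs: "0 \<le> r - s" using s by simp
    have kk: "\<kappa> s \<le> ?k" unfolding \<kappa>_def using s \<delta> by (intro nat_mono floor_mono divide_right_mono) auto
    show ?thesis
    proof (cases "\<kappa> s < ?k")
      case False
      then have "\<kappa> s = ?k" using kk by simp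
      then have "real ?k * \<delta> \<le> s" using \<kappa>(1)[OF s(1)] by simp
      moreover have "f s = S (r - s) (F (Xs s))" using True False step3[OF s(1)] by (simp add: f_def)
      then have "norm (f s) \<le> \<Phi>" using sg_norm_le[OF rs, of "F (Xs s)"] F(1)[of "Xs s"] by simp
      ultimately show ?thesis using s by (simp add: add_increasing ennreal_leI)
    next
      case lt: True
      define u where "u = real (?k - \<kappa> s) * \<delta>"
      have u: "0 \<le> u" "\<bar>r - s - u\<bar> \<le> \<delta>"
        using \<delta> \<kappa>[OF s(1)] \<kappa>[OF r] kk by (auto simp: u_def of_nat_diff left_diff_distrib abs_le_iff)
      let ?y = "F (Xs s)"
      have "f s = S (r - s) ?y - S u (?P (F (E (\<kappa> s))))"
        using True lt step3[OF s(1)] by (simp add: f_def v_def u_def)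
      also have "\<dots> = S (r - s) (?y - ?P ?y) + (S (r - s) (?P ?y) - S u (?P ?y)) + S u (?P (?y - F (E (\<kappa> s))))"
        by (simp add: linear_simps[OF sg_lin[OF rs]] linear_simps[OF sg_lin[OF u(1)]] linear_simps[OF lipP])
      finally have fs: "f s = S (r - s) (?y - ?P ?y) + (S (r - s) (?P ?y) - S u (?P ?y)) + S u (?P (?y - F (E (\<kappa> s))))" .
      have "norm (f s) \<le> norm (S (r - s) (?y - ?P ?y)) + norm (S (r - s) (?P ?y) - S u (?P ?y)) + norm (S u (?P (?y - F (E (\<kappa> s)))))"
        unfolding fs by (intro order_trans[OF norm_triangle_ineq] add_right_mono norm_triangle_ineq)
      moreover have "norm (S (r - s) (?y - ?P ?y)) \<le> norm (?y - ?P ?y)" by (rule sg_norm_le[OF rs])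
      moreover have "norm (S (r - s) (?P ?y) - S u (?P ?y)) \<le> \<Gamma> * \<bar>r - s - u\<bar> * norm ?y"
        by (rule sg_proj_lipschitz[OF rs u(1) \<Gamma>])
      moreover have "\<Gamma> * \<bar>r - s - u\<bar> * norm ?y \<le> \<Gamma> * \<delta> * \<Phi>"
        using u(2) \<Gamma>(2) F(1)[of "Xs s"] \<delta> by (intro mult_mono mult_left_mono) auto
      moreover have "norm (S u (?P (?y - F (E (\<kappa> s))))) \<le> L * min 1 (norm (Xs s - E (\<kappa> s)))"
        using sg_norm_le[OF u(1), of "?P (?y - F (E (\<kappa> s)))"] norm_proj_le[OF ob, of N "?y - F (E (\<kappa> s))"]
          F(2)[of "Xs s" "E (\<kappa> s)"] by linarith
      ultimately have "norm (f s) \<le> norm (?y - ?P ?y) + \<Gamma> * \<delta> * \<Phi> + L * min 1 (norm (Xs s - E (\<kappa> s)))" by linarith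
      then have "ennreal (norm (f s)) \<le> ennreal (norm (?y - ?P ?y) + \<Gamma> * \<delta> * \<Phi> + L * min 1 (norm (Xs s - E (\<kappa> s))))"
        by (rule ennreal_leI)
      also have "\<dots> = ennreal (norm (?y - ?P ?y)) + ennreal (\<Gamma> * \<delta> * \<Phi>) + ennreal L * ennreal (min 1 (norm (Xs s - E (\<kappa> s))))"
        using \<Gamma>(2) \<delta> \<Phi> L by (simp add: ennreal_mult)
      finally show ?thesis using True by (simp add: add_increasing2)
    qed
  qed
  let ?I1 = "\<integral>\<^sup>+s\<in>{0..r}. ennreal (norm (F (Xs s) - ?P (F (Xs s)))) \<partial>lborel"
  let ?I2 = "\<integral>\<^sup>+s\<in>{0..r}. ennreal (min 1 (norm (Xs s - E (\<kappa> s)))) \<partial>lborel"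
  have drift: "ennreal (norm (\<integral>s. f s \<partial>lborel)) \<le> ?I1 + ennreal L * ?I2 + ennreal ((\<Gamma> * r + 1) * \<delta> * \<Phi>)"
  proof -
    have "ennreal (norm (\<integral>s. f s \<partial>lborel)) \<le> (\<integral>\<^sup>+s. ennreal (norm (f s)) \<partial>lborel)"
      by (rule integral_norm_bound_ennreal[OF f(1)])
    also have "\<dots> \<le> (\<integral>\<^sup>+s. (ennreal (norm (F (Xs s) - ?P (F (Xs s)))) + ennreal (\<Gamma> * \<delta> * \<Phi>) + ennreal L * ennreal (min 1 (norm (Xs s - E (\<kappa> s))))) * indicator {0..r} s
     + ennreal \<Phi> * indicator {real ?k * \<delta>..r} s \<partial>lborel)"
      by (rule nn_integral_mono) (rule ptw)
    also have "\<dots> = (\<integral>\<^sup>+s. (ennreal (norm (F (Xs s) - ?P (F (Xs s)))) * indicator {0..r} s + ennreal (\<Gamma> * \<delta> * \<Phi>) * indicator {0..r} s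
        + ennreal L * (ennreal (min 1 (norm (Xs s - E (\<kappa> s)))) * indicator {0..r} s))
       + ennreal \<Phi> * indicator {real ?k * \<delta>..r} s \<partial>lborel)"
      by (intro nn_integral_cong) (simp only: distrib_right mult.assoc)
    also have "\<dots> = (?I1 + ennreal (\<Gamma> * \<delta> * \<Phi>) * ennreal r + ennreal L * ?I2) + ennreal \<Phi> * ennreal (r - real ?k * \<delta>)"
      using r \<kappa>(1)[OF r]
      by (simp add: nn_integral_add nn_integral_cmult nn_integral_cmult_indicator)
    also have "\<dots> \<le> (?I1 + ennreal (\<Gamma> * \<delta> * \<Phi>) * ennreal r + ennreal L * ?I2) + ennreal \<Phi> * ennreal \<delta>"
      using \<kappa>(2)[OF r] by (intro add_left_mono mult_left_mono ennreal_leI) auto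
    also have "\<dots> = ?I1 + ennreal L * ?I2 + (ennreal (\<Gamma> * \<delta> * \<Phi>) * ennreal r + ennreal \<Phi> * ennreal \<delta>)"
      by (simp only: add_ac)
    also have "ennreal (\<Gamma> * \<delta> * \<Phi>) * ennreal r + ennreal \<Phi> * ennreal \<delta> = ennreal ((\<Gamma> * r + 1) * \<delta> * \<Phi>)"
      using \<Gamma>(2) \<delta> \<Phi> r by (simp add: ennreal_mult[symmetric] ennreal_plus[symmetric] algebra_simps del: ennreal_plus)
    finally show ?thesis .
  qed
  have noise: "ennreal (min 1 (norm (za - (\<Sum>n<N. noise n *\<^sub>R e n)))) \<le>
    ennreal (min 1 (norm (za - ?P za))) + (\<Sum>n<N. ennreal (min 1 \<bar>za \<bullet> e n - noise n\<bar>))"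
  proof -
    have ne: "norm (e n) = 1" for n by (simp add: norm_eq_sqrt_inner inner_basis[OF ob])
    have "za - (\<Sum>n<N. noise n *\<^sub>R e n) = (za - ?P za) + (\<Sum>n<N. (za \<bullet> e n - noise n) *\<^sub>R e n)"
      by (simp add: proj_def scaleR_diff_left sum_subtractf)
    then have "norm (za - (\<Sum>n<N. noise n *\<^sub>R e n)) \<le> norm (za - ?P za) + norm (\<Sum>n<N. (za \<bullet> e n - noise n) *\<^sub>R e n)"
      by (metis norm_triangle_ineq)
    also have "norm (\<Sum>n<N. (za \<bullet> e n - noise n) *\<^sub>R e n) \<le> (\<Sum>n<N. \<bar>za \<bullet> e n - noise n\<bar>)"
      by (rule order_trans[OF norm_sum]) (simp add: ne)
    finally have "ennreal (min 1 (norm (za - (\<Sum>n<N. noise n *\<^sub>R e n)))) \<le>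
      ennreal (min 1 (norm (za - ?P za) + (\<Sum>n<N. \<bar>za \<bullet> e n - noise n\<bar>)))"
      by (intro ennreal_leI) auto
    also have "\<dots> \<le> ennreal (min 1 (norm (za - ?P za))) + ennreal (min 1 (\<Sum>n<N. \<bar>za \<bullet> e n - noise n\<bar>))"
      by (intro ennreal_min_add_le sum_nonneg) auto
    also have "ennreal (min 1 (\<Sum>n<M. \<bar>za \<bullet> e n - noise n\<bar>)) \<le> (\<Sum>n<M. ennreal (min 1 \<bar>za \<bullet> e n - noise n\<bar>))" for M
    proof (induction M)
      case (Suc M)
      have "ennreal (min 1 (\<Sum>n<Suc M. \<bar>za \<bullet> e n - noise n\<bar>)) \<le>
        ennreal (min 1 (\<Sum>n<M. \<bar>za \<bullet> e n - noise n\<bar>)) + ennreal (min 1 \<bar>za \<bullet> e M - noise M\<bar>)"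
        unfolding sum.lessThan_Suc by (intro ennreal_min_add_le sum_nonneg) auto
      also have "\<dots> \<le> (\<Sum>n<M. ennreal (min 1 \<bar>za \<bullet> e n - noise n\<bar>)) + ennreal (min 1 \<bar>za \<bullet> e M - noise M\<bar>)"
        by (intro add_right_mono Suc.IH)
      finally show ?case by simp
    qed simp
    finally show ?thesis by (simp add: add_left_mono)
  qed
  let ?a = "norm (S r x - S (real ?k * \<delta>) (?P x))" and ?b = "norm (\<integral>s. f s \<partial>lborel)"
    and ?c = "norm (za - (\<Sum>n<N. noise n *\<^sub>R e n))"
  have "norm (Xs r - E ?k) \<le> ?a + ?b + ?c"
    unfolding decomp by (intro order_trans[OF norm_triangle_ineq] add_right_mono norm_triangle_ineq)
  then have "ennreal (min 1 (norm (Xs r - E ?k))) \<le> ennreal (min 1 (?a + ?b + ?c))" by (intro ennreal_leI) auto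
  also have "\<dots> \<le> ennreal (min 1 (?a + ?b)) + ennreal (min 1 ?c)" by (intro ennreal_min_add_le) auto
  also have "\<dots> \<le> ennreal (?a + ?b) + ennreal (min 1 ?c)" by (intro add_right_mono ennreal_leI) auto
  also have "\<dots> = ennreal ?a + ennreal ?b + ennreal (min 1 ?c)" by simp
  also have "\<dots> \<le> ennreal (norm (x - ?P x) + \<Gamma> * \<delta> * norm x) + (?I1 + ennreal L * ?I2 + ennreal ((\<Gamma> * r + 1) * \<delta> * \<Phi>)) +
    (ennreal (min 1 (norm (za - ?P za))) + (\<Sum>n<N. ennreal (min 1 \<bar>za \<bullet> e n - noise n\<bar>)))"
    by (intro add_mono ennreal_leI init drift noise)
  also have "\<dots> = (ennreal (norm (x - ?P x) + \<Gamma> * \<delta> * norm x) + ennreal ((\<Gamma> * r + 1) * \<delta> * \<Phi>)) + ?I1 +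
    (ennreal (min 1 (norm (za - ?P za))) + (\<Sum>n<N. ennreal (min 1 \<bar>za \<bullet> e n - noise n\<bar>))) + ennreal L * ?I2"
    by (simp only: add_ac)
  also have "ennreal (norm (x - ?P x) + \<Gamma> * \<delta> * norm x) + ennreal ((\<Gamma> * r + 1) * \<delta> * \<Phi>) =
    ennreal (norm (x - ?P x) + \<Gamma> * \<delta> * norm x + (\<Gamma> * r + 1) * \<delta> * \<Phi>)"
    using \<Gamma>(2) \<delta> \<Phi> r by (intro ennreal_plus[symmetric]) (auto intro!: add_nonneg_nonneg mult_nonneg_nonneg)
  finally show ?thesis unfolding noise_def .
qed

end

section \<open>Passage to the limit in probability\<close>

lemma euler_rv_measurable:
  fixes e :: "nat \<Rightarrow> 'h::{real_normed_vector, second_countable_topology}"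
  assumes T: "continuous_on UNIV T" and G: "continuous_on UNIV G"
    and \<xi>[measurable]: "\<And>i. \<xi> i \<in> borel_measurable M"
  shows "(\<lambda>\<omega>. euler T G \<delta> e N x (\<lambda>i. \<xi> i \<omega>) k) \<in> borel_measurable M"
proof (induction k)
  case (Suc k)
  have [measurable]: "T \<in> borel_measurable borel" "G \<in> borel_measurable borel"
    using T G by (auto intro: borel_measurable_continuous_onI)
  note Suc[measurable]
  show ?case by simp
qed simp

lemma sums_inner_basis:
  fixes e :: "nat \<Rightarrow> 'h::{real_inner, banach, second_countable_topology}"
  assumes ob: "orthonormal_basis e" and s: "(\<lambda>n. c n *\<^sub>R e n) sums y"
  shows "y \<bullet> e k = c k"
proof -
  have "(\<lambda>n. (c n *\<^sub>R e n) \<bullet> e k) sums (y \<bullet> e k)"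
    using bounded_linear.sums[OF bounded_linear_inner_left s] .
  moreover have "(\<lambda>n. (c n *\<^sub>R e n) \<bullet> e k) = (\<lambda>n. if n = k then c n else 0)"
    by (auto simp: inner_basis[OF ob])
  ultimately have "(\<lambda>n. if n = k then c n else 0) sums (y \<bullet> e k)" by simp
  moreover have "(\<lambda>n. if n = k then c n else 0) sums c k" by (rule sums_single)
  ultimately show ?thesis by (rule sums_unique2)
qed

definition noise_increment ::
  "(nat \<Rightarrow> real \<Rightarrow> 'w \<Rightarrow> real) \<Rightarrow> (nat \<Rightarrow> real) \<Rightarrow> real \<Rightarrow> nat \<times> nat \<Rightarrow> 'w \<Rightarrow> real" where
  "noise_increment Z \<beta> \<delta> = (\<lambda>(n, k) \<omega>. \<beta> n * (Z n (real (Suc k) * \<delta>) \<omega> - Z n (real k * \<delta>) \<omega>))"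

text \<open>The error splits into \<open>b\<close>, caused by projecting the initial value, the
  drift and the noise and independent of \<open>m\<close>, and \<open>c\<close>, which vanishes as
  \<open>m\<close> grows for fixed \<open>N\<close>. Since \<open>c\<close> contains
  \<open>\<Gamma> N * \<delta> m\<close>, the truncation is fixed before the step.\<close>

lemma euler_converges:
  fixes e :: "nat \<Rightarrow> 'h::{real_inner, banach, second_countable_topology}"
    and F :: "'h \<Rightarrow> 'h" and X :: "real \<Rightarrow> 'w \<Rightarrow> 'h"
  assumes ob: "orthonormal_basis e"
    and \<gamma>0: "\<And>n. 0 < \<gamma> n" and \<gamma>inf: "filterlim \<gamma> at_top sequentially"
    and sa: "self_adjoint_op D A" and eig: "\<And>n. e n \<in> D \<and> A (e n) = - \<gamma> n *\<^sub>R e n"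
    and gen: "semigroup_generated_by D A S"
    and sb: "stochastic_basis M Fil" and levy: "\<And>n. levy_process M Fil (Z n)" and \<beta>: "\<And>n. 0 < \<beta> n"
    and conv: "stochastic_convolution M Fil Z e \<beta> \<gamma> ZA"
    and mild: "mild_solution M Fil S F ZA x X"
    and lip: "L0-lipschitz_on UNIV F" and \<Phi>: "\<And>z. norm (F z) \<le> \<Phi>"
    and t: "0 < t" and \<epsilon>: "0 < \<epsilon>"
  defines "\<delta> \<equiv> \<lambda>m. t / real (Suc m)"
  defines "Eul \<equiv> \<lambda>N m \<omega> k. euler (S (\<delta> m)) (\<lambda>z. proj e N (F z)) (\<delta> m) e N (proj e N x)
    (\<lambda>i. noise_increment Z \<beta> (\<delta> m) i \<omega>) k"
  shows "\<exists>N0. \<forall>N\<ge>N0. \<exists>m0. \<forall>m\<ge>m0. (\<integral>\<^sup>+\<omega>. ennreal (min 1 (norm (X t \<omega> - Eul N m \<omega> (Suc m)))) \<partial>M) \<le> ennreal \<epsilon>"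
proof -
  interpret prob_space M using sb by (simp add: stochastic_basis_def)
  interpret LM: pair_sigma_finite lborel M ..
  note sg = ob \<gamma>0 \<gamma>inf sa eig gen
  \<comment> \<open>One constant for the truncated Lipschitz bound: \<open>L0\<close> serves near
    points, \<open>2 * \<Phi>\<close> distant ones, and adding 1 makes it positive as Gronwall's
    inequality requires.\<close>
  define L where "L = max L0 (2 * \<Phi>) + 1"
  have \<Phi>0: "0 \<le> \<Phi>" using \<Phi>[of 0] norm_ge_zero[of "F 0"] by linarith
  have L: "0 < L" using \<Phi>0 by (simp add: L_def)
  have FL: "norm (F a - F b) \<le> L * min 1 (norm (a - b))" for a b
  proof (cases "norm (a - b) \<le> 1")
    case True
    have "norm (F a - F b) \<le> L0 * norm (a - b)" using lipschitz_onD[OF lip, of a b] by (simp add: dist_norm)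
    also have "\<dots> \<le> L * norm (a - b)" by (intro mult_right_mono) (auto simp: L_def)
    finally show ?thesis using True by simp
  next
    case False
    have "norm (F a - F b) \<le> 2 * \<Phi>" using norm_triangle_ineq4[of "F a" "F b"] \<Phi>[of a] \<Phi>[of b] by linarith
    then show ?thesis using False by (simp add: L_def)
  qed
  have Fc: "continuous_on UNIV F" using lip by (rule lipschitz_on_continuous_on)
  have Pc: "continuous_on UNIV (proj e N)" for N
    by (rule linear_continuous_on[OF bounded_linear_proj[OF ob]])
  have PFc: "continuous_on UNIV (\<lambda>z. proj e N (F z))" for N
    by (rule continuous_on_compose2[OF Pc Fc]) simp
  have [measurable]: "F \<in> borel_measurable borel" "proj e N \<in> borel_measurable borel" for N
    using Fc Pc by (auto intro: borel_measurable_continuous_onI)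
  have \<delta>: "0 < \<delta> m" "\<delta> m \<le> t" for m using t by (auto simp: \<delta>_def field_simps)
  have \<delta>0: "\<delta> \<longlonglongrightarrow> 0" unfolding \<delta>_def by real_asymp
  have Sc: "continuous_on UNIV (S (\<delta> m))" for m
    using sg_lin[OF sg, of "\<delta> m"] \<delta>(1)[of m] by (intro linear_continuous_on) auto
  define \<kappa> where "\<kappa> m s = nat \<lfloor>s / \<delta> m\<rfloor>" for m and s :: real
  have [measurable]: "\<kappa> m \<in> measurable borel (count_space UNIV)" for m unfolding \<kappa>_def by measurable
  have Zm: "0 \<le> s \<Longrightarrow> Z n s \<in> borel_measurable M" for s n
    using levy[of n] sb by (auto simp: levy_process_def stochastic_basis_def intro: measurable_from_subalg)
  have \<xi>m[measurable]: "noise_increment Z \<beta> (\<delta> m) i \<in> borel_measurable M" for m i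
    using \<delta>(1)[of m] unfolding noise_increment_def
    by (cases i) (auto intro!: borel_measurable_times borel_measurable_diff Zm simp: less_imp_le)
  have Em[measurable]: "(\<lambda>\<omega>. Eul N m \<omega> k) \<in> borel_measurable M" for N m k
    unfolding Eul_def by (rule euler_rv_measurable[OF Sc PFc \<xi>m])
  define X' where "X' s = X (max 0 s)" for s
  define ZA' where "ZA' s = ZA (max 0 s)" for s
  have X'm[measurable]: "(\<lambda>(s, \<omega>). X' s \<omega>) \<in> borel_measurable (borel \<Otimes>\<^sub>M M)"
    using predictable_measurable_pair[OF sb] mild by (auto simp: mild_solution_def X'_def)
  have ZA'm[measurable]: "(\<lambda>(s, \<omega>). ZA' s \<omega>) \<in> borel_measurable (borel \<Otimes>\<^sub>M M)"
    using predictable_measurable_pair[OF sb] conv by (auto simp: stochastic_convolution_def ZA'_def)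
  have Ekm[measurable]: "(\<lambda>(s, \<omega>). Eul N m \<omega> (\<kappa> m s)) \<in> borel_measurable (borel \<Otimes>\<^sub>M M)" for N m
    unfolding case_prod_beta' by (rule measurable_compose_countable[where g="\<lambda>p. \<kappa> m (fst p)"]) measurable
  define Rm where "Rm n m k \<omega> = (\<Sum>j<k. exp (- \<gamma> n * (real (k - j) * \<delta> m)) * noise_increment Z \<beta> (\<delta> m) (n, j) \<omega>)" for n m k \<omega>
  have [measurable]: "Rm n m k \<in> borel_measurable M" for n m k unfolding Rm_def by measurable
  have Rkm[measurable]: "(\<lambda>(s, \<omega>). Rm n m (\<kappa> m s) \<omega>) \<in> borel_measurable (borel \<Otimes>\<^sub>M M)" for n m
    unfolding case_prod_beta' by (rule measurable_compose_countable[where g="\<lambda>p. \<kappa> m (fst p)"]) measurable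
  \<comment> \<open>Any bound for the first \<open>N\<close> eigenvalues will do; the sum avoids a
    maximum over a possibly empty set.\<close>
  define \<Gamma> where "\<Gamma> N = (\<Sum>n<N. \<gamma> n)" for N
  have \<Gamma>: "\<gamma> n \<le> \<Gamma> N" if "n < N" for n N
    unfolding \<Gamma>_def using that \<gamma>0 by (intro member_le_sum) (auto simp: less_imp_le)
  have \<Gamma>0: "0 \<le> \<Gamma> N" for N unfolding \<Gamma>_def using \<gamma>0 by (intro sum_nonneg) (auto simp: less_imp_le)
  define d where "d N m r = (\<integral>\<^sup>+\<omega>. ennreal (min 1 (norm (X' r \<omega> - Eul N m \<omega> (\<kappa> m r)))) \<partial>M)" for N m r
  define b0 where "b0 N = (\<integral>\<^sup>+\<omega>. (\<integral>\<^sup>+s\<in>{0..t}. ennreal (norm (F (X' s \<omega>) - proj e N (F (X' s \<omega>)))) \<partial>lborel) \<partial>M)" for N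
  define b1 where "b1 N r = (\<integral>\<^sup>+\<omega>. ennreal (min 1 (norm (ZA' r \<omega> - proj e N (ZA' r \<omega>)))) \<partial>M)" for N r
  define c1 where "c1 N m r = (\<Sum>n<N. \<integral>\<^sup>+\<omega>. ennreal (min 1 \<bar>ZA' r \<omega> \<bullet> e n - Rm n m (\<kappa> m r) \<omega>\<bar>) \<partial>M)" for N m r
  define b where "b N r = ennreal (norm (x - proj e N x)) + b0 N + b1 N r" for N r
  define c where "c N m r = ennreal (\<Gamma> N * \<delta> m * norm x + (\<Gamma> N * t + 1) * \<delta> m * \<Phi>) + c1 N m r" for N m r
  have dm[measurable]: "d N m \<in> borel_measurable borel" for N m unfolding d_def by measurable
  have b1m[measurable]: "b1 N \<in> borel_measurable borel" for N unfolding b1_def by measurable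
  have c1m[measurable]: "c1 N m \<in> borel_measurable borel" for N m unfolding c1_def by measurable
  have bm[measurable]: "b N \<in> borel_measurable borel" for N unfolding b_def by measurable
  have cm[measurable]: "c N m \<in> borel_measurable borel" for N m unfolding c_def by measurable
  have X'\<omega>[measurable]: "X' s \<in> borel_measurable M" for s using measurable_Pair2[OF X'm, of s] by simp
  have ZA'\<omega>[measurable]: "ZA' s \<in> borel_measurable M" for s using measurable_Pair2[OF ZA'm, of s] by simp
  have main: "d N m r \<le> (b N r + c N m r) + ennreal L * (\<integral>\<^sup>+s\<in>{0..r}. d N m s \<partial>lborel)"
    if r: "0 \<le> r" "r \<le> t" for N m r
  proof -
    let ?I1 = "\<lambda>\<omega>. \<integral>\<^sup>+s\<in>{0..t}. ennreal (norm (F (X' s \<omega>) - proj e N (F (X' s \<omega>)))) \<partial>lborel"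
    let ?I2 = "\<lambda>\<omega>. \<integral>\<^sup>+s\<in>{0..r}. ennreal (min 1 (norm (X' s \<omega> - Eul N m \<omega> (\<kappa> m s)))) \<partial>lborel"
    let ?z = "\<lambda>\<omega>. ennreal (min 1 (norm (ZA' r \<omega> - proj e N (ZA' r \<omega>))))"
    let ?n = "\<lambda>\<omega>. \<Sum>n<N. ennreal (min 1 \<bar>ZA' r \<omega> \<bullet> e n - Rm n m (\<kappa> m r) \<omega>\<bar>)"
    let ?c = "ennreal (norm (x - proj e N x) + (\<Gamma> N * \<delta> m * norm x + (\<Gamma> N * t + 1) * \<delta> m * \<Phi>))"
    have [measurable]: "?I1 \<in> borel_measurable M" by measurable
    have [measurable]: "?I2 \<in> borel_measurable M" by measurable
    have "AE \<omega> in M. set_integrable lborel {0..r} (\<lambda>s. S (r - s) (F (X s \<omega>))) \<and>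
        X r \<omega> = S r x + (LINT s:{0..r}|lborel. S (r - s) (F (X s \<omega>))) + ZA r \<omega>"
      using mild r by (simp add: mild_solution_def)
    then have ae: "AE \<omega> in M. ennreal (min 1 (norm (X' r \<omega> - Eul N m \<omega> (\<kappa> m r)))) \<le>
       ?c + ?I1 \<omega> + (?z \<omega> + ?n \<omega>) + ennreal L * ?I2 \<omega>"
      using AE_space
    proof eventually_elim
      case (elim \<omega>)
      have sec: "(\<lambda>s. X' s \<omega>) \<in> borel_measurable borel"
        using measurable_Pair1[OF X'm elim(2)] by simp
      have secE: "(\<lambda>s. Eul N m \<omega> (\<kappa> m s)) \<in> borel_measurable borel"
        using measurable_Pair1[OF Ekm elim(2)] by simp
      note [measurable] = sec secE
      have "set_integrable lborel {0..r} (\<lambda>s. S (r - s) (F (X' s \<omega>))) \<longleftrightarrow> set_integrable lborel {0..r} (\<lambda>s. S (r - s) (F (X s \<omega>)))"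
        by (intro set_integrable_cong refl) (simp add: X'_def)
      moreover have "(LINT s:{0..r}|lborel. S (r - s) (F (X' s \<omega>))) = (LINT s:{0..r}|lborel. S (r - s) (F (X s \<omega>)))"
        by (intro set_lebesgue_integral_cong) (auto simp: X'_def)
      ultimately have i: "set_integrable lborel {0..r} (\<lambda>s. S (r - s) (F (X' s \<omega>)))"
        and eq: "X' r \<omega> = S r x + (LINT s:{0..r}|lborel. S (r - s) (F (X' s \<omega>))) + ZA' r \<omega>"
        using elim(1) r by (auto simp: X'_def ZA'_def)
      have "ennreal (min 1 (norm (X' r \<omega> - Eul N m \<omega> (\<kappa> m r)))) \<le>
        ennreal (norm (x - proj e N x) + \<Gamma> N * \<delta> m * norm x + (\<Gamma> N * r + 1) * \<delta> m * \<Phi>) +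
        (\<integral>\<^sup>+s\<in>{0..r}. ennreal (norm (F (X' s \<omega>) - proj e N (F (X' s \<omega>)))) \<partial>lborel) +
        (?z \<omega> + ?n \<omega>) + ennreal L * ?I2 \<omega>"
        unfolding Rm_def Eul_def \<kappa>_def
      proof (rule mild_euler_estimate[OF sg \<delta>(1)[of m] r(1) \<Phi> FL less_imp_le[OF L] \<Gamma>[of _ N] \<Gamma>0[of N] i eq])
        show "(\<lambda>s. norm (F (X' s \<omega>) - proj e N (F (X' s \<omega>)))) \<in> borel_measurable borel" by measurable
        show "(\<lambda>s. norm (X' s \<omega> - euler (S (\<delta> m)) (\<lambda>z. proj e N (F z)) (\<delta> m) e N (proj e N x)
            (\<lambda>i. noise_increment Z \<beta> (\<delta> m) i \<omega>) (nat \<lfloor>s / \<delta> m\<rfloor>))) \<in> borel_measurable borel"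
          using sec secE[unfolded Eul_def \<kappa>_def] by measurable
      qed
      also have "\<dots> \<le> ?c + ?I1 \<omega> + (?z \<omega> + ?n \<omega>) + ennreal L * ?I2 \<omega>"
      proof (intro add_right_mono add_mono)
        have "(\<Gamma> N * r + 1) * \<delta> m * \<Phi> \<le> (\<Gamma> N * t + 1) * \<delta> m * \<Phi>"
          using r \<Gamma>0[of N] \<delta>(1)[of m] \<Phi>0 by (intro mult_right_mono add_right_mono mult_left_mono) auto
        then show "ennreal (norm (x - proj e N x) + \<Gamma> N * \<delta> m * norm x + (\<Gamma> N * r + 1) * \<delta> m * \<Phi>) \<le> ?c"
          by (intro ennreal_leI) linarith
        show "(\<integral>\<^sup>+s\<in>{0..r}. ennreal (norm (F (X' s \<omega>) - proj e N (F (X' s \<omega>)))) \<partial>lborel) \<le> ?I1 \<omega>"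
          using r by (intro nn_integral_mono) (auto simp: indicator_def)
      qed
      finally show ?case .
    qed
    have "d N m r \<le> (\<integral>\<^sup>+\<omega>. ?c + ?I1 \<omega> + (?z \<omega> + ?n \<omega>) + ennreal L * ?I2 \<omega> \<partial>M)"
      unfolding d_def by (rule nn_integral_mono_AE[OF ae])
    also have "\<dots> = ?c + b0 N + (b1 N r + c1 N m r) + ennreal L * (\<integral>\<^sup>+\<omega>. ?I2 \<omega> \<partial>M)"
      by (simp add: nn_integral_add nn_integral_cmult nn_integral_sum emeasure_space_1 b0_def b1_def c1_def
          del: sum_ennreal)
    also have "(\<integral>\<^sup>+\<omega>. ?I2 \<omega> \<partial>M) = (\<integral>\<^sup>+s. (\<integral>\<^sup>+\<omega>. ennreal (min 1 (norm (X' s \<omega> - Eul N m \<omega> (\<kappa> m s)))) * indicator {0..r} s \<partial>M) \<partial>lborel)"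
      by (rule LM.Fubini') measurable
    also have "\<dots> = (\<integral>\<^sup>+s\<in>{0..r}. d N m s \<partial>lborel)"
      unfolding d_def by (intro nn_integral_cong nn_integral_multc) measurable
    also have "?c = ennreal (norm (x - proj e N x)) + ennreal (\<Gamma> N * \<delta> m * norm x + (\<Gamma> N * t + 1) * \<delta> m * \<Phi>)"
      using \<Gamma>0[of N] \<delta>(1)[of m] \<Phi>0 t by (intro ennreal_plus) (auto intro!: add_nonneg_nonneg mult_nonneg_nonneg)
    finally show ?thesis unfolding b_def c_def by (simp only: add_ac)
  qed
  have d1: "d N m s \<le> 1" for N m s
  proof -
    have "d N m s \<le> (\<integral>\<^sup>+\<omega>. 1 \<partial>M)" unfolding d_def by (intro nn_integral_mono) (simp add: ennreal_le_1)
    then show ?thesis by (simp add: emeasure_space_1)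
  qed
  define K where "K = ennreal L * ennreal (2 * exp (2 * L * t))"
  \<comment> \<open>Gronwall's inequality controls the time integral of \<open>d\<close>; reinserted
    into \<open>main\<close>, it gives \<open>d\<close> at the single time \<open>t\<close>.\<close>
  have fin: "d N m t \<le> (b N t + K * (\<integral>\<^sup>+s\<in>{0..t}. b N s \<partial>lborel)) + (c N m t + K * (\<integral>\<^sup>+s\<in>{0..t}. c N m s \<partial>lborel))" for N m
  proof -
    have "(\<integral>\<^sup>+s\<in>{0..t}. d N m s \<partial>lborel) \<le> ennreal (2 * exp (2 * L * t)) * (\<integral>\<^sup>+s\<in>{0..t}. (b N s + c N m s) \<partial>lborel)"
      using t by (intro nn_integral_gronwall[OF _ _ L _ d1 main]) auto
    also have "(\<integral>\<^sup>+s\<in>{0..t}. (b N s + c N m s) \<partial>lborel) = (\<integral>\<^sup>+s\<in>{0..t}. b N s \<partial>lborel) + (\<integral>\<^sup>+s\<in>{0..t}. c N m s \<partial>lborel)"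
      by (simp add: distrib_right nn_integral_add)
    finally have "d N m t \<le> (b N t + c N m t) + ennreal L * (ennreal (2 * exp (2 * L * t)) *
        ((\<integral>\<^sup>+s\<in>{0..t}. b N s \<partial>lborel) + (\<integral>\<^sup>+s\<in>{0..t}. c N m s \<partial>lborel)))"
      using main[of t N m] t by (meson add_left_mono less_imp_le mult_left_mono order_refl order_trans zero_le)
    then show ?thesis unfolding K_def by (simp add: distrib_left mult.assoc add_ac)
  qed
  have Kfin: "K < top" unfolding K_def by (simp add: ennreal_mult_less_top)
  have Pcompl: "(\<lambda>N. norm (y - proj e N y)) \<longlonglongrightarrow> 0" for y
    using tendsto_norm[OF tendsto_diff[OF tendsto_const proj_tendsto[OF ob, of y], of y]] by simp
  have PE: "(\<lambda>N. ennreal (norm (y - proj e N y))) \<longlonglongrightarrow> 0" for y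
    using tendsto_ennrealI[OF Pcompl[of y]] by simp
  have PE1: "(\<lambda>N. ennreal (min 1 (norm (y - proj e N y)))) \<longlonglongrightarrow> 0" for y
    using tendsto_ennrealI[OF tendsto_min[OF tendsto_const Pcompl[of y], of 1]] by simp
  have cle: "norm (y - proj e N y) \<le> norm y" for y N by (rule norm_proj_compl_le[OF ob])
  have dom: "(\<integral>\<^sup>+\<omega>. (\<integral>\<^sup>+s. ennreal \<Phi> * indicator {0..t} s \<partial>lborel) \<partial>M) = ennreal \<Phi> * ennreal t"
    using t by (simp add: nn_integral_cmult_indicator emeasure_space_1)
  have b0lim: "b0 \<longlonglongrightarrow> 0"
  proof -
    have "(\<lambda>N. b0 N) \<longlonglongrightarrow> (\<integral>\<^sup>+\<omega>. 0 \<partial>M)"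
      unfolding b0_def
    proof (rule nn_integral_dominated_convergence[where w="\<lambda>_. ennreal \<Phi> * ennreal t"])
      have le: "ennreal (norm (F (X' s \<omega>) - proj e N (F (X' s \<omega>)))) * indicator {0..t} s \<le> ennreal \<Phi> * indicator {0..t} s" for N s \<omega>
        using order_trans[OF cle \<Phi>] by (intro mult_right_mono ennreal_leI) auto
      show "AE \<omega> in M. (\<integral>\<^sup>+s\<in>{0..t}. ennreal (norm (F (X' s \<omega>) - proj e N (F (X' s \<omega>)))) \<partial>lborel) \<le> ennreal \<Phi> * ennreal t" for N
      proof (rule AE_I2)
        fix \<omega>
        have "(\<integral>\<^sup>+s\<in>{0..t}. ennreal (norm (F (X' s \<omega>) - proj e N (F (X' s \<omega>)))) \<partial>lborel) \<le> (\<integral>\<^sup>+s. ennreal \<Phi> * indicator {0..t} s \<partial>lborel)"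
          by (intro nn_integral_mono le)
        then show "(\<integral>\<^sup>+s\<in>{0..t}. ennreal (norm (F (X' s \<omega>) - proj e N (F (X' s \<omega>)))) \<partial>lborel) \<le> ennreal \<Phi> * ennreal t"
          using t by (simp add: nn_integral_cmult_indicator)
      qed
      show "AE \<omega> in M. (\<lambda>N. \<integral>\<^sup>+s\<in>{0..t}. ennreal (norm (F (X' s \<omega>) - proj e N (F (X' s \<omega>)))) \<partial>lborel) \<longlonglongrightarrow> 0"
        using AE_space
      proof eventually_elim
        case (elim \<omega>)
        have [measurable]: "(\<lambda>s. X' s \<omega>) \<in> borel_measurable borel"
          using measurable_Pair1[OF X'm elim] by simp
        have "(\<lambda>N. \<integral>\<^sup>+s\<in>{0..t}. ennreal (norm (F (X' s \<omega>) - proj e N (F (X' s \<omega>)))) \<partial>lborel) \<longlonglongrightarrow> (\<integral>\<^sup>+s. 0 \<partial>(lborel :: real measure))"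
        proof (rule nn_integral_dominated_convergence[where w="\<lambda>s. ennreal \<Phi> * indicator {0..t} s"])
          show "AE s in lborel. (\<lambda>N. ennreal (norm (F (X' s \<omega>) - proj e N (F (X' s \<omega>)))) * indicator {0..t} s) \<longlonglongrightarrow> 0"
          proof (rule AE_I2)
            fix s
            show "(\<lambda>N. ennreal (norm (F (X' s \<omega>) - proj e N (F (X' s \<omega>)))) * indicator {0..t} s) \<longlonglongrightarrow> 0"
              using PE[of "F (X' s \<omega>)"] by (cases "s \<in> {0..t}") auto
          qed
        qed (use le t in \<open>auto simp: nn_integral_cmult_indicator ennreal_mult_less_top\<close>)
        then show ?case by simp
      qed
    qed (auto simp: emeasure_space_1 ennreal_mult_less_top)
    then show ?thesis by simp
  qed
  have b1lim: "(\<lambda>N. b1 N r) \<longlonglongrightarrow> 0" for r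
  proof -
    have "(\<lambda>N. b1 N r) \<longlonglongrightarrow> (\<integral>\<^sup>+\<omega>. 0 \<partial>M)"
      unfolding b1_def
      by (rule nn_integral_dominated_convergence[where w="\<lambda>_. 1"])
        (use PE1 in \<open>auto simp: emeasure_space_1 ennreal_le_1\<close>)
    then show ?thesis by simp
  qed
  have blim: "(\<lambda>N. b N r) \<longlonglongrightarrow> 0" for r
    using tendsto_add[OF tendsto_add[OF PE[of x] b0lim] b1lim[of r]] by (simp add: b_def)
  have b0le: "b0 N \<le> ennreal \<Phi> * ennreal t" for N
    unfolding b0_def dom[symmetric] using order_trans[OF cle \<Phi>]
    by (intro nn_integral_mono mult_right_mono ennreal_leI) auto
  have int1: "(\<integral>\<^sup>+\<omega>. ennreal (min 1 (f \<omega>)) \<partial>M) \<le> 1" for f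
  proof -
    have "(\<integral>\<^sup>+\<omega>. ennreal (min 1 (f \<omega>)) \<partial>M) \<le> (\<integral>\<^sup>+\<omega>. 1 \<partial>M)" by (intro nn_integral_mono) (simp add: ennreal_le_1)
    then show ?thesis by (simp add: emeasure_space_1)
  qed
  have ble: "b N r \<le> ennreal (norm x) + ennreal \<Phi> * ennreal t + 1" for N r
    unfolding b_def by (intro add_mono ennreal_leI cle b0le) (simp add: b1_def int1)
  have bint: "(\<lambda>N. \<integral>\<^sup>+s\<in>{0..t}. b N s \<partial>lborel) \<longlonglongrightarrow> 0"
  proof -
    have "(\<lambda>N. \<integral>\<^sup>+s\<in>{0..t}. b N s \<partial>lborel) \<longlonglongrightarrow> (\<integral>\<^sup>+s. 0 \<partial>(lborel :: real measure))"
    proof (rule nn_integral_dominated_convergence[where w="\<lambda>s. (ennreal (norm x) + ennreal \<Phi> * ennreal t + 1) * indicator {0..t} s"])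
      show "AE s in lborel. (\<lambda>N. b N s * indicator {0..t} s) \<longlonglongrightarrow> 0"
      proof (rule AE_I2)
        fix s
        show "(\<lambda>N. b N s * indicator {0..t} s) \<longlonglongrightarrow> 0" using blim[of s] by (cases "s \<in> {0..t}") auto
      qed
      show "AE s in lborel. b N s * indicator {0..t} s \<le> (ennreal (norm x) + ennreal \<Phi> * ennreal t + 1) * indicator {0..t} s" for N
        by (intro AE_I2 mult_right_mono ble) auto
    qed (use t in \<open>auto simp: nn_integral_cmult_indicator ennreal_mult_less_top ennreal_add_eq_top\<close>)
    then show ?thesis by simp
  qed
  have Blim: "(\<lambda>N. b N t + K * (\<integral>\<^sup>+s\<in>{0..t}. b N s \<partial>lborel)) \<longlonglongrightarrow> 0"
    using tendsto_add[OF blim[of t] ennreal_tendsto_cmult[OF Kfin bint]] by simp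
  have c1lim: "(\<lambda>m. c1 N m r) \<longlonglongrightarrow> 0" if r: "0 \<le> r" for N r
  proof -
    obtain J where J: "\<And>n. stochastic_integral M (\<lambda>s. exp (- \<gamma> n * (r - s)) * \<beta> n) (Z n) r (J n)"
      "AE \<omega> in M. (\<lambda>n. J n \<omega> *\<^sub>R e n) sums ZA r \<omega>"
      using conv r unfolding stochastic_convolution_def by blast
    have "(\<lambda>m. \<integral>\<^sup>+\<omega>. ennreal (min 1 \<bar>ZA' r \<omega> \<bullet> e n - Rm n m (\<kappa> m r) \<omega>\<bar>) \<partial>M) \<longlonglongrightarrow> 0" for n
    proof -
      have "(\<integral>\<^sup>+\<omega>. ennreal (min 1 \<bar>ZA' r \<omega> \<bullet> e n - Rm n m (\<kappa> m r) \<omega>\<bar>) \<partial>M) =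
        (\<integral>\<^sup>+\<omega>. ennreal (min 1 \<bar>J n \<omega> - Rm n m (\<kappa> m r) \<omega>\<bar>) \<partial>M)" for m
      proof (rule nn_integral_cong_AE)
        show "AE \<omega> in M. ennreal (min 1 \<bar>ZA' r \<omega> \<bullet> e n - Rm n m (\<kappa> m r) \<omega>\<bar>) = ennreal (min 1 \<bar>J n \<omega> - Rm n m (\<kappa> m r) \<omega>\<bar>)"
          using J(2)
        proof eventually_elim
          case (elim \<omega>)
          then have "ZA' r \<omega> \<bullet> e n = J n \<omega>" using sums_inner_basis[OF ob elim, of n] r by (simp add: ZA'_def)
          then show ?case by simp
        qed
      qed
      then show ?thesis
        using riemann_sums_converge[OF sb levy[of n] J(1)[of n] \<gamma>0[of n] \<beta>[of n] t r]
        by (simp add: Rm_def noise_increment_def \<kappa>_def \<delta>_def)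
    qed
    then have "(\<lambda>m. c1 N m r) \<longlonglongrightarrow> (\<Sum>n<N. 0)" unfolding c1_def by (intro tendsto_sum)
    then show ?thesis by simp
  qed
  have clim: "(\<lambda>m. c N m r) \<longlonglongrightarrow> 0" if r: "0 \<le> r" for N r
  proof -
    have "(\<lambda>m. \<Gamma> N * \<delta> m * norm x + (\<Gamma> N * t + 1) * \<delta> m * \<Phi>) \<longlonglongrightarrow> \<Gamma> N * 0 * norm x + (\<Gamma> N * t + 1) * 0 * \<Phi>"
      by (intro tendsto_intros \<delta>0)
    from tendsto_ennrealI[OF this] have "(\<lambda>m. ennreal (\<Gamma> N * \<delta> m * norm x + (\<Gamma> N * t + 1) * \<delta> m * \<Phi>)) \<longlonglongrightarrow> 0" by simp
    from tendsto_add[OF this c1lim[OF r]] show ?thesis by (simp add: c_def)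
  qed
  have cle': "c N m r \<le> ennreal (\<Gamma> N * t * norm x + (\<Gamma> N * t + 1) * t * \<Phi>) + of_nat N" for N m r
  proof -
    have "c1 N m r \<le> (\<Sum>n<N. 1)" unfolding c1_def by (intro sum_mono int1)
    then have "c1 N m r \<le> of_nat N" by simp
    moreover have "\<Gamma> N * \<delta> m * norm x + (\<Gamma> N * t + 1) * \<delta> m * \<Phi> \<le> \<Gamma> N * t * norm x + (\<Gamma> N * t + 1) * t * \<Phi>"
      using \<delta>[of m] \<Gamma>0[of N] \<Phi>0 t by (intro add_mono mult_right_mono mult_left_mono) auto
    ultimately show ?thesis unfolding c_def by (rule add_mono[OF ennreal_leI, rotated])
  qed
  have Clim: "(\<lambda>m. c N m t + K * (\<integral>\<^sup>+s\<in>{0..t}. c N m s \<partial>lborel)) \<longlonglongrightarrow> 0" for N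
  proof -
    let ?B = "ennreal (\<Gamma> N * t * norm x + (\<Gamma> N * t + 1) * t * \<Phi>) + of_nat N"
    have "(\<lambda>m. \<integral>\<^sup>+s\<in>{0..t}. c N m s \<partial>lborel) \<longlonglongrightarrow> (\<integral>\<^sup>+s. 0 \<partial>(lborel :: real measure))"
    proof (rule nn_integral_dominated_convergence[where w="\<lambda>s. ?B * indicator {0..t} s"])
      show "AE s in lborel. (\<lambda>m. c N m s * indicator {0..t} s) \<longlonglongrightarrow> 0"
      proof (rule AE_I2)
        fix s
        show "(\<lambda>m. c N m s * indicator {0..t} s) \<longlonglongrightarrow> 0" using clim[of s N] by (cases "s \<in> {0..t}") auto
      qed
      show "AE s in lborel. c N m s * indicator {0..t} s \<le> ?B * indicator {0..t} s" for m
        by (intro AE_I2 mult_right_mono cle') auto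
    qed (use t in \<open>auto simp: nn_integral_cmult_indicator ennreal_mult_less_top ennreal_add_eq_top of_nat_less_top\<close>)
    then have "(\<lambda>m. \<integral>\<^sup>+s\<in>{0..t}. c N m s \<partial>lborel) \<longlonglongrightarrow> 0" by simp
    from tendsto_add[OF clim[of t N] ennreal_tendsto_cmult[OF Kfin this]] show ?thesis using t by simp
  qed
  have \<epsilon>2: "0 < ennreal (\<epsilon> / 2)" using \<epsilon> by (simp add: ennreal_less_zero_iff)
  obtain N0 where N0: "\<And>N. N \<ge> N0 \<Longrightarrow> b N t + K * (\<integral>\<^sup>+s\<in>{0..t}. b N s \<partial>lborel) < ennreal (\<epsilon> / 2)"
    using order_tendstoD(2)[OF Blim \<epsilon>2] unfolding eventually_sequentially by blast
  have "\<exists>m0. \<forall>m\<ge>m0. (\<integral>\<^sup>+\<omega>. ennreal (min 1 (norm (X t \<omega> - Eul N m \<omega> (Suc m)))) \<partial>M) \<le> ennreal \<epsilon>" if N: "N \<ge> N0" for N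
  proof -
    obtain m0 where m0: "\<And>m. m \<ge> m0 \<Longrightarrow> c N m t + K * (\<integral>\<^sup>+s\<in>{0..t}. c N m s \<partial>lborel) < ennreal (\<epsilon> / 2)"
      using order_tendstoD(2)[OF Clim[of N] \<epsilon>2] unfolding eventually_sequentially by blast
    have "(\<integral>\<^sup>+\<omega>. ennreal (min 1 (norm (X t \<omega> - Eul N m \<omega> (Suc m)))) \<partial>M) \<le> ennreal \<epsilon>" if m: "m \<ge> m0" for m
    proof -
      \<comment> \<open>The step divides \<open>t\<close> exactly, so \<open>t\<close> is a grid
        point and is reached after \<open>Suc m\<close> steps.\<close>
      have "t / \<delta> m = real (Suc m)" using t by (simp add: \<delta>_def)
      then have "\<kappa> m t = Suc m" unfolding \<kappa>_def by (simp only: floor_of_nat nat_int)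
      then have "(\<integral>\<^sup>+\<omega>. ennreal (min 1 (norm (X t \<omega> - Eul N m \<omega> (Suc m)))) \<partial>M) = d N m t"
        using t by (simp add: d_def X'_def)
      also have "\<dots> \<le> ennreal (\<epsilon> / 2) + ennreal (\<epsilon> / 2)"
        by (rule order_trans[OF fin add_mono[OF less_imp_le[OF N0[OF N]] less_imp_le[OF m0[OF m]]]])
      also have "\<dots> = ennreal \<epsilon>" using \<epsilon> by (subst ennreal_plus[symmetric]) auto
      finally show ?thesis .
    qed
    then show ?thesis by blast
  qed
  then show ?thesis by blast
qed

section \<open>Lipschitz estimates uniform in the discretisation\<close>

lemma levy_process_increment_law:
  assumes sb: "stochastic_basis M Fil" and levy: "\<And>n. stable_levy_process M Fil \<alpha> (Z n)"
    and \<delta>: "0 \<le> \<delta>" and \<beta>: "\<And>n. 0 < \<beta> n"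
  defines "\<kappa> \<equiv> \<lambda>n. distr M borel (\<lambda>\<omega>. \<beta> n * Z n \<delta> \<omega>)"
  shows "real_distribution (\<kappa> n)"
    and "char (\<kappa> n) h = of_real (exp (- (\<delta> * \<beta> n powr \<alpha> * \<bar>h\<bar> powr \<alpha>)))"
    and "distr M borel (noise_increment Z \<beta> \<delta> (n, k)) = \<kappa> n"
proof -
  interpret prob_space M using sb by (simp add: stochastic_basis_def)
  have Zm[measurable]: "0 \<le> s \<Longrightarrow> Z n s \<in> borel_measurable M" for s n
    using levy[of n] sb
    by (auto simp: stable_levy_process_def levy_process_def stochastic_basis_def intro: measurable_from_subalg)
  note [measurable] = Zm[OF \<delta>]
  show "real_distribution (\<kappa> n)"
    unfolding real_distribution_def real_distribution_axioms_def \<kappa>_def by (simp add: prob_space_distr)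
  have "char (\<kappa> n) h = (CLINT \<omega>|M. iexp ((h * \<beta> n) * Z n \<delta> \<omega>))"
    unfolding char_def \<kappa>_def by (subst integral_distr) (auto simp: mult_ac)
  also have "\<dots> = of_real (exp (- \<delta> * \<bar>h * \<beta> n\<bar> powr \<alpha>))"
    using levy[of n] \<delta> unfolding stable_levy_process_def by blast
  also have "\<bar>h * \<beta> n\<bar> powr \<alpha> = \<beta> n powr \<alpha> * \<bar>h\<bar> powr \<alpha>"
    using \<beta>[of n] by (simp add: abs_mult powr_mult)
  finally show "char (\<kappa> n) h = of_real (exp (- (\<delta> * \<beta> n powr \<alpha> * \<bar>h\<bar> powr \<alpha>)))" by (simp add: mult.assoc)
  let ?s = "real k * \<delta>" and ?t = "real (Suc k) * \<delta>"
  have st: "0 \<le> ?s" "?s \<le> ?t" "0 \<le> ?t" "?t - ?s = \<delta>" using \<delta> by (auto simp: algebra_simps)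
  have d: "distr M borel (\<lambda>\<omega>. Z n ?t \<omega> - Z n ?s \<omega>) = distr M borel (Z n \<delta>)"
    using levy[of n] st unfolding stable_levy_process_def levy_process_def by metis
  have dm: "(\<lambda>\<omega>. Z n ?t \<omega> - Z n ?s \<omega>) \<in> borel_measurable M"
    using st by (intro borel_measurable_diff Zm)
  have "distr M borel (noise_increment Z \<beta> \<delta> (n, k)) =
    distr (distr M borel (\<lambda>\<omega>. Z n ?t \<omega> - Z n ?s \<omega>)) borel (\<lambda>x. \<beta> n * x)"
    using dm by (subst distr_distr) (auto simp: noise_increment_def o_def)
  also have "\<dots> = \<kappa> n" unfolding d \<kappa>_def by (subst distr_distr) (auto simp: o_def)
  finally show "distr M borel (noise_increment Z \<beta> \<delta> (n, k)) = \<kappa> n" .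
qed

lemma noise_increment_indep:
  assumes sb: "stochastic_basis M Fil" and levy: "\<And>n. levy_process M Fil (Z n)"
    and indZ: "independent_processes M Z" and \<delta>: "0 \<le> \<delta>" and Nm: "0 < N" "0 < m"
  shows "prob_space.indep_vars M (\<lambda>_. borel) (noise_increment Z \<beta> \<delta>) ({..<N} \<times> {..<m})"
proof -
  interpret prob_space M using sb by (simp add: stochastic_basis_def)
  have "indep_vars (\<lambda>_. borel) (\<lambda>i \<omega>. \<beta> (fst i) * (case i of (n, k) \<Rightarrow> \<lambda>\<omega>. Z n (real (Suc k) * \<delta>) \<omega> - Z n (real k * \<delta>) \<omega>) \<omega>)
    ({..<N} \<times> {..<m})"
    by (rule indep_vars_compose2[OF increments_indep[OF assms]]) simp
  moreover have "(\<lambda>i \<omega>. \<beta> (fst i) * (case i of (n, k) \<Rightarrow> \<lambda>\<omega>. Z n (real (Suc k) * \<delta>) \<omega> - Z n (real k * \<delta>) \<omega>) \<omega>) =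
    noise_increment Z \<beta> \<delta>"
    by (auto simp: noise_increment_def fun_eq_iff)
  ultimately show ?thesis by simp
qed

lemma smoothing_bcont:
  fixes \<kappa> :: "nat \<Rightarrow> real measure" and e :: "nat \<Rightarrow> 'h::{real_normed_vector, second_countable_topology}"
  assumes rd: "\<And>n. real_distribution (\<kappa> n)" and f: "bcont B f"
  shows "bcont B (smoothing \<kappa> e N f)"
    and "integrable (PiM {..<N} \<kappa>) (\<lambda>w. f (z + (\<Sum>n<N. w n *\<^sub>R e n)))"
proof -
  interpret K: real_distribution "\<kappa> n" for n by (rule rd)
  interpret PK: prob_space "PiM {..<N} \<kappa>" by (intro prob_space_PiM) unfold_locales
  have fc: "continuous_on UNIV f" and fB: "\<And>z. \<bar>f z\<bar> \<le> B" using f by (auto simp: bcont_def)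
  have [measurable]: "f \<in> borel_measurable borel" using fc by (rule borel_measurable_continuous_onI)
  have meas[measurable]: "(\<lambda>w. f (z + (\<Sum>n<N. w n *\<^sub>R e n))) \<in> borel_measurable (PiM {..<N} \<kappa>)" for z
    by measurable
  show int: "integrable (PiM {..<N} \<kappa>) (\<lambda>w. f (z + (\<Sum>n<N. w n *\<^sub>R e n)))" for z
    by (rule PK.integrable_const_bound[where B=B]) (use fB in auto)
  have "continuous_on UNIV (smoothing \<kappa> e N f)"
    unfolding continuous_on_sequentially
  proof (intro ballI allI impI; elim conjE)
    fix z :: 'h and u assume u: "u \<longlonglongrightarrow> z"
    have "(\<lambda>i. \<integral>w. f (u i + (\<Sum>n<N. w n *\<^sub>R e n)) \<partial>PiM {..<N} \<kappa>) \<longlonglongrightarrow> (\<integral>w. f (z + (\<Sum>n<N. w n *\<^sub>R e n)) \<partial>PiM {..<N} \<kappa>)"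
    proof (rule integral_dominated_convergence[where w="\<lambda>_. B"])
      show "AE w in PiM {..<N} \<kappa>. (\<lambda>i. f (u i + (\<Sum>n<N. w n *\<^sub>R e n))) \<longlonglongrightarrow> f (z + (\<Sum>n<N. w n *\<^sub>R e n))"
        by (intro AE_I2 continuous_on_tendsto_compose[OF fc] tendsto_intros u) auto
    qed (use fB in auto)
    then show "(smoothing \<kappa> e N f \<circ> u) \<longlonglongrightarrow> smoothing \<kappa> e N f z" by (simp add: smoothing_def o_def)
  qed
  moreover have "\<bar>smoothing \<kappa> e N f z\<bar> \<le> B" for z
  proof -
    have "\<bar>smoothing \<kappa> e N f z\<bar> \<le> (\<integral>w. \<bar>f (z + (\<Sum>n<N. w n *\<^sub>R e n))\<bar> \<partial>PiM {..<N} \<kappa>)"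
      unfolding smoothing_def by (rule integral_abs_bound)
    also have "\<dots> \<le> (\<integral>w. B \<partial>PiM {..<N} \<kappa>)" using int fB by (intro integral_mono) auto
    finally show ?thesis using PK.prob_space by simp
  qed
  ultimately show "bcont B (smoothing \<kappa> e N f)" by (simp add: bcont_def)
qed

text \<open>For exponents between 1 and 2 the power is at most \<open>y\<close> below 1 and at most
  \<open>y\<^sup>2\<close> above 1, and both occur in the expansion of \<open>exp y - 1\<close>. The
  exponent will be \<open>\<alpha> * g\<close>.\<close>

lemma powr_le_exp_minus_one:
  fixes y p :: real
  assumes y: "0 \<le> y" and p: "1 \<le> p" "p \<le> 2"
  shows "y powr p \<le> 2 * (exp y - 1)"
proof -
  have e: "1 + y + y\<^sup>2 / 2 \<le> exp y" using exp_lower_Taylor_quadratic[OF y] .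
  show ?thesis
  proof (cases "y \<le> 1")
    case True
    show ?thesis
    proof (cases "y = 0")
      case False
      then have "y powr p \<le> y powr 1" using y p True by (intro powr_mono') auto
      also have "\<dots> = y" using y by simp
      also have "\<dots> \<le> 2 * (exp y - 1)"
      proof -
        have "y \<le> exp y - 1" using exp_ge_add_one_self[of y] by (simp only: le_diff_eq add.commute)
        then have "1 * y \<le> 2 * (exp y - 1)" using y by (intro mult_mono) auto
        then show ?thesis by simp
      qed
      finally show ?thesis .
    qed (use p in simp)
  next
    case False
    then have "y powr p \<le> y powr 2" using p by (intro powr_mono) auto
    also have "\<dots> = y\<^sup>2" using False by (simp add: powr_numeral)
    finally show ?thesis using e y by simp
  qed
qed

text \<open>The discrete noise accumulated up to time \<open>\<tau> = (j + 1) \<delta>\<close>, pulled back to time \<open>0\<close>, has in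
  each direction a scale at least of order \<open>\<tau>\<^sup>g\<close>; this is where \<open>\<beta> n \<ge> C1 * \<gamma> n powr (1 / \<alpha> - g)\<close>
  and \<open>1 / \<alpha> \<le> g\<close> enter.\<close>

lemma accumulated_scale_lower_bound:
  fixes \<alpha> g C1 \<beta> \<gamma> \<delta> :: real
  assumes \<alpha>: "1 < \<alpha>" "\<alpha> < 2" and g: "1 / \<alpha> \<le> g" "g < 1" and C1: "0 < C1" and \<gamma>: "0 < \<gamma>"
    and \<beta>: "C1 * \<gamma> powr (1 / \<alpha> - g) \<le> \<beta>" and \<delta>: "0 < \<delta>" "\<gamma> * \<delta> \<le> 1"
  shows "C1 * (real (Suc j) * \<delta>) powr g / (4 * exp 2) \<le>
    (\<delta> * \<beta> powr \<alpha> * (\<Sum>i\<le>j. (1 / exp (- \<gamma> * \<delta>)) powr (\<alpha> * real i))) powr (1 / \<alpha>)"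
proof -
  \<comment> \<open>The accumulated sum is geometric with ratio \<open>exp y\<close>. The bound
    \<open>\<gamma> * \<delta> \<le> 1\<close> keeps \<open>y\<close> at most 2, where
    \<open>exp y - 1\<close> is comparable to \<open>y\<close>.\<close>
  define y where "y = \<alpha> * \<gamma> * \<delta>"
  define \<tau> where "\<tau> = real (Suc j) * \<delta>"
  have y: "0 < y" "y \<le> 2"
  proof -
    have "\<alpha> * (\<gamma> * \<delta>) \<le> 2 * 1" using \<alpha> \<delta> \<gamma> by (intro mult_mono) auto
    then show "y \<le> 2" by (simp add: y_def mult.assoc)
  qed (use \<alpha> \<gamma> \<delta> in \<open>simp add: y_def\<close>)
  have \<tau>: "0 < \<tau>" using \<delta> by (simp add: \<tau>_def)
  have ag: "1 \<le> \<alpha> * g" "\<alpha> * g \<le> 2"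
  proof -
    show "1 \<le> \<alpha> * g" using g \<alpha> by (simp add: field_simps)
    have "\<alpha> * g \<le> 2 * 1" using \<alpha> g by (intro mult_mono) (auto intro: order_trans[of _ "1 / \<alpha>"])
    then show "\<alpha> * g \<le> 2" by simp
  qed
  have "(\<Sum>i\<le>j. (1 / exp (- \<gamma> * \<delta>)) powr (\<alpha> * real i)) = (\<Sum>i<Suc j. exp y ^ i)"
    unfolding lessThan_Suc_atMost
  proof (rule sum.cong[OF refl])
    fix i
    have "1 / exp (- \<gamma> * \<delta>) = exp (\<gamma> * \<delta>)" by (simp add: exp_minus field_simps)
    then have "(1 / exp (- \<gamma> * \<delta>)) powr (\<alpha> * real i) = exp (\<alpha> * real i * (\<gamma> * \<delta>))" by (simp add: powr_def)
    also have "\<dots> = exp y ^ i" by (simp add: exp_of_nat_mult[symmetric] y_def mult_ac)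
    finally show "(1 / exp (- \<gamma> * \<delta>)) powr (\<alpha> * real i) = exp y ^ i" .
  qed
  also have "\<dots> = (exp y ^ Suc j - 1) / (exp y - 1)" using y by (intro geometric_sum) simp
  also have "exp y ^ Suc j = exp (\<alpha> * \<gamma> * \<tau>)" by (simp only: exp_of_nat_mult[symmetric]) (simp add: y_def \<tau>_def mult_ac)
  finally have sum_eq: "(\<Sum>i\<le>j. (1 / exp (- \<gamma> * \<delta>)) powr (\<alpha> * real i)) = (exp (\<alpha> * \<gamma> * \<tau>) - 1) / (exp y - 1)" .
  have ey: "exp y - 1 \<le> y * exp 2"
  proof -
    have "1 - y \<le> exp (- y)" using exp_ge_add_one_self[of "- y"] by simp
    then have "exp y * (1 - y) \<le> exp y * exp (- y)" by (intro mult_left_mono) auto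
    then have "exp y - 1 \<le> y * exp y" by (simp add: mult_exp_exp algebra_simps)
    also have "\<dots> \<le> y * exp 2" using y by simp
    finally show ?thesis .
  qed
  have ey0: "0 < exp y - 1" using y by simp
  have num: "(\<alpha> * \<gamma> * \<tau>) powr (\<alpha> * g) / 2 \<le> exp (\<alpha> * \<gamma> * \<tau>) - 1"
    using powr_le_exp_minus_one[OF _ ag, of "\<alpha> * \<gamma> * \<tau>"] \<alpha> \<gamma> \<tau> by simp
  have "(\<alpha> * \<gamma> * \<tau>) powr (\<alpha> * g) / 2 / (y * exp 2) \<le> (exp (\<alpha> * \<gamma> * \<tau>) - 1) / (exp y - 1)"
  proof (rule frac_le[OF _ num ey0 ey])
    show "0 \<le> exp (\<alpha> * \<gamma> * \<tau>) - 1" using \<alpha> \<gamma> \<tau> by simp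
  qed
  then have S: "(\<alpha> * \<gamma> * \<tau>) powr (\<alpha> * g) / (2 * y * exp 2) \<le> (\<Sum>i\<le>j. (1 / exp (- \<gamma> * \<delta>)) powr (\<alpha> * real i))"
    unfolding sum_eq by (simp add: mult_ac)
  have bb: "C1 powr \<alpha> * \<gamma> powr (1 - \<alpha> * g) \<le> \<beta> powr \<alpha>"
  proof -
    have "(C1 * \<gamma> powr (1 / \<alpha> - g)) powr \<alpha> \<le> \<beta> powr \<alpha>" using \<beta> C1 \<alpha> by (intro powr_mono2) auto
    moreover have "(1 / \<alpha> - g) * \<alpha> = 1 - \<alpha> * g" using \<alpha> by (simp add: field_simps)
    ultimately show ?thesis using C1 by (simp add: powr_mult powr_powr)
  qed
  \<comment> \<open>In \<open>4 * exp 2\<close> one factor 2 comes from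
    \<open>powr_le_exp_minus_one\<close>, the other bounds \<open>\<alpha>\<close>, and
    \<open>exp 2\<close> comes from \<open>ey\<close>. Raising it to the power
    \<open>\<alpha>\<close> enlarges it, which is the right direction.\<close>
  have "(C1 * \<tau> powr g / (4 * exp 2)) powr \<alpha> \<le> C1 powr \<alpha> * \<tau> powr (\<alpha> * g) / (4 * exp 2)"
  proof -
    have "(4 * exp 2) powr 1 \<le> (4 * exp 2 :: real) powr \<alpha>"
    proof (rule powr_mono)
      have "(1::real) \<le> exp 2" by simp
      then show "1 \<le> (4 * exp 2 :: real)" by linarith
    qed (use \<alpha> in simp)
    then have "C1 powr \<alpha> * \<tau> powr (\<alpha> * g) / (4 * exp 2) powr \<alpha> \<le> C1 powr \<alpha> * \<tau> powr (\<alpha> * g) / (4 * exp 2)"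
      by (intro divide_left_mono) (auto intro!: mult_nonneg_nonneg)
    then show ?thesis using C1 \<tau> by (simp add: powr_divide powr_mult powr_powr mult.commute[of g])
  qed
  also have "\<dots> \<le> \<delta> * (C1 powr \<alpha> * \<gamma> powr (1 - \<alpha> * g)) * ((\<alpha> * \<gamma> * \<tau>) powr (\<alpha> * g) / (2 * y * exp 2))"
  proof -
    have "\<delta> * (C1 powr \<alpha> * \<gamma> powr (1 - \<alpha> * g)) * ((\<alpha> * \<gamma> * \<tau>) powr (\<alpha> * g) / (2 * y * exp 2)) =
      C1 powr \<alpha> * \<tau> powr (\<alpha> * g) * (\<alpha> powr (\<alpha> * g) * (\<gamma> powr (1 - \<alpha> * g) * \<gamma> powr (\<alpha> * g)) * \<delta> / (2 * y * exp 2))"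
      using \<alpha> \<gamma> \<tau> by (simp add: powr_mult mult_ac)
    \<comment> \<open>The lower bound on \<open>\<beta>\<close> is tuned to this cancellation: the
      remaining \<open>\<gamma>\<close> disappears against \<open>y\<close>, so the scale is bounded
      below uniformly over the modes.\<close>
    also have "\<gamma> powr (1 - \<alpha> * g) * \<gamma> powr (\<alpha> * g) = \<gamma>" using \<gamma> by (simp add: powr_add[symmetric])
    also have "\<alpha> powr (\<alpha> * g) * \<gamma> * \<delta> / (2 * y * exp 2) = \<alpha> powr (\<alpha> * g) / (2 * \<alpha> * exp 2)"
      using \<alpha> \<gamma> \<delta> by (simp add: y_def field_simps)
    finally have eq: "\<delta> * (C1 powr \<alpha> * \<gamma> powr (1 - \<alpha> * g)) * ((\<alpha> * \<gamma> * \<tau>) powr (\<alpha> * g) / (2 * y * exp 2)) =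
      C1 powr \<alpha> * \<tau> powr (\<alpha> * g) * (\<alpha> powr (\<alpha> * g) / (2 * \<alpha> * exp 2))" .
    have "1 \<le> \<alpha> powr (\<alpha> * g)" using \<alpha> ag by (intro ge_one_powr_ge_zero) auto
    then have "1 / (4 * exp 2) \<le> \<alpha> powr (\<alpha> * g) / (2 * \<alpha> * exp 2)" using \<alpha> by (intro frac_le) auto
    then have "C1 powr \<alpha> * \<tau> powr (\<alpha> * g) * (1 / (4 * exp 2)) \<le> C1 powr \<alpha> * \<tau> powr (\<alpha> * g) * (\<alpha> powr (\<alpha> * g) / (2 * \<alpha> * exp 2))"
      by (intro mult_left_mono) auto
    then show ?thesis unfolding eq by simp
  qed
  also have "\<dots> \<le> \<delta> * \<beta> powr \<alpha> * (\<Sum>i\<le>j. (1 / exp (- \<gamma> * \<delta>)) powr (\<alpha> * real i))"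
    using S bb \<delta> y by (intro mult_mono mult_left_mono) (auto intro!: mult_nonneg_nonneg sum_nonneg)
  finally have "((C1 * \<tau> powr g / (4 * exp 2)) powr \<alpha>) powr (1 / \<alpha>) \<le>
    (\<delta> * \<beta> powr \<alpha> * (\<Sum>i\<le>j. (1 / exp (- \<gamma> * \<delta>)) powr (\<alpha> * real i))) powr (1 / \<alpha>)"
    using \<alpha> by (intro powr_mono2) auto
  then show ?thesis unfolding \<tau>_def[symmetric] using \<alpha> C1 by (simp add: powr_powr)
qed

text \<open>\<open>4 * exp 2 / C1\<close> is the reciprocal of the constant in
  \<open>accumulated_scale_lower_bound\<close>; adding 1 keeps the value positive without a lower
  bound on \<open>inv_moment \<alpha>\<close>.\<close>

definition gradient_const :: "real \<Rightarrow> real \<Rightarrow> real" where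
  "gradient_const \<alpha> C1 = (sqrt (inv_moment \<alpha>) + 1) * (4 * exp 2) / C1"

lemma gradient_const_pos: "0 < C1 \<Longrightarrow> 0 < gradient_const \<alpha> C1"
  unfolding gradient_const_def by (intro divide_pos_pos mult_pos_pos add_nonneg_pos) (auto simp: inv_moment_def)

text \<open>By \<open>smoothing_iterate\<close>, \<open>j\<close> steps amount to one smoothing with
  the accumulated scales, and the power of \<open>T\<close> is absorbed into the bounded function. A
  lower bound common to all scales turns the weighted sum in \<open>smoothing_shift_bound\<close>
  into the norm of \<open>h\<close>, whatever \<open>N\<close> is.\<close>

lemma galerkin_gradient_bound:
  fixes e :: "nat \<Rightarrow> 'h::{real_inner, banach, second_countable_topology}"
  assumes ob: "orthonormal_basis e"
    and \<alpha>: "1 < \<alpha>" "\<alpha> < 2" and g: "1 / \<alpha> \<le> g" "g < 1" and C1: "0 < C1"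
    and \<gamma>: "\<And>n. 0 < \<gamma> n" and \<beta>: "\<And>n. C1 * \<gamma> n powr (1 / \<alpha> - g) \<le> \<beta> n"
    and \<delta>: "0 < \<delta>" "\<And>n. n < N \<Longrightarrow> \<gamma> n * \<delta> \<le> 1"
    and T: "bounded_linear T" and Te: "\<And>n. T (e n) = exp (- \<gamma> n * \<delta>) *\<^sub>R e n"
    and rd: "\<And>n. real_distribution (\<kappa> n)"
    and ch: "\<And>n h. char (\<kappa> n) h = of_real (exp (- (\<delta> * \<beta> n powr \<alpha> * \<bar>h\<bar> powr \<alpha>)))"
    and f: "bcont B f" and j: "1 \<le> j" and h: "proj e N h = h"
  shows "\<bar>((\<lambda>f. smoothing \<kappa> e N (f \<circ> T)) ^^ j) f (z + h) - ((\<lambda>f. smoothing \<kappa> e N (f \<circ> T)) ^^ j) f z\<bar>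
    \<le> gradient_const \<alpha> C1 * (real j * \<delta>) powr - g * B * norm h"
proof -
  obtain i where i: "j = Suc i" using j by (cases j) auto
  have fB: "\<And>z. \<bar>f z\<bar> \<le> B" and fm: "f \<in> borel_measurable borel"
    using f by (auto simp: bcont_def intro: borel_measurable_continuous_onI)
  have B: "0 \<le> B" using fB[of undefined] by linarith
  define q where "q n = exp (- \<gamma> n * \<delta>)" for n
  define s where "s n = \<delta> * \<beta> n powr \<alpha> * (\<Sum>l\<le>i. (1 / q n) powr (\<alpha> * real l))" for n
  have \<beta>0: "0 < \<beta> n" for n
  proof -
    have "0 < C1 * \<gamma> n powr (1 / \<alpha> - g)" using C1 \<gamma>[of n] by simp
    then show ?thesis using \<beta>[of n] by linarith
  qed
  have s: "0 < s n" for n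
  proof -
    have "0 < (\<Sum>l\<le>i. (1 / q n) powr (\<alpha> * real l))" by (intro sum_pos) (auto simp: q_def)
    moreover have "0 < \<beta> n powr \<alpha>" using \<beta>0[of n] by simp
    ultimately show ?thesis unfolding s_def using \<delta>(1) by simp
  qed
  have Te': "\<And>n. T (e n) = q n *\<^sub>R e n" and q0: "\<And>n. 0 < q n" by (simp_all add: Te q_def)
  from smoothing_iterate[where e=e and N=N and q=q and \<kappa>=\<kappa> and s="\<lambda>n. \<delta> * \<beta> n powr \<alpha>" and j=i, OF T Te' q0 rd ch]
  obtain \<kappa>' where rd': "\<And>n. real_distribution (\<kappa>' n)"
    and ch': "\<And>n h. char (\<kappa>' n) h = of_real (exp (- (s n * \<bar>h\<bar> powr \<alpha>)))"
    and eq': "\<forall>g\<in>borel_measurable borel. \<forall>B. (\<forall>z. \<bar>g z\<bar> \<le> B) \<longrightarrow>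
       ((\<lambda>f. smoothing \<kappa> e N (f \<circ> T)) ^^ Suc i) g = smoothing \<kappa>' e N (g \<circ> (T ^^ Suc i))"
    unfolding s_def by (elim exE conjE) blast
  have eq: "((\<lambda>f. smoothing \<kappa> e N (f \<circ> T)) ^^ Suc i) f = smoothing \<kappa>' e N (f \<circ> (T ^^ Suc i))"
    using eq' fm fB by blast
  have "continuous_on UNIV (T ^^ Suc i)"
  proof -
    have "continuous_on UNIV (T ^^ l)" for l
    proof (induction l)
      case (Suc l)
      then show ?case
        using continuous_on_compose2[OF linear_continuous_on[OF T, of UNIV] Suc] by (simp add: o_def)
    qed (simp add: id_def)
    then show ?thesis .
  qed
  then have gm: "f \<circ> (T ^^ Suc i) \<in> borel_measurable borel"
    using fm by (intro measurable_comp[OF borel_measurable_continuous_onI]) auto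
  have ch'': "char (\<kappa>' n) h = of_real (exp (- (\<bar>s n powr (1 / \<alpha>) * h\<bar> powr \<alpha>)))" for n h
  proof -
    have "\<bar>s n powr (1 / \<alpha>) * h\<bar> powr \<alpha> = s n * \<bar>h\<bar> powr \<alpha>"
      using s[of n] \<alpha> by (simp add: abs_mult powr_mult powr_powr)
    then show ?thesis by (simp only: ch')
  qed
  have sp: "0 < s n powr (1 / \<alpha>)" for n using s[of n] by simp
  have hs: "h = (\<Sum>n<N. (h \<bullet> e n) *\<^sub>R e n)" using h by (simp add: proj_def)
  have "\<bar>smoothing \<kappa>' e N (f \<circ> (T ^^ Suc i)) (z + (\<Sum>n<N. (h \<bullet> e n) *\<^sub>R e n)) - smoothing \<kappa>' e N (f \<circ> (T ^^ Suc i)) z\<bar>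
    \<le> B * sqrt (inv_moment \<alpha>) * sqrt (\<Sum>n<N. ((h \<bullet> e n) / s n powr (1 / \<alpha>))\<^sup>2)"
    using sp fB by (intro smoothing_shift_bound[OF \<alpha> _ rd' ch'' gm]) auto
  also have "\<dots> \<le> B * (sqrt (inv_moment \<alpha>) + 1) * ((4 * exp 2) / C1 * (real j * \<delta>) powr - g * norm h)"
  proof (intro mult_mono)
    let ?a = "C1 * (real j * \<delta>) powr g / (4 * exp 2)"
    have a: "0 < ?a" using C1 \<delta>(1) i by simp
    have sa: "?a \<le> s n powr (1 / \<alpha>)" if "n < N" for n
      unfolding s_def q_def i using accumulated_scale_lower_bound[OF \<alpha> g C1 \<gamma> \<beta> \<delta>(1) \<delta>(2)[OF that]] .
    have "sqrt (\<Sum>n<N. ((h \<bullet> e n) / s n powr (1 / \<alpha>))\<^sup>2) \<le> sqrt (\<Sum>n<N. (1 / ?a)\<^sup>2 * (h \<bullet> e n)\<^sup>2)"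
    proof (intro real_sqrt_le_mono sum_mono)
      fix n assume n: "n \<in> {..<N}"
      have gen: "(u / d)\<^sup>2 \<le> (1 / b)\<^sup>2 * u\<^sup>2" if "0 < b" "b \<le> d" for u b d :: real
      proof -
        have "u\<^sup>2 / d\<^sup>2 \<le> u\<^sup>2 / b\<^sup>2" using that by (intro divide_left_mono power_mono mult_pos_pos) auto
        then show ?thesis by (simp add: power_divide)
      qed
      show "((h \<bullet> e n) / s n powr (1 / \<alpha>))\<^sup>2 \<le> (1 / ?a)\<^sup>2 * (h \<bullet> e n)\<^sup>2"
        using n by (intro gen a sa) simp
    qed
    also have "\<dots> = sqrt ((1 / ?a)\<^sup>2 * (norm h)\<^sup>2)"
    proof -
      have "(norm h)\<^sup>2 = (\<Sum>n<N. (h \<bullet> e n)\<^sup>2)"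
        by (subst hs, subst norm_sum_basis[OF ob]) simp_all
      then show ?thesis by (simp only: sum_distrib_left)
    qed
    also have "\<dots> = (1 / ?a) * norm h" 
      by (simp only: real_sqrt_mult real_sqrt_abs abs_of_pos[OF divide_pos_pos[OF zero_less_one a]] abs_norm_cancel)
    also have "1 / ?a = (4 * exp 2) / C1 * (real j * \<delta>) powr - g" using C1 \<delta>(1) i by (simp add: powr_minus field_simps)
    finally show "sqrt (\<Sum>n<N. ((h \<bullet> e n) / s n powr (1 / \<alpha>))\<^sup>2) \<le> (4 * exp 2) / C1 * (real j * \<delta>) powr - g * norm h" .
  qed (use B in \<open>auto simp: inv_moment_def intro!: mult_nonneg_nonneg sum_nonneg\<close>)
  also have "\<dots> = gradient_const \<alpha> C1 * (real j * \<delta>) powr - g * B * norm h"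
    by (simp add: gradient_const_def field_simps)
  finally show ?thesis unfolding i eq hs[symmetric] .
qed

lemma sup_norm_ge:
  assumes "bounded (range f)"
  shows "norm (f x) \<le> sup_norm f"
proof -
  have "bdd_above (range (\<lambda>x. norm (f x)))"
    using assms unfolding bounded_iff bdd_above_def by auto
  then show ?thesis unfolding sup_norm_def by (intro cSUP_upper) auto
qed

text \<open>A time up to which \<open>a * s powr (1 - g) \<le> 1 / 2\<close> holds with
  \<open>a = C * \<Phi> * (4 / (1 - g))\<close>. The denominator \<open>2 * a + 1\<close> covers
  \<open>a = 0\<close>, and the cap at 1 keeps negative powers of the time at least 1.\<close>

definition short_time :: "real \<Rightarrow> real \<Rightarrow> real \<Rightarrow> real" where
  "short_time C g \<Phi> = min 1 ((1 / (2 * (C * \<Phi> * (4 / (1 - g))) + 1)) powr (1 / (1 - g)))"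

lemma short_time:
  assumes C: "0 \<le> C" and \<Phi>: "0 \<le> \<Phi>" and g: "g < 1"
  shows "0 < short_time C g \<Phi>" "short_time C g \<Phi> \<le> 1"
    "\<And>s. 0 \<le> s \<Longrightarrow> s \<le> short_time C g \<Phi> \<Longrightarrow> C * \<Phi> * (4 / (1 - g) * s powr (1 - g)) \<le> 1 / 2"
proof -
  define a where "a = C * \<Phi> * (4 / (1 - g))"
  have a: "0 \<le> a" unfolding a_def using C \<Phi> g by (intro mult_nonneg_nonneg) auto
  show "0 < short_time C g \<Phi>" "short_time C g \<Phi> \<le> 1"
    using a unfolding short_time_def a_def[symmetric] by auto
  fix s assume s: "0 \<le> s" "s \<le> short_time C g \<Phi>"
  have "s powr (1 - g) \<le> ((1 / (2 * a + 1)) powr (1 / (1 - g))) powr (1 - g)"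
    using s g unfolding short_time_def a_def[symmetric] by (intro powr_mono2) auto
  also have "\<dots> = 1 / (2 * a + 1)" using a g by (simp add: powr_powr)
  finally have "a * s powr (1 - g) \<le> a * (1 / (2 * a + 1))" using a by (intro mult_left_mono)
  also have "\<dots> \<le> 1 / 2" using a by (simp add: field_simps)
  finally show "C * \<Phi> * (4 / (1 - g) * s powr (1 - g)) \<le> 1 / 2" by (simp add: a_def mult_ac)
qed

text \<open>The factor 2 is that of \<open>perturbed_gradient_bound\<close>. Half of the short time
  appears because the last grid point before it may fall short by one step, which is at most that
  half.\<close>

definition lipschitz_const :: "real \<Rightarrow> real \<Rightarrow> real \<Rightarrow> real \<Rightarrow> real" where
  "lipschitz_const \<alpha> g C1 \<Phi> =
    2 * gradient_const \<alpha> C1 * (short_time (gradient_const \<alpha> C1) g \<Phi> / 2) powr - g"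

text \<open>Iterates compose: \<open>j\<close> steps from the initial points regularise, and the
  other \<open>m - j\<close> steps merely turn \<open>f\<close> into another function with the bound
  \<open>B\<close>. The gradient bound never needs more than a short time.\<close>

lemma galerkin_lipschitz_bound:
  fixes e :: "nat \<Rightarrow> 'h::{real_inner, banach, second_countable_topology}" and Q :: "('h \<Rightarrow> real) \<Rightarrow> 'h \<Rightarrow> real"
  assumes ob: "orthonormal_basis e"
    and \<alpha>: "1 < \<alpha>" "\<alpha> < 2" and g: "1 / \<alpha> \<le> g" "g < 1" and C1: "0 < C1"
    and \<gamma>: "\<And>n. 0 < \<gamma> n" and \<beta>: "\<And>n. C1 * \<gamma> n powr (1 / \<alpha> - g) \<le> \<beta> n"
    and \<delta>: "0 < \<delta>" "\<And>n. n < N \<Longrightarrow> \<gamma> n * \<delta> \<le> 1"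
    and T: "bounded_linear T" and Te: "\<And>n. T (e n) = exp (- \<gamma> n * \<delta>) *\<^sub>R e n"
    and rd: "\<And>n. real_distribution (\<kappa> n)"
    and ch: "\<And>n h. char (\<kappa> n) h = of_real (exp (- (\<delta> * \<beta> n powr \<alpha> * \<bar>h\<bar> powr \<alpha>)))"
    and F: "continuous_on UNIV F" "\<And>z. norm (F z) \<le> \<Phi>"
    and Q: "\<And>f z. Q f z = smoothing \<kappa> e N (f \<circ> T) (z + \<delta> *\<^sub>R proj e N (F z))"
    and m: "real m * \<delta> = t" "0 < t" and small: "\<delta> \<le> short_time (gradient_const \<alpha> C1) g \<Phi> / 2"
    and f: "bcont B f"
  shows "\<And>f B. bcont B f \<Longrightarrow> bcont B (Q f)"
    and "\<bar>(Q ^^ m) f (proj e N x) - (Q ^^ m) f (proj e N y)\<bar> \<le>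
      lipschitz_const \<alpha> g C1 \<Phi> * (norm (x - y) + 2 * \<Phi> * \<delta>) * (1 / min (t powr g) 1) * B"
proof -
  let ?C = "gradient_const \<alpha> C1"
  have C: "0 < ?C" by (rule gradient_const_pos[OF C1])
  have \<Phi>: "0 \<le> \<Phi>" using F(2)[of 0] norm_ge_zero[of "F 0"] by linarith
  have g0: "0 < g" using g(1) \<alpha> by (meson less_le_trans zero_less_divide_1_iff less_trans zero_less_one)
  have B: "0 \<le> B" using f unfolding bcont_def by (meson abs_ge_zero order_trans)
  define V where "V = {z :: 'h. proj e N z = z}"
  note P = bounded_linear_proj[OF ob, of N]
  have Tc: "continuous_on UNIV T" by (rule linear_continuous_on[OF T])
  have fT: "bcont B (f \<circ> T)" if "bcont B f" for f B
    using that Tc continuous_on_compose2[of UNIV f UNIV T] by (auto simp: bcont_def o_def)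
  interpret K: perturbed_kernel "\<lambda>f. smoothing \<kappa> e N (f \<circ> T)" V "\<lambda>z. proj e N (F z)" \<delta> \<Phi> ?C g
  proof
    show "bcont B (smoothing \<kappa> e N (f \<circ> T))" if "bcont B f" for f B
      by (rule smoothing_bcont(1)[OF rd fT[OF that]])
    show "smoothing \<kappa> e N ((\<lambda>z. f z - f' z) \<circ> T) = (\<lambda>z. smoothing \<kappa> e N (f \<circ> T) z - smoothing \<kappa> e N (f' \<circ> T) z)"
      if "bcont B f" "bcont B' f'" for f f' B B'
      using smoothing_bcont(2)[OF rd fT[OF that(1)]] smoothing_bcont(2)[OF rd fT[OF that(2)]]
      by (simp add: smoothing_def fun_eq_iff)
    show "\<bar>((\<lambda>f. smoothing \<kappa> e N (f \<circ> T)) ^^ j) f (z + h) - ((\<lambda>f. smoothing \<kappa> e N (f \<circ> T)) ^^ j) f z\<bar>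
      \<le> ?C * (real j * \<delta>) powr - g * B * norm h"
      if "bcont B f" "1 \<le> j" "h \<in> V" for f B j z h
      using that by (intro galerkin_gradient_bound[OF ob \<alpha> g C1 \<gamma> \<beta> \<delta> T Te rd ch]) (auto simp: V_def)
    show "subspace V" unfolding V_def subspace_def by (auto simp: linear_simps[OF P])
    show "continuous_on UNIV (\<lambda>z. proj e N (F z))"
      using continuous_on_compose2[OF linear_continuous_on[OF P, of UNIV] F(1)] by simp
    show "proj e N (F z) \<in> V" for z by (simp add: V_def proj_idem[OF ob])
    show "norm (proj e N (F z)) \<le> \<Phi>" for z using norm_proj_le[OF ob, of N "F z"] F(2)[of z] by linarith
  qed (use \<delta> C g g0 in auto)
  have Q_eq: "perturbed_kernel.Q (\<lambda>f. smoothing \<kappa> e N (f \<circ> T)) (\<lambda>z. proj e N (F z)) \<delta> = Q"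
    by (simp add: fun_eq_iff K.Q_def Q)
  note bound = K.perturbed_gradient_bound[unfolded Q_eq] and Qb = K.funpow_Q_bcont[unfolded Q_eq]
  show "bcont B (Q f)" if "bcont B f" for f B using K.Q_bcont[OF that] unfolding Q_eq .
  let ?T0 = "short_time ?C g \<Phi>"
  note T0 = short_time[OF less_imp_le[OF C] \<Phi> g(2)]
  have m0: "0 < m" using m by (cases m) auto
  \<comment> \<open>All steps if \<open>t\<close> is short, otherwise the last grid time within the
    short time. The final alternative bounds the regularising time from below, either by
    \<open>t\<close> or by a constant.\<close>
  obtain j where j: "1 \<le> j" "j \<le> m" "real j * \<delta> \<le> ?T0" "t \<le> real j * \<delta> \<or> ?T0 / 2 \<le> real j * \<delta>"
  proof (cases "t \<le> ?T0")
    case True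
    then show ?thesis using m m0 by (intro that[of m]) auto
  next
    case False
    define j where "j = nat \<lfloor>?T0 / \<delta>\<rfloor>"
    have "0 \<le> ?T0 / \<delta>" using T0(1) \<delta>(1) by simp
    then have "real j = of_int \<lfloor>?T0 / \<delta>\<rfloor>" by (simp add: j_def)
    then have "real j \<le> ?T0 / \<delta>" "?T0 / \<delta> \<le> real j + 1" by linarith+
    then have jd: "real j * \<delta> \<le> ?T0" "?T0 \<le> real j * \<delta> + \<delta>" using \<delta>(1) by (auto simp: field_simps)
    have half: "?T0 / 2 \<le> real j * \<delta>" using jd(2) small by linarith
    have "0 < real j * \<delta>" using half T0(1) by linarith
    then have "1 \<le> j" using \<delta>(1) by (cases j) auto
    moreover have "j \<le> m"
    proof -
      have "real j * \<delta> \<le> real m * \<delta>" using jd(1) False m by linarith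
      then show ?thesis using \<delta>(1) by simp
    qed
    ultimately show ?thesis using jd half by (intro that[of j]) auto
  qed
  have "proj e N x - proj e N y \<in> V"
    using linear_simps(2)[OF P] by (simp add: V_def proj_idem[OF ob])
  then have "\<bar>(Q ^^ j) ((Q ^^ (m - j)) f) (proj e N x) - (Q ^^ j) ((Q ^^ (m - j)) f) (proj e N y)\<bar>
    \<le> 2 * (?C * norm (proj e N x - proj e N y) + 2 * ?C * \<Phi> * \<delta>) * (real j * \<delta>) powr - g * B"
    using \<delta>(1) j by (intro bound Qb f T0(3)) auto
  moreover have "(Q ^^ j) ((Q ^^ (m - j)) f) = (Q ^^ m) f"
    using j(2) by (simp add: funpow_add[symmetric, THEN fun_cong, unfolded o_apply])
  ultimately have "\<bar>(Q ^^ m) f (proj e N x) - (Q ^^ m) f (proj e N y)\<bar>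
    \<le> 2 * (?C * norm (proj e N x - proj e N y) + 2 * ?C * \<Phi> * \<delta>) * (real j * \<delta>) powr - g * B" by simp
  also have "\<dots> \<le> 2 * (?C * norm (x - y) + 2 * ?C * \<Phi> * \<delta>) * ((?T0 / 2) powr - g * (1 / min (t powr g) 1)) * B"
  proof (rule mult_right_mono[OF mult_mono])
    have "norm (proj e N x - proj e N y) \<le> norm (x - y)"
      using norm_proj_le[OF ob, of N "x - y"] by (simp add: linear_simps[OF P])
    then show "2 * (?C * norm (proj e N x - proj e N y) + 2 * ?C * \<Phi> * \<delta>) \<le> 2 * (?C * norm (x - y) + 2 * ?C * \<Phi> * \<delta>)"
      using C by simp
    have tp: "0 < t powr g" using m(2) by simp
    have T01: "1 \<le> (?T0 / 2) powr - g"
    proof -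
      have "1 powr - g \<le> (?T0 / 2) powr - g" using T0(1,2) g0 by (intro powr_mono2') auto
      then show ?thesis by simp
    qed
    show "(real j * \<delta>) powr - g \<le> (?T0 / 2) powr - g * (1 / min (t powr g) 1)"
      using j(4)
    proof
      assume "t \<le> real j * \<delta>"
      then have "(real j * \<delta>) powr - g \<le> t powr - g" using m(2) g0 by (intro powr_mono2') auto
      also have "\<dots> = 1 / t powr g" by (simp add: powr_minus divide_inverse)
      also have "\<dots> \<le> 1 / min (t powr g) 1" using tp by (intro divide_left_mono) auto
      also have "\<dots> = 1 * (1 / min (t powr g) 1)" by simp
      also have "\<dots> \<le> (?T0 / 2) powr - g * (1 / min (t powr g) 1)"
        using T01 tp by (intro mult_right_mono) auto
      finally show ?thesis .
    next
      assume "?T0 / 2 \<le> real j * \<delta>"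
      then have "(real j * \<delta>) powr - g \<le> (?T0 / 2) powr - g" using T0(1) g0 by (intro powr_mono2') auto
      also have "\<dots> = (?T0 / 2) powr - g * 1" by simp
      also have "\<dots> \<le> (?T0 / 2) powr - g * (1 / min (t powr g) 1)"
        using tp by (intro mult_left_mono) auto
      finally show ?thesis .
    qed
  qed (use B C \<Phi> \<delta> in \<open>auto intro!: mult_nonneg_nonneg add_nonneg_nonneg\<close>)
  also have "\<dots> = lipschitz_const \<alpha> g C1 \<Phi> * (norm (x - y) + 2 * \<Phi> * \<delta>) * (1 / min (t powr g) 1) * B"
    unfolding lipschitz_const_def by (simp add: algebra_simps)
  finally show "\<bar>(Q ^^ m) f (proj e N x) - (Q ^^ m) f (proj e N y)\<bar> \<le>
      lipschitz_const \<alpha> g C1 \<Phi> * (norm (x - y) + 2 * \<Phi> * \<delta>) * (1 / min (t powr g) 1) * B" .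
qed

lemma predictable_process_measurable:
  fixes X :: "real \<Rightarrow> 'w \<Rightarrow> 'h::topological_space"
  assumes sb: "stochastic_basis M Fil" and X: "predictable_process M Fil X" and t: "0 \<le> t"
  shows "X t \<in> borel_measurable M"
  using measurable_Pair2[OF predictable_measurable_pair[OF sb X], of t] t by simp

text \<open>For the scheme the expectation is \<open>(Q ^^ Suc m) f\<close>, which obeys the uniform
  bound. Closeness in probability transfers to expectations because \<open>f\<close> is bounded and
  Lipschitz; its Lipschitz constant multiplies only the error \<open>\<epsilon>\<close> and is
  absent from the final bound.\<close>

lemma lipschitz_expectation_bound:
  fixes e :: "nat \<Rightarrow> 'h::{real_inner, banach, second_countable_topology}"
    and F :: "'h \<Rightarrow> 'h" and X :: "'h \<Rightarrow> real \<Rightarrow> 'w \<Rightarrow> 'h" and f :: "'h \<Rightarrow> real"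
  assumes \<alpha>: "1 < \<alpha>" "\<alpha> < 2"
    and sb: "stochastic_basis M Fil" and levy: "\<And>n. stable_levy_process M Fil \<alpha> (Z n)"
    and indZ: "independent_processes M Z" and ob: "orthonormal_basis e"
    and \<beta>0: "\<And>n. 0 < \<beta> n" and \<gamma>0: "\<And>n. 0 < \<gamma> n" and \<gamma>inf: "filterlim \<gamma> at_top sequentially"
    and sa: "self_adjoint_op D A" and eig: "\<And>n. e n \<in> D \<and> A (e n) = - \<gamma> n *\<^sub>R e n"
    and gen: "semigroup_generated_by D A S"
    and lip: "L0-lipschitz_on UNIV F" and \<Phi>: "\<And>z. norm (F z) \<le> \<Phi>"
    and g: "1 / \<alpha> \<le> g" "g < 1" and C1: "0 < C1" and \<beta>: "\<And>n. C1 * \<gamma> n powr (1 / \<alpha> - g) \<le> \<beta> n"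
    and conv: "stochastic_convolution M Fil Z e \<beta> \<gamma> ZA"
    and mild: "\<And>x. mild_solution M Fil S F ZA x (X x)"
    and t: "0 < t" and f: "Lf-lipschitz_on UNIV f" and f1: "\<And>z. \<bar>f z\<bar> \<le> 1"
  shows "\<bar>(\<integral>\<omega>. f (X x t \<omega>) \<partial>M) - (\<integral>\<omega>. f (X y t \<omega>) \<partial>M)\<bar>
    \<le> lipschitz_const \<alpha> g C1 \<Phi> * (1 / min (t powr g) 1) * norm (x - y)"
proof -
  interpret prob_space M using sb by (simp add: stochastic_basis_def)
  note sg = ob \<gamma>0 \<gamma>inf sa eig gen
  have levy': "levy_process M Fil (Z n)" for n using levy[of n] by (simp add: stable_levy_process_def)
  have \<Phi>0: "0 \<le> \<Phi>" using \<Phi>[of 0] norm_ge_zero[of "F 0"] by linarith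
  have Fc: "continuous_on UNIV F" using lip by (rule lipschitz_on_continuous_on)
  have fc: "continuous_on UNIV f" using f by (rule lipschitz_on_continuous_on)
  have fb: "bcont 1 f" using fc f1 by (simp add: bcont_def)
  have [measurable]: "f \<in> borel_measurable borel" using fc by (rule borel_measurable_continuous_onI)
  have Xm[measurable]: "X x t \<in> borel_measurable M" for x
    using mild[of x] t by (intro predictable_process_measurable[OF sb]) (auto simp: mild_solution_def)
  define \<delta> where "\<delta> m = t / real (Suc m)" for m
  have \<delta>: "0 < \<delta> m" "real (Suc m) * \<delta> m = t" for m using t by (auto simp: \<delta>_def)
  have \<delta>0: "\<delta> \<longlonglongrightarrow> 0" unfolding \<delta>_def by real_asymp
  define Eul where "Eul N x m \<omega> k = euler (S (\<delta> m)) (\<lambda>z. proj e N (F z)) (\<delta> m) e N (proj e N x)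
    (\<lambda>i. noise_increment Z \<beta> (\<delta> m) i \<omega>) k" for N x m \<omega> k
  have Sl: "bounded_linear (S (\<delta> m))" for m using sg_lin[OF sg, of "\<delta> m"] \<delta>(1)[of m] by simp
  have Sc: "continuous_on UNIV (S (\<delta> m))" for m by (rule linear_continuous_on[OF Sl])
  have PFc: "continuous_on UNIV (\<lambda>z. proj e N (F z))" for N
    by (rule continuous_on_compose2[OF linear_continuous_on[OF bounded_linear_proj[OF ob], of UNIV] Fc]) simp
  have Zm: "0 \<le> s \<Longrightarrow> Z n s \<in> borel_measurable M" for s n
    using levy'[of n] sb by (auto simp: levy_process_def stochastic_basis_def intro: measurable_from_subalg)
  have \<xi>m: "noise_increment Z \<beta> (\<delta> m) i \<in> borel_measurable M" for m i
    using \<delta>(1)[of m] unfolding noise_increment_def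
    by (cases i) (auto intro!: borel_measurable_times borel_measurable_diff Zm simp: less_imp_le)
  have Em[measurable]: "(\<lambda>\<omega>. Eul N x m \<omega> k) \<in> borel_measurable M" for N x m k
    unfolding Eul_def by (rule euler_rv_measurable[OF Sc PFc \<xi>m])
  have approx: "\<bar>(\<integral>\<omega>. f (X x t \<omega>) \<partial>M) - (\<integral>\<omega>. f (Eul N x m \<omega> (Suc m)) \<partial>M)\<bar> \<le> max Lf 2 * \<epsilon>"
    if le: "(\<integral>\<^sup>+\<omega>. ennreal (min 1 (norm (X x t \<omega> - Eul N x m \<omega> (Suc m)))) \<partial>M) \<le> ennreal \<epsilon>" and \<epsilon>: "0 < \<epsilon>" for N x m \<epsilon>
  proof -
    let ?Y = "\<lambda>\<omega>. Eul N x m \<omega> (Suc m)" and ?m = "\<lambda>\<omega>. min 1 (norm (X x t \<omega> - Eul N x m \<omega> (Suc m)))"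
    have i: "integrable M (\<lambda>\<omega>. f (X x t \<omega>))" "integrable M (\<lambda>\<omega>. f (?Y \<omega>))" "integrable M ?m"
      using f1 by (auto intro!: integrable_const_bound[where B=1])
    have pt: "\<bar>f a - f b\<bar> \<le> max Lf 2 * min 1 (norm (a - b))" for a b
    proof (cases "norm (a - b) \<le> 1")
      case True
      have "\<bar>f a - f b\<bar> \<le> Lf * norm (a - b)" using lipschitz_onD[OF f, of a b] by (simp add: dist_norm)
      also have "\<dots> \<le> max Lf 2 * norm (a - b)" by (intro mult_right_mono) auto
      finally show ?thesis using True by simp
    next
      case False
      then show ?thesis using f1[of a] f1[of b] by (simp add: min_def)
    qed
    have "\<bar>(\<integral>\<omega>. f (X x t \<omega>) \<partial>M) - (\<integral>\<omega>. f (?Y \<omega>) \<partial>M)\<bar> = \<bar>\<integral>\<omega>. f (X x t \<omega>) - f (?Y \<omega>) \<partial>M\<bar>" using i by simp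
    also have "\<dots> \<le> (\<integral>\<omega>. \<bar>f (X x t \<omega>) - f (?Y \<omega>)\<bar> \<partial>M)" by (rule integral_abs_bound)
    also have "\<dots> \<le> (\<integral>\<omega>. max Lf 2 * ?m \<omega> \<partial>M)" using i pt by (intro integral_mono) auto
    also have "\<dots> = max Lf 2 * (\<integral>\<omega>. ?m \<omega> \<partial>M)" by simp
    also have "\<dots> \<le> max Lf 2 * \<epsilon>"
    proof (rule mult_left_mono)
      have "ennreal (\<integral>\<omega>. ?m \<omega> \<partial>M) \<le> ennreal \<epsilon>" using le nn_integral_eq_integral[OF i(3)] by simp
      then show "(\<integral>\<omega>. ?m \<omega> \<partial>M) \<le> \<epsilon>" using \<epsilon> by (subst (asm) ennreal_le_iff) auto
    qed simp
    finally show ?thesis .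
  qed
  let ?c = "lipschitz_const \<alpha> g C1 \<Phi>" and ?q = "1 / min (t powr g) 1"
  have c0: "0 \<le> ?c"
    unfolding lipschitz_const_def using gradient_const_pos[OF C1, of \<alpha>] by simp
  have q0: "0 \<le> ?q" using t by simp
  have step: "\<bar>(\<integral>\<omega>. f (X x t \<omega>) \<partial>M) - (\<integral>\<omega>. f (X y t \<omega>) \<partial>M)\<bar> \<le>
    ?c * ?q * norm (x - y) + (2 * max Lf 2 + ?c * ?q * (2 * \<Phi>)) * \<epsilon>" if \<epsilon>: "0 < \<epsilon>" for \<epsilon>
  proof -
    have ec: "\<exists>N0. \<forall>N\<ge>N0. \<exists>m0. \<forall>m\<ge>m0. (\<integral>\<^sup>+\<omega>. ennreal (min 1 (norm (X x t \<omega> - Eul N x m \<omega> (Suc m)))) \<partial>M) \<le> ennreal \<epsilon>" for x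
      unfolding Eul_def \<delta>_def by (rule euler_converges[OF sg sb levy' \<beta>0 conv mild lip \<Phi> t \<epsilon>])
    obtain Nx where Nx: "\<forall>N\<ge>Nx. \<exists>m0. \<forall>m\<ge>m0. (\<integral>\<^sup>+\<omega>. ennreal (min 1 (norm (X x t \<omega> - Eul N x m \<omega> (Suc m)))) \<partial>M) \<le> ennreal \<epsilon>"
      using ec[of x] by blast
    obtain Ny where Ny: "\<forall>N\<ge>Ny. \<exists>m0. \<forall>m\<ge>m0. (\<integral>\<^sup>+\<omega>. ennreal (min 1 (norm (X y t \<omega> - Eul N y m \<omega> (Suc m)))) \<partial>M) \<le> ennreal \<epsilon>"
      using ec[of y] by blast
    \<comment> \<open>One truncation for both starting points, at least 1 because the independence
      statements ask for a nonempty index set.\<close>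
    define N where "N = max 1 (max Nx Ny)"
    have N: "0 < N" "Nx \<le> N" "Ny \<le> N" by (auto simp: N_def)
    obtain mx where mx: "\<forall>m\<ge>mx. (\<integral>\<^sup>+\<omega>. ennreal (min 1 (norm (X x t \<omega> - Eul N x m \<omega> (Suc m)))) \<partial>M) \<le> ennreal \<epsilon>"
      using Nx N(2) by blast
    obtain my where my: "\<forall>m\<ge>my. (\<integral>\<^sup>+\<omega>. ennreal (min 1 (norm (X y t \<omega> - Eul N y m \<omega> (Suc m)))) \<partial>M) \<le> ennreal \<epsilon>"
      using Ny N(3) by blast
    let ?T0 = "short_time (gradient_const \<alpha> C1) g \<Phi>"
    define \<Gamma> where "\<Gamma> = (\<Sum>n<N. \<gamma> n)"
    have \<Gamma>: "\<gamma> n \<le> \<Gamma>" if "n < N" for n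
      unfolding \<Gamma>_def using that \<gamma>0 by (intro member_le_sum) (auto simp: less_imp_le)
    have \<Gamma>0: "0 < \<Gamma>" using \<Gamma>[OF N(1)] \<gamma>0[of 0] by linarith
    have T0: "0 < ?T0" using short_time(1)[OF less_imp_le[OF gradient_const_pos[OF C1]] \<Phi>0 g(2)] .
    \<comment> \<open>The step has to be below \<open>\<epsilon>\<close> for the drift error of the
      gradient bound, below half the short time for the choice of grid time, and below
      \<open>1 / \<Gamma>\<close> so that \<open>\<gamma> n * \<delta> m \<le> 1\<close> on the
      retained modes.\<close>
    have "0 < min \<epsilon> (min (?T0 / 2) (1 / \<Gamma>))" using \<epsilon> T0 \<Gamma>0 by simp
    from order_tendstoD(2)[OF \<delta>0 this]
    obtain m0 where m0: "\<And>m. m0 \<le> m \<Longrightarrow> \<delta> m < min \<epsilon> (min (?T0 / 2) (1 / \<Gamma>))"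
      unfolding eventually_sequentially by blast
    define m where "m = max m0 (max mx my)"
    have m: "\<delta> m < \<epsilon>" "\<delta> m \<le> ?T0 / 2" "\<delta> m < 1 / \<Gamma>" using m0[of m] by (auto simp: m_def)
    have \<gamma>\<delta>: "\<gamma> n * \<delta> m \<le> 1" if "n < N" for n
    proof -
      have "\<gamma> n * \<delta> m \<le> \<Gamma> * (1 / \<Gamma>)" using \<Gamma>[OF that] m(3) \<Gamma>0 \<delta>(1)[of m] by (intro mult_mono) auto
      then show ?thesis using \<Gamma>0 by simp
    qed
    define \<kappa> where "\<kappa> n = distr M borel (\<lambda>\<omega>. \<beta> n * Z n (\<delta> m) \<omega>)" for n
    note law = levy_process_increment_law[where Z=Z and \<beta>=\<beta>, OF sb levy less_imp_le[OF \<delta>(1)[of m]] \<beta>0]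
    have \<kappa>: "real_distribution (\<kappa> n)"
      "char (\<kappa> n) h = of_real (exp (- (\<delta> m * \<beta> n powr \<alpha> * \<bar>h\<bar> powr \<alpha>)))"
      "distr M borel (noise_increment Z \<beta> (\<delta> m) (n, k)) = \<kappa> n" for n h k
      unfolding \<kappa>_def by (rule law)+
    define Q where "Q f z = smoothing \<kappa> e N (f \<circ> S (\<delta> m)) (z + \<delta> m *\<^sub>R proj e N (F z))" for f z
    have Te: "S (\<delta> m) (e n) = exp (- \<gamma> n * \<delta> m) *\<^sub>R e n" for n
      by (rule sg_basis[OF sg less_imp_le[OF \<delta>(1)]])
    note bound = galerkin_lipschitz_bound[where N=N and \<kappa>=\<kappa> and T="S (\<delta> m)" and \<delta>="\<delta> m" and Q=Q and \<gamma>=\<gamma> and \<beta>=\<beta>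
        and F=F, OF ob \<alpha> g C1 \<gamma>0 \<beta> \<delta>(1)[of m] \<gamma>\<delta> Sl[of m] Te \<kappa>(1,2) Fc \<Phi> Q_def \<delta>(2)[of m] t m(2) fb]
    have E: "(\<integral>\<omega>. f (Eul N z m \<omega> (Suc m)) \<partial>M) = (Q ^^ Suc m) f (proj e N z)" for z
      unfolding Eul_def
      by (rule euler_expectation[OF prob_space_axioms N(1)
            noise_increment_indep[OF sb levy' indZ less_imp_le[OF \<delta>(1)] N(1)] _ Sc PFc bound(1) Q_def order_refl fb])
        (simp_all add: \<kappa>(3))
    have "\<bar>(Q ^^ Suc m) f (proj e N x) - (Q ^^ Suc m) f (proj e N y)\<bar> \<le> ?c * (norm (x - y) + 2 * \<Phi> * \<delta> m) * ?q * 1"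
      by (rule bound(2))
    also have "\<dots> \<le> ?c * (norm (x - y) + 2 * \<Phi> * \<epsilon>) * ?q * 1"
      using m(1) \<Phi>0 c0 q0 by (intro mult_right_mono mult_left_mono add_left_mono) auto
    finally have QQ: "\<bar>(Q ^^ Suc m) f (proj e N x) - (Q ^^ Suc m) f (proj e N y)\<bar> \<le> ?c * (norm (x - y) + 2 * \<Phi> * \<epsilon>) * ?q * 1" .
    have "mx \<le> m" "my \<le> m" by (auto simp: m_def)
    then have "\<bar>(\<integral>\<omega>. f (X x t \<omega>) \<partial>M) - (Q ^^ Suc m) f (proj e N x)\<bar> \<le> max Lf 2 * \<epsilon>"
      "\<bar>(\<integral>\<omega>. f (X y t \<omega>) \<partial>M) - (Q ^^ Suc m) f (proj e N y)\<bar> \<le> max Lf 2 * \<epsilon>"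
      unfolding E[symmetric] using mx my \<epsilon> by (auto intro!: approx)
    with QQ have "\<bar>(\<integral>\<omega>. f (X x t \<omega>) \<partial>M) - (\<integral>\<omega>. f (X y t \<omega>) \<partial>M)\<bar> \<le>
      max Lf 2 * \<epsilon> + ?c * (norm (x - y) + 2 * \<Phi> * \<epsilon>) * ?q * 1 + max Lf 2 * \<epsilon>" by linarith
    also have "\<dots> = ?c * ?q * norm (x - y) + (2 * max Lf 2 + ?c * ?q * (2 * \<Phi>)) * \<epsilon>" by (simp only: algebra_simps)
    finally show ?thesis .
  qed
  let ?K = "2 * max Lf 2 + ?c * ?q * (2 * \<Phi>)"
  have K: "0 < ?K"
    using c0 q0 \<Phi>0 by (intro add_pos_nonneg mult_nonneg_nonneg) auto
  show ?thesis
  proof (rule field_le_epsilon)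
    fix \<epsilon> :: real assume "0 < \<epsilon>"
    then have "0 < \<epsilon> / ?K" using K by simp
    from step[OF this] show "\<bar>(\<integral>\<omega>. f (X x t \<omega>) \<partial>M) - (\<integral>\<omega>. f (X y t \<omega>) \<partial>M)\<bar> \<le> ?c * ?q * norm (x - y) + \<epsilon>"
      using K by simp
  qed
qed

theorem theorem5p9:
  fixes \<alpha> :: real
  assumes "1 < \<alpha>" and "\<alpha> < 2"
  shows "\<exists>Ct :: real \<Rightarrow> real \<Rightarrow> real \<Rightarrow> real \<Rightarrow> real.
    \<forall>(M :: 'w measure) (Fil :: real \<Rightarrow> 'w measure) (Z :: nat \<Rightarrow> real \<Rightarrow> 'w \<Rightarrow> real)
      (e :: nat \<Rightarrow> 'h::{real_inner, banach, second_countable_topology})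
      (\<beta> :: nat \<Rightarrow> real) (\<gamma> :: nat \<Rightarrow> real) (D :: 'h set) (A :: 'h \<Rightarrow> 'h)
      (S :: real \<Rightarrow> 'h \<Rightarrow> 'h) (F :: 'h \<Rightarrow> 'h) (ZA :: real \<Rightarrow> 'w \<Rightarrow> 'h)
      (X :: 'h \<Rightarrow> real \<Rightarrow> 'w \<Rightarrow> 'h) (g :: real) (C1 :: real).
      stochastic_basis M Fil \<and> usual_conditions M Fil \<and>
      (\<forall>n. stable_levy_process M Fil \<alpha> (Z n)) \<and> independent_processes M Z \<and>
      orthonormal_basis e \<and>
      (\<forall>n. 0 < \<beta> n) \<and> (\<forall>n. 0 < \<gamma> n) \<and> filterlim \<gamma> at_top sequentially \<and>
      self_adjoint_op D A \<and> (\<forall>n. e n \<in> D \<and> A (e n) = - \<gamma> n *\<^sub>R e n) \<and>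
      semigroup_generated_by D A S \<and>
      summable (\<lambda>n. \<beta> n powr \<alpha> / \<gamma> n) \<and>
      lipschitz F \<and> bounded (range F) \<and>
      1 / \<alpha> \<le> g \<and> g < 1 \<and> 0 < C1 \<and> (\<forall>n. \<beta> n \<ge> C1 * \<gamma> n powr (1 / \<alpha> - g)) \<and>
      stochastic_convolution M Fil Z e \<beta> \<gamma> ZA \<and>
      (\<forall>x. mild_solution M Fil S F ZA x (X x))
      \<longrightarrow>
      (\<forall>t>0. \<forall>f\<in>bounded_borel. lipschitz (transition_semigroup M X t f)) \<and>
      0 < Ct g (c_stable \<alpha>) C1 (sup_norm F) \<and>
      (\<forall>x y. \<forall>t>0. \<forall>f\<in>bounded_borel.
         \<bar>transition_semigroup M X t f x - transition_semigroup M X t f y\<bar>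
         \<le> Ct g (c_stable \<alpha>) C1 (sup_norm F) * sup_norm f * (1 / min (t powr g) 1) * norm (x - y))"
\<comment> \<open>\<open>Ct\<close> is chosen after \<open>\<alpha>\<close>, so it may depend on
  \<open>\<alpha>\<close> through \<open>inv_moment \<alpha>\<close>, the number that controls the
  Hellinger distance between a stable law and its translates.\<close>
proof (intro exI[of _ "\<lambda>g _ C1 \<Phi>. lipschitz_const \<alpha> g C1 \<Phi>"] allI impI, elim conjE)
  fix M :: "'w measure" and Fil :: "real \<Rightarrow> 'w measure" and Z :: "nat \<Rightarrow> real \<Rightarrow> 'w \<Rightarrow> real"
    and e :: "nat \<Rightarrow> 'h" and \<beta> \<gamma> :: "nat \<Rightarrow> real" and D :: "'h set" and A :: "'h \<Rightarrow> 'h"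
    and S :: "real \<Rightarrow> 'h \<Rightarrow> 'h" and F :: "'h \<Rightarrow> 'h" and ZA :: "real \<Rightarrow> 'w \<Rightarrow> 'h"
    and X :: "'h \<Rightarrow> real \<Rightarrow> 'w \<Rightarrow> 'h" and g C1 :: real
  assume sb: "stochastic_basis M Fil" and levy: "\<forall>n. stable_levy_process M Fil \<alpha> (Z n)"
    and indZ: "independent_processes M Z" and ob: "orthonormal_basis e"
    and \<beta>0: "\<forall>n. 0 < \<beta> n" and \<gamma>0: "\<forall>n. 0 < \<gamma> n" and \<gamma>inf: "filterlim \<gamma> at_top sequentially"
    and sa: "self_adjoint_op D A" and eig: "\<forall>n. e n \<in> D \<and> A (e n) = - \<gamma> n *\<^sub>R e n"
    and gen: "semigroup_generated_by D A S"
    and lip: "lipschitz F" and bdd: "bounded (range F)"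
    and g: "1 / \<alpha> \<le> g" "g < 1" and C1: "0 < C1" and \<beta>: "\<forall>n. C1 * \<gamma> n powr (1 / \<alpha> - g) \<le> \<beta> n"
    and conv: "stochastic_convolution M Fil Z e \<beta> \<gamma> ZA"
    and mild: "\<forall>x. mild_solution M Fil S F ZA x (X x)"
  interpret prob_space M using sb by (simp add: stochastic_basis_def)
  let ?c = "lipschitz_const \<alpha> g C1 (sup_norm F)"
  obtain L0 where L0: "L0-lipschitz_on UNIV F" using lip by (auto simp: lipschitz_def)
  have \<Phi>: "norm (F z) \<le> sup_norm F" for z by (rule sup_norm_ge[OF bdd])
  have \<Phi>0: "0 \<le> sup_norm F" using \<Phi>[of 0] norm_ge_zero[of "F 0"] by linarith
  have c: "0 < ?c"
  proof -
    have "0 < short_time (gradient_const \<alpha> C1) g (sup_norm F)"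
      by (rule short_time(1)[OF less_imp_le[OF gradient_const_pos[OF C1]] \<Phi>0 g(2)])
    then show ?thesis unfolding lipschitz_const_def using gradient_const_pos[OF C1, of \<alpha>] by simp
  qed
  have main: "\<bar>transition_semigroup M X t f x - transition_semigroup M X t f y\<bar>
      \<le> ?c * sup_norm f * (1 / min (t powr g) 1) * norm (x - y)"
    if t: "0 < t" and f: "f \<in> bounded_borel" for x y t f
  proof -
    have [measurable]: "f \<in> borel_measurable borel" and fB: "\<And>z. \<bar>f z\<bar> \<le> sup_norm f"
      using f sup_norm_ge[of f] by (auto simp: bounded_borel_def)
    have Xm[measurable]: "X x t \<in> borel_measurable M" for x
      using mild t by (intro predictable_process_measurable[OF sb]) (auto simp: mild_solution_def)
    have tr: "transition_semigroup M X t h x = (\<integral>z. h z \<partial>distr M borel (X x t))"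
      if [measurable]: "h \<in> borel_measurable borel" for h x
      unfolding transition_semigroup_def by (subst integral_distr) auto
    \<comment> \<open>In terms of the laws of \<open>X x t\<close> and \<open>X y t\<close> the
      passage to Borel functions concerns two probability measures on \<open>'h\<close>;
      completeness and second countability supply their inner regularity.\<close>
    have "\<bar>(\<integral>z. f z \<partial>distr M borel (X x t)) - (\<integral>z. f z \<partial>distr M borel (X y t))\<bar>
      \<le> sup_norm f * (?c * (1 / min (t powr g) 1) * norm (x - y))"
    proof (rule bounded_borel_integral_diff_bound)
      fix h :: "'h \<Rightarrow> real" and L assume h: "L-lipschitz_on UNIV h" "\<And>x. \<bar>h x\<bar> \<le> 1"
      have hm: "h \<in> borel_measurable borel"
        using h(1) by (intro borel_measurable_continuous_onI lipschitz_on_continuous_on)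
      show "\<bar>(\<integral>z. h z \<partial>distr M borel (X x t)) - (\<integral>z. h z \<partial>distr M borel (X y t))\<bar>
        \<le> ?c * (1 / min (t powr g) 1) * norm (x - y)"
        unfolding tr[OF hm, symmetric] unfolding transition_semigroup_def
        by (rule lipschitz_expectation_bound[OF assms sb spec[OF levy] indZ ob spec[OF \<beta>0] spec[OF \<gamma>0] \<gamma>inf sa spec[OF eig]
              gen L0 \<Phi> g C1 spec[OF \<beta>] conv spec[OF mild] t h])
    qed (use fB in \<open>auto intro!: prob_space_distr\<close>)
    then show ?thesis by (simp add: tr mult_ac)
  qed
  have "lipschitz (transition_semigroup M X t f)" if t: "0 < t" and f: "f \<in> bounded_borel" for t f
    unfolding lipschitz_def
  proof (intro exI lipschitz_onI)
    have "0 \<le> sup_norm f"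
      using sup_norm_ge[of f undefined] f norm_ge_zero[of "f undefined"] by (auto simp: bounded_borel_def)
    then show "0 \<le> ?c * sup_norm f * (1 / min (t powr g) 1)" using c t by simp
    show "dist (transition_semigroup M X t f x) (transition_semigroup M X t f y)
      \<le> ?c * sup_norm f * (1 / min (t powr g) 1) * dist x y" for x y
      using main[OF t f, of x y] by (simp add: dist_real_def dist_norm)
  qed
  then show "(\<forall>t>0. \<forall>f\<in>bounded_borel. lipschitz (transition_semigroup M X t f)) \<and> 0 < ?c \<and>
    (\<forall>x y. \<forall>t>0. \<forall>f\<in>bounded_borel. \<bar>transition_semigroup M X t f x - transition_semigroup M X t f y\<bar>
      \<le> ?c * sup_norm f * (1 / min (t powr g) 1) * norm (x - y))"
    using main c by blast
qed

end
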